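(* Let $\Omega\subset\mathbb C^n$ be a bounded domain whose Bergman metric $g$ has holomorphic sectional curvature identically equal to a negative constant $-c^2$. Then for every $p\in\Omega$: 1) the Bergman kernel $K(\cdot,p)$ has no zeros on $\Omega$; 2) the Bergman representative coordinate $T=(w_1,\dots,w_n)^\tau$ at $p$ is holomorphic on $\Omega$ and maps $\Omega$ into $\{(w_1,\dots,w_n)^\tau: \sum_{\alpha,\beta=1}^n w_\alpha g_{\alpha\bar\beta}(p)\overline{w_\beta}<2c^{-2}\}$; 3) the Bergman-Calabi diastasis relative to $p$ satisfies $$\Phi_p(z)=\frac{-2}{c^2}\log\Big(1-\frac{c^2}{2}\sum_{\alpha,\beta=1}^n w_\alpha(z)g_{\alpha\bar\beta}(p)\overline{w_\beta(z)}\Big),\quad z\in\Omega;$$ 4) for every $z_0\in\Omega$, the length of $\partial\Phi_{z_0}$ measured by $g$ at $p$ satisfies $|\partial\Phi_{z_0}|_g^2(p)<2c^{-2}$.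
   Context: For a bounded domain $\Omega\subset\mathbb C^n$, $K(z,t)$ denotes its Bergman kernel and $g_{\alpha\bar\beta}(z)=\partial^2\log K(z,z)/\partial z_\alpha\partial\overline{z_\beta}$ its Bergman metric; $(g^{\bar j\alpha})=(g_{\alpha\bar j})^{-1}$. For $z_0\in\Omega$ the Bergman-Calabi diastasis relative to $z_0$ is $\Phi_{z_0}(z)=\log\frac{K(z,z)K(z_0,z_0)}{|K(z,z_0)|^2}$, defined where $K(z,z_0)\neq0$. The Bergman representative coordinate at $p$ is $T(z)=(w_1(z),\dots,w_n(z))^\tau$ with $w_\alpha(z)=\sum_{j=1}^n g^{\bar j\alpha}(p)\Big(K(z,p)^{-1}\frac{\partial}{\partial\overline{t_j}}\big|_{t=p}K(z,t)-\frac{\partial}{\partial\overline{t_j}}\big|_{t=p}\log K(t,t)\Big)$, defined where $K(z,p)\ne 0$. For a $(1,0)$-form $\partial\Phi$, $|\partial\Phi|^2_g(p)=\sum_{\alpha,\beta} g^{\bar\beta\alpha}(p)\frac{\partial\Phi}{\partial z_\alpha}(p)\overline{\frac{\partial\Phi}{\partial z_\beta}(p)}$. *)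

theory Defs
  imports "HOL-Analysis.Analysis"
begin

definition ddir :: "(complex^'n \<Rightarrow> complex) \<Rightarrow> complex^'n \<Rightarrow> complex^'n \<Rightarrow> complex" where
  "ddir f v z = frechet_derivative f (at z) v"

definition wz :: "'n::finite \<Rightarrow> (complex^'n \<Rightarrow> complex) \<Rightarrow> complex^'n \<Rightarrow> complex" where
  "wz a f z = (ddir f (axis a 1) z - \<i> * ddir f (axis a \<i>) z) / 2"

definition wzb :: "'n::finite \<Rightarrow> (complex^'n \<Rightarrow> complex) \<Rightarrow> complex^'n \<Rightarrow> complex" where
  "wzb a f z = (ddir f (axis a 1) z + \<i> * ddir f (axis a \<i>) z) / 2"

definition holo_on :: "(complex^'n::finite) set \<Rightarrow> (complex^'n \<Rightarrow> complex) \<Rightarrow> bool" where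
  "holo_on \<Omega> f \<longleftrightarrow> (\<forall>z\<in>\<Omega>. \<exists>L. (f has_derivative L) (at z) \<and> (\<forall>c x. L (c *s x) = c * L x))"

definition bounded_domain :: "(complex^'n::finite) set \<Rightarrow> bool" where
  "bounded_domain \<Omega> \<longleftrightarrow> open \<Omega> \<and> connected \<Omega> \<and> bounded \<Omega> \<and> \<Omega> \<noteq> {}"

definition bergman_space :: "(complex^'n::finite) set \<Rightarrow> (complex^'n \<Rightarrow> complex) set" where
  "bergman_space \<Omega> = {f. holo_on \<Omega> f \<and> set_integrable lborel \<Omega> (\<lambda>z. (cmod (f z))^2)}"

text \<open>K is the Bergman kernel of Omega: K(.,t) lies in A^2 and reproduces A^2,
  f(t) = int_Omega f(z) conj(K(z,t)) dV(z).  This determines K on Omega x Omega.\<close>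
definition is_bergman_kernel :: "(complex^'n::finite) set \<Rightarrow> (complex^'n \<Rightarrow> complex^'n \<Rightarrow> complex) \<Rightarrow> bool" where
  "is_bergman_kernel \<Omega> K \<longleftrightarrow>
     (\<forall>t\<in>\<Omega>. (\<lambda>z. K z t) \<in> bergman_space \<Omega>) \<and>
     (\<forall>f\<in>bergman_space \<Omega>. \<forall>t\<in>\<Omega>. f t = (LINT z:\<Omega>|lborel. f z * cnj (K z t)))"

definition bmetric :: "(complex^'n \<Rightarrow> complex^'n \<Rightarrow> complex) \<Rightarrow> 'n::finite \<Rightarrow> 'n \<Rightarrow> complex^'n \<Rightarrow> complex" where
  "bmetric K a b z = wz a (wzb b (\<lambda>u. Ln (K u u))) z"

definition bmatrix :: "(complex^'n \<Rightarrow> complex^'n \<Rightarrow> complex) \<Rightarrow> complex^'n \<Rightarrow> complex^'n^'n::finite" where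
  "bmatrix K z = (\<chi> a b. bmetric K a b z)"

text \<open>binv K z $ j $ a = g^{jbar a}(z), the entries of the inverse matrix (g_{a jbar})^{-1}.\<close>
definition binv :: "(complex^'n \<Rightarrow> complex^'n \<Rightarrow> complex) \<Rightarrow> complex^'n \<Rightarrow> complex^'n^'n::finite" where
  "binv K z = matrix_inv (bmatrix K z)"

definition bcurv :: "(complex^'n \<Rightarrow> complex^'n \<Rightarrow> complex) \<Rightarrow> 'n::finite \<Rightarrow> 'n \<Rightarrow> 'n \<Rightarrow> 'n \<Rightarrow> complex^'n \<Rightarrow> complex" where
  "bcurv K a b c d z = - wz c (wzb d (bmetric K a b)) z
     + (\<Sum>m\<in>UNIV. \<Sum>\<nu>\<in>UNIV. binv K z $ \<nu> $ m * wz c (bmetric K a \<nu>) z * wzb d (bmetric K m b) z)"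

text \<open>Holomorphic sectional curvature in the direction xi (sign convention: the unit
  disc with its Bergman metric has holomorphic sectional curvature -1).\<close>
definition hsc :: "(complex^'n \<Rightarrow> complex^'n \<Rightarrow> complex) \<Rightarrow> complex^'n \<Rightarrow> complex^'n::finite \<Rightarrow> complex" where
  "hsc K z \<xi> = (\<Sum>a\<in>UNIV. \<Sum>b\<in>UNIV. \<Sum>c\<in>UNIV. \<Sum>d\<in>UNIV.
        bcurv K a b c d z * \<xi>$a * cnj (\<xi>$b) * \<xi>$c * cnj (\<xi>$d))
     / (\<Sum>a\<in>UNIV. \<Sum>b\<in>UNIV. bmetric K a b z * \<xi>$a * cnj (\<xi>$b))^2"

definition diastasis :: "(complex^'n \<Rightarrow> complex^'n \<Rightarrow> complex) \<Rightarrow> complex^'n \<Rightarrow> complex^'n \<Rightarrow> complex" where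
  "diastasis K z0 z = complex_of_real (ln (Re (K z z) * Re (K z0 z0) / (cmod (K z z0))^2))"

definition rep_coord :: "(complex^'n \<Rightarrow> complex^'n \<Rightarrow> complex) \<Rightarrow> complex^'n \<Rightarrow> 'n::finite \<Rightarrow> complex^'n \<Rightarrow> complex" where
  "rep_coord K p a z = (\<Sum>j\<in>UNIV. binv K p $ j $ a *
      (wzb j (\<lambda>t. K z t) p / K z p - wzb j (\<lambda>t. Ln (K t t)) p))"

definition rep_quad :: "(complex^'n \<Rightarrow> complex^'n \<Rightarrow> complex) \<Rightarrow> complex^'n \<Rightarrow> complex^'n::finite \<Rightarrow> complex" where
  "rep_quad K p z = (\<Sum>a\<in>UNIV. \<Sum>b\<in>UNIV. rep_coord K p a z * bmetric K a b p * cnj (rep_coord K p b z))"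

definition dPhi_normsq :: "(complex^'n \<Rightarrow> complex^'n \<Rightarrow> complex) \<Rightarrow> complex^'n \<Rightarrow> complex^'n::finite \<Rightarrow> complex" where
  "dPhi_normsq K z0 p = (\<Sum>a\<in>UNIV. \<Sum>b\<in>UNIV.
      binv K p $ b $ a * wz a (diastasis K z0) p * cnj (wz b (diastasis K z0) p))"

end

theory Submission
  imports Defs "HOL-Complex_Analysis.Complex_Analysis"
begin

text \<open>
  Let \<open>\<kappa> = c\<^sup>2/2\<close>. The kernel is polarized to a function \<open>H(z,s) = K(z, cnj s)\<close> that is holomorphic in
  all variables, and so is the equation of constant holomorphic sectional curvature, because the
  conjugate diagonal is a set of uniqueness. For the polarized diastasis \<open>\<Phi>\<close> at \<open>p\<close> the equation says
  that the Christoffel symbols in \<open>s\<close>, corrected by multiples of the first derivatives of \<open>\<Phi>\<close>, do not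
  depend on \<open>z\<close>. Hence \<open>exp(-\<kappa>\<Phi>)\<close> solves in \<open>s\<close> a linear system with coefficients independent of \<open>z\<close>,
  and uniqueness gives \<open>exp(-\<kappa>\<Phi>(z, cnj t)) = 1 - \<kappa>Q(z,t)\<close> near \<open>p\<close>, where \<open>Q(z,t)\<close> is the inner product of
  the representative coordinates of \<open>z\<close> and \<open>t\<close>.

  Equivalently \<open>K(z,t)K(p,p) = K(z,p)K(p,t)(1 - \<kappa>Q(z,t)) powr (-1/\<kappa>)\<close>, and this continues to the component
  \<open>U\<close> of \<open>p\<close> in the set where \<open>K(z,p) \<noteq> 0\<close> and \<open>\<kappa>Q(z,z) < 1\<close>. At a boundary point of \<open>U\<close> inside the domain
  either \<open>K(z,p)\<close> vanishes, and then so does \<open>K(z,t)\<close> for every \<open>t\<close>, or \<open>\<kappa>Q(z,z) = 1\<close>, and then \<open>K(z,z)\<close> is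
  infinite; both are absurd, so \<open>U\<close> is the whole domain.
\<close>

section \<open>Separately holomorphic functions\<close>

text \<open>The constant \<open>\<kappa>\<close> is half of c^2 because a tensor of constant
  holomorphic sectional curvature is a sum of two products of the metric. The exponential is a
  Riccati substitution: the second s-derivatives of the potential are quadratic in the first ones,
  and exp(-\<kappa>\<Phi>) absorbs the square. The kernel is given only by its reproducing property,
  so joint holomorphy of H must be built: Hermitian symmetry gives holomorphy in each group of
  variables, the mean value inequality and Cauchy-Schwarz give local bounds, and Osgood's lemma
  joins them. Positivity of the metric has to be derived too: nondegeneracy is read off the nonzero
  curvature quotient, and semidefiniteness of the form behind Q follows from Cauchy-Schwarz for K by
  a second-order limit at p. The continuation must tame the multivalued power -1/\<kappa>:
  Cauchy-Schwarz for that form gives \<kappa>|Q(z,t)| < 1 whenever \<kappa>Q(z,z) and \<kappa>Q(t,t)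
  are below 1, so the principal branch serves on all of U x U. The gradient estimate is the estimate
  on T in disguise: the squared length at p of the gradient of the diastasis relative to z0 is
  Q(z0,z0).\<close>

lemma holomorphic_ball_estimates:
  assumes g: "g holomorphic_on ball 0 r" and M: "\<And>x. x \<in> ball 0 r \<Longrightarrow> cmod (g x) \<le> M"
    and r: "0 < r" and h: "cmod h < r/2"
  shows "cmod (deriv g h) \<le> 4 * M / r"
    and "cmod (g h - g 0) \<le> 4 * M / r * cmod h"
    and "cmod (g h - g 0 - deriv g 0 * h) \<le> 32 * M / r^2 * (cmod h)^2"
proof -
  have der: "((deriv ^^ i) g has_field_derivative (deriv ^^ Suc i) g x) (at x)" if "x \<in> ball 0 r" for i x
    using holomorphic_derivI[OF holomorphic_higher_deriv[OF g open_ball, of i] open_ball that]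
    by simp
  \<comment> \<open>Cauchy's inequality on discs of radius r/4 about points of the half-size disc;
    this is the source of 4 M / r and of 2! M / (r/4)^2 = 32 M / r^2.\<close>
  have bd: "cmod ((deriv ^^ n) g x) \<le> fact n * M / (r/4)^n" if x: "x \<in> ball 0 (r/2)" for x n
  proof -
    have sub: "cball x (r/4) \<subseteq> ball 0 r"
    proof
      fix y assume "y \<in> cball x (r/4)"
      then have "cmod (x - y) \<le> r/4" "cmod x < r/2" using x by (auto simp: dist_norm)
      then show "y \<in> ball 0 r" using norm_triangle_ineq4[of x "x - y"] r by (simp add: dist_norm)
    qed
    show ?thesis
    proof (rule Cauchy_inequality)
      show "g holomorphic_on ball x (r/4)" using sub g by (meson ball_subset_cball holomorphic_on_subset)
      show "continuous_on (cball x (r/4)) g" using sub g by (meson continuous_on_subset holomorphic_on_imp_continuous_on)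
      show "0 < r/4" using r by simp
      show "cmod (g y) \<le> M" if "cmod (x - y) = r/4" for y
        by (rule M) (use sub that in \<open>auto simp: dist_norm\<close>)
    qed
  qed
  have hb: "h \<in> ball 0 (r/2)" "0 \<in> ball 0 (r/2)" using h r by (auto simp: dist_norm)
  have sub: "ball 0 (r/2) \<subseteq> ball (0::complex) r" using r by auto
  show 1: "cmod (deriv g h) \<le> 4 * M / r" using bd[OF hb(1), of 1] by (simp add: mult.commute)
  show "cmod (g h - g 0) \<le> 4 * M / r * cmod h"
  proof -
    have "cmod ((deriv ^^ 0) g h - (\<Sum>i\<le>0. (deriv ^^ i) g 0 * (h - 0) ^ i / fact i))
       \<le> (4*M/r) * cmod (h - 0) ^ Suc 0 / fact 0"
    proof (rule complex_Taylor[of "ball 0 (r/2)"])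
      show "cmod ((deriv ^^ Suc 0) g x) \<le> 4 * M / r" if "x \<in> ball 0 (r/2)" for x
        using bd[OF that, of 1] by (simp add: mult.commute)
      show "((deriv ^^ i) g has_field_derivative (deriv ^^ Suc i) g x) (at x within ball 0 (r/2))"
        if "x \<in> ball 0 (r/2)" for i x
        using der[of x i] sub that by (meson has_field_derivative_at_within subsetD)
    qed (use hb in auto)
    then show ?thesis by simp
  qed
  have *: "cmod ((deriv ^^ 0) g h - (\<Sum>i\<le>1. (deriv ^^ i) g 0 * (h - 0) ^ i / fact i))
     \<le> (32*M/r^2) * cmod (h - 0) ^ Suc 1 / fact 1"
  proof (rule complex_Taylor[of "ball 0 (r/2)"])
    show "cmod ((deriv ^^ Suc 1) g x) \<le> 32 * M / r\<^sup>2" if "x \<in> ball 0 (r/2)" for x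
      using bd[OF that, of 2] by (simp add: power2_eq_square numeral_2_eq_2 field_simps)
  qed (use hb der sub in \<open>auto intro: has_field_derivative_at_within\<close>)
  then show "cmod (g h - g 0 - deriv g 0 * h) \<le> 32 * M / r^2 * (cmod h)^2"
    by (simp add: algebra_simps power2_eq_square)
qed

text \<open>A ball in the sup norm: coordinates can be moved independently, and the polydisc about
  \<open>mk p q\<close> is the product of those about \<open>p\<close> and \<open>q\<close>.\<close>

definition polydisc :: "complex^'m \<Rightarrow> real \<Rightarrow> (complex^'m::finite) set" where
  "polydisc Z r = {W. \<forall>i. cmod (W$i - Z$i) < r}"

text \<open>A complex partial derivative taken by \<open>deriv\<close> on a slice, hence meaningful
  before joint differentiability is known.\<close>

definition pd :: "'m \<Rightarrow> (complex^'m \<Rightarrow> complex) \<Rightarrow> complex^'m::finite \<Rightarrow> complex" where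
  "pd i f Z = deriv (\<lambda>\<zeta>. f (Z + axis i \<zeta>)) 0"

definition separately_holo :: "(complex^'m \<Rightarrow> complex) \<Rightarrow> (complex^'m::finite) set \<Rightarrow> bool" where
  "separately_holo f S \<longleftrightarrow> (\<forall>Z\<in>S. \<forall>i. (\<lambda>\<zeta>. f (Z + axis i \<zeta>)) field_differentiable at 0)"

text \<open>The inclusion \<open>polydisc Z r \<subseteq> S\<close> belongs to the condition, which
  thereby also encodes that \<open>S\<close> is open.\<close>

definition locally_bounded :: "(complex^'m \<Rightarrow> complex) \<Rightarrow> (complex^'m::finite) set \<Rightarrow> bool" where
  "locally_bounded f S \<longleftrightarrow> (\<forall>Z\<in>S. \<exists>r>0. \<exists>M. polydisc Z r \<subseteq> S \<and> (\<forall>W\<in>polydisc Z r. cmod (f W) \<le> M))"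

lemma norm_cart_le_sum: "norm (x::complex^'m::finite) \<le> (\<Sum>i\<in>UNIV. cmod (x$i))"
  unfolding norm_vec_def by (rule L2_set_le_sum) simp

lemma open_polydisc: "open (polydisc Z r)"
proof -
  have "polydisc Z r = (\<Inter>i. {W. cmod (W$i - Z$i) < r})" by (auto simp: polydisc_def)
  then show ?thesis by (auto intro!: open_INT open_Collect_less continuous_intros)
qed

lemma convex_polydisc: "convex (polydisc Z r)"
proof -
  have "polydisc Z r = (\<Inter>i. (\<lambda>W. W$i) -` ball (Z$i) r)" by (auto simp: polydisc_def dist_norm norm_minus_commute)
  moreover have "convex ((\<lambda>W::complex^'a. W$i) -` ball (Z$i) r)" for i
    by (rule convex_linear_vimage) (auto intro!: linearI)
  ultimately show ?thesis by (auto intro!: convex_INT)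
qed

lemma centre_in_polydisc [simp]: "0 < r \<Longrightarrow> Z \<in> polydisc Z r"
  by (simp add: polydisc_def)

lemma polydisc_mono: "r \<le> s \<Longrightarrow> polydisc Z r \<subseteq> polydisc Z s"
  unfolding polydisc_def by (auto intro: less_le_trans)

lemma polydisc_subset_open:
  assumes "open S" "Z \<in> S"
  obtains r where "0 < r" "polydisc Z r \<subseteq> S"
proof -
  from assms obtain e where e: "e > 0" "ball Z e \<subseteq> S" by (meson open_contains_ball)
  let ?n = "real CARD('a)"
  have "polydisc Z (e / ?n) \<subseteq> ball Z e"
  proof
    fix W assume W: "W \<in> polydisc Z (e / ?n)"
    have "norm (W - Z) \<le> (\<Sum>i\<in>UNIV. cmod ((W - Z)$i))" by (rule norm_cart_le_sum)
    also have "\<dots> < (\<Sum>i\<in>(UNIV::'a set). e / ?n)" using W by (intro sum_strict_mono) (auto simp: polydisc_def)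
    also have "\<dots> = e" by simp
    finally show "W \<in> ball Z e" by (simp add: dist_norm norm_minus_commute)
  qed
  with e show ?thesis by (intro that[of "e / ?n"]) auto
qed

lemma polydisc_add_axis:
  assumes "W \<in> polydisc Z r" "cmod h < s"
  shows "W + axis i h \<in> polydisc Z (r + s)"
  unfolding polydisc_def mem_Collect_eq
proof
  fix j
  have "cmod (W$j - Z$j) < r" using assms by (auto simp: polydisc_def)
  moreover have "cmod (axis i h $ j) < s" using assms(2) le_less_trans[OF norm_ge_zero assms(2)] by (simp add: axis_def)
  ultimately show "cmod ((W + axis i h)$j - Z$j) < r + s"
    using norm_triangle_ineq[of "W$j - Z$j" "axis i h $ j"] by (simp add: algebra_simps)
qed

lemma axis_add: "axis i (x::complex) + axis i y = axis i (x + y)"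
  by (simp add: vec_eq_iff axis_def)

text \<open>The estimates behind Osgood's lemma: they turn bounded partial holomorphy into joint
  differentiability.\<close>
lemma separately_holo_slice:
  assumes f: "separately_holo f S" and sub: "polydisc Z (2*r) \<subseteq> S" and M: "\<forall>W\<in>polydisc Z (2*r). cmod (f W) \<le> M"
    and r: "0 < r" and W: "W \<in> polydisc Z r"
  shows "(\<lambda>\<zeta>. f (W + axis i \<zeta>)) holomorphic_on ball 0 r"
    and "cmod (pd i f W) \<le> 4 * M / r"
    and "cmod h < r/2 \<Longrightarrow> cmod (f (W + axis i h) - f W) \<le> 4 * M / r * cmod h"
    and "cmod h < r/2 \<Longrightarrow> cmod (f (W + axis i h) - f W - pd i f W * h) \<le> 32 * M / r^2 * (cmod h)^2"
proof -
  let ?g = "\<lambda>\<zeta>. f (W + axis i \<zeta>)"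
  have inD: "W + axis i \<zeta> \<in> polydisc Z (2*r)" if "\<zeta> \<in> ball 0 r" for \<zeta>
    using polydisc_add_axis[OF W, of \<zeta> r i] that by (auto simp: dist_norm)
  show g: "?g holomorphic_on ball 0 r"
    unfolding holomorphic_on_def
  proof
    fix \<zeta> assume z: "\<zeta> \<in> ball (0::complex) r"
    \<comment> \<open>\<open>separately_holo\<close> speaks only of slices at parameter 0; shifting
      the base point to \<open>W + axis i \<zeta>\<close> reaches the other parameters.\<close>
    have "(\<lambda>\<xi>. f ((W + axis i \<zeta>) + axis i \<xi>)) field_differentiable at 0"
      using f sub inD[OF z] by (auto simp: separately_holo_def)
    then obtain D where "((\<lambda>\<xi>. f ((W + axis i \<zeta>) + axis i \<xi>)) has_field_derivative D) (at 0)"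
      by (auto simp: field_differentiable_def)
    then have "((\<lambda>\<xi>. ?g (\<zeta> + \<xi>)) has_field_derivative D) (at 0)"
      by (simp add: add.assoc axis_add)
    then have "(?g has_field_derivative D) (at \<zeta>)"
      using DERIV_at_within_shift[of ?g D \<zeta> 0 UNIV] by simp
    then show "?g field_differentiable at \<zeta> within ball 0 r"
      by (auto simp: field_differentiable_def intro: has_field_derivative_at_within)
  qed
  have b: "cmod (?g x) \<le> M" if "x \<in> ball 0 r" for x using M inD that by blast
  have a0: "axis i (0::complex) = 0" by (simp add: vec_eq_iff axis_def)
  note E = holomorphic_ball_estimates[OF g b r]
  show "cmod (pd i f W) \<le> 4 * M / r" using E(1)[of 0] r by (simp add: pd_def)
  show "cmod h < r/2 \<Longrightarrow> cmod (f (W + axis i h) - f W) \<le> 4 * M / r * cmod h"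
    using E(2)[of h] by (simp add: a0)
  show "cmod h < r/2 \<Longrightarrow> cmod (f (W + axis i h) - f W - pd i f W * h) \<le> 32 * M / r^2 * (cmod h)^2"
    using E(3)[of h] by (simp add: a0 pd_def)
qed

lemma locally_boundedE:
  assumes "locally_bounded f S" "Z \<in> S"
  obtains r M where "0 < r" "polydisc Z (2*r) \<subseteq> S" "\<forall>W\<in>polydisc Z (2*r). cmod (f W) \<le> M" "0 \<le> M"
proof -
  obtain r M where *: "r > 0" "polydisc Z r \<subseteq> S" "\<forall>W\<in>polydisc Z r. cmod (f W) \<le> M"
    using assms unfolding locally_bounded_def by blast
  then have "cmod (f Z) \<le> M" by simp
  then have "0 \<le> M" using norm_ge_zero order_trans by blast
  with * show ?thesis by (intro that[of "r/2" M]) auto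
qed

text \<open>Difference quotients converge locally uniformly to the partial derivative, so a partial
  derivative is again separately holomorphic and commutes with the others.\<close>
lemma separately_holo_pd:
  assumes f: "separately_holo f S" and b: "locally_bounded f S"
  shows "separately_holo (pd i f) S" "locally_bounded (pd i f) S"
    and "Z \<in> S \<Longrightarrow> pd j (pd i f) Z = pd i (pd j f) Z"
proof -
  \<comment> \<open>One number \<open>g'\<close> is at once the derivative of \<open>pd i f\<close>
    in direction j and the limit of difference quotients of \<open>pd j f\<close> in direction i;
    this double role yields the commutation of the partials.\<close>
  have main: "\<exists>g'. ((\<lambda>\<zeta>. pd i f (Z + axis j \<zeta>)) has_field_derivative g') (at 0) \<and>
      (\<lambda>n. (pd j f (Z + axis i (1/of_nat (Suc n))) - pd j f Z) * of_nat (Suc n)) \<longlonglongrightarrow> g'"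
    if ZS: "Z \<in> S" for Z i j
  proof -
    obtain r M where r: "0 < r" and sub: "polydisc Z (2*r) \<subseteq> S" and M: "\<forall>W\<in>polydisc Z (2*r). cmod (f W) \<le> M" and M0: "0 \<le> M"
      using locally_boundedE[OF b ZS] by metis
    note E = separately_holo_slice[OF f sub M r]
    define a where "a n = (1 / of_nat (Suc n) :: complex)" for n
    have an: "cmod (a n) = 1 / real (Suc n)" for n by (simp add: a_def norm_divide del: of_nat_Suc)
    have a0: "(\<lambda>n. cmod (a n)) \<longlonglongrightarrow> 0" unfolding an using LIMSEQ_inverse_real_of_nat by (simp add: inverse_eq_divide)
    have anz: "a n \<noteq> 0" for n by (simp add: a_def del: of_nat_Suc)
    define F where "F n \<zeta> = (f (Z + axis j \<zeta> + axis i (a n)) - f (Z + axis j \<zeta>)) / a n" for n \<zeta>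
    define F' where "F' n \<zeta> = (pd j f (Z + axis j \<zeta> + axis i (a n)) - pd j f (Z + axis j \<zeta>)) / a n" for n \<zeta>
    have inD: "Z + axis j \<zeta> \<in> polydisc Z r" if "cmod \<zeta> < r" for \<zeta>
      using that le_less_trans[OF norm_ge_zero that] by (simp add: polydisc_def axis_def)
    have small: "\<forall>\<^sub>F n in sequentially. cmod (a n) < r/2"
      using order_tendstoD(2)[OF a0, of "r/2"] r by simp
    have derf: "((\<lambda>\<zeta>. f (V + axis j \<zeta>)) has_field_derivative pd j f (V + axis j \<zeta>)) (at \<zeta>)"
      if "V \<in> polydisc Z r" "cmod \<zeta> < r" for V \<zeta>
    proof -
      have "(\<lambda>\<zeta>. f (V + axis j \<zeta>)) field_differentiable at \<zeta>"
        using E(1)[OF that(1), of j] that(2) by (auto simp: holomorphic_on_def at_within_open[OF _ open_ball] dest!: bspec[of _ _ \<zeta>])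
      then have d: "((\<lambda>\<zeta>. f (V + axis j \<zeta>)) has_field_derivative deriv (\<lambda>\<zeta>. f (V + axis j \<zeta>)) \<zeta>) (at \<zeta>)"
        by (simp add: DERIV_deriv_iff_field_differentiable)
      then have "((\<lambda>\<xi>. f (V + axis j (\<zeta> + \<xi>))) has_field_derivative deriv (\<lambda>\<zeta>. f (V + axis j \<zeta>)) \<zeta>) (at 0)"
        using DERIV_at_within_shift[of "\<lambda>\<zeta>. f (V + axis j \<zeta>)" "deriv (\<lambda>\<zeta>. f (V + axis j \<zeta>)) \<zeta>" \<zeta> 0 UNIV] by simp
      then have "pd j f (V + axis j \<zeta>) = deriv (\<lambda>\<zeta>. f (V + axis j \<zeta>)) \<zeta>"
        unfolding pd_def by (intro DERIV_imp_deriv) (simp add: add.assoc axis_add)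
      with d show ?thesis by simp
    qed
    have Fd: "\<forall>\<^sub>F n in sequentially. \<forall>w\<in>ball 0 (r/2). (F n has_field_derivative F' n w) (at w)"
      using small
    proof eventually_elim
      case (elim n)
      show ?case
      proof
        fix w :: complex assume w: "w \<in> ball 0 (r/2)"
        have "Z + axis i (a n) \<in> polydisc Z r"
          using polydisc_add_axis[of Z Z "r/2" "a n" "r/2" i] r elim by simp
        from derf[OF this, of w] derf[of Z w]
        have "((\<lambda>\<zeta>. f (Z + axis i (a n) + axis j \<zeta>) - f (Z + axis j \<zeta>)) has_field_derivative
            pd j f (Z + axis i (a n) + axis j w) - pd j f (Z + axis j w)) (at w)"
          using w r by (intro DERIV_diff) auto
        from DERIV_cdivide[OF this, of "a n"] show "(F n has_field_derivative F' n w) (at w)"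
          unfolding F_def F'_def by (simp add: ac_simps)
      qed
    qed
    \<comment> \<open>The second-order remainder divided by |a n| is at most 32 M / r^2 |a n|,
      uniformly in the parameter; Weierstrass's theorem then gives the derivative of the
      limit.\<close>
    have U: "uniform_limit (cball 0 (r/4)) F (\<lambda>\<zeta>. pd i f (Z + axis j \<zeta>)) sequentially"
    proof (rule uniform_limitI)
      fix e :: real assume e: "0 < e"
      have "(\<lambda>n. 32 * M / r^2 * cmod (a n)) \<longlonglongrightarrow> 32 * M / r^2 * 0" by (intro tendsto_intros a0)
      then have "\<forall>\<^sub>F n in sequentially. 32 * M / r^2 * cmod (a n) < e" using e by (auto dest: order_tendstoD)
      then show "\<forall>\<^sub>F n in sequentially. \<forall>x\<in>cball 0 (r/4). dist (F n x) (pd i f (Z + axis j x)) < e"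
        using small
      proof eventually_elim
        case (elim n)
        show ?case
        proof
          fix x :: complex assume "x \<in> cball 0 (r/4)"
          then have x: "cmod x < r" using r by simp
          have "F n x - pd i f (Z + axis j x) = (f (Z + axis j x + axis i (a n)) - f (Z + axis j x) - pd i f (Z + axis j x) * a n) / a n"
            using anz[of n] by (simp add: F_def field_simps)
          then have "cmod (F n x - pd i f (Z + axis j x)) \<le> 32 * M / r^2 * (cmod (a n))^2 / cmod (a n)"
            using divide_right_mono[OF E(4)[OF inD[OF x] elim(2), of i], of "cmod (a n)"] by (simp add: norm_divide)
          also have "\<dots> = 32 * M / r^2 * cmod (a n)" using anz[of n] by (simp add: power2_eq_square)
          finally show "dist (F n x) (pd i f (Z + axis j x)) < e" using elim by (simp add: dist_norm)
        qed
      qed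
    qed
    have C: "\<forall>\<^sub>F n in sequentially. continuous_on (cball 0 (r/4)) (F n) \<and> (\<forall>w\<in>ball 0 (r/4). (F n has_field_derivative F' n w) (at w))"
      using Fd
    proof eventually_elim
      case (elim n)
      have "continuous (at w) (F n)" if "w \<in> cball 0 (r/4)" for w
        using elim that r by (intro DERIV_isCont[of _ "F' n w"]) auto
      then show ?case using elim r by (auto intro: continuous_at_imp_continuous_on)
    qed
    obtain g' where "\<And>w. w \<in> ball 0 (r/4) \<Longrightarrow> ((\<lambda>\<zeta>. pd i f (Z + axis j \<zeta>)) has_field_derivative g' w) (at w) \<and> (\<lambda>n. F' n w) \<longlonglongrightarrow> g' w"
      using has_complex_derivative_uniform_limit[OF C U] r by auto
    from this[of 0] r show ?thesis
      by (intro exI[of _ "g' 0"]) (auto simp: F'_def a_def axis_def[of _ 0] vec_eq_iff simp del: of_nat_Suc simp flip: zero_vec_def)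
  qed
  show 1: "separately_holo (pd i f) S" for i
    unfolding separately_holo_def field_differentiable_def using main by blast
  show "locally_bounded (pd i f) S"
    unfolding locally_bounded_def
  proof
    fix Z assume "Z \<in> S"
    then obtain r M where r: "0 < r" and sub: "polydisc Z (2*r) \<subseteq> S" and M: "\<forall>W\<in>polydisc Z (2*r). cmod (f W) \<le> M"
      using locally_boundedE[OF b] by metis
    have "polydisc Z r \<subseteq> S" using sub polydisc_mono[of r "2*r" Z] r by auto
    then show "\<exists>r>0. \<exists>M. polydisc Z r \<subseteq> S \<and> (\<forall>W\<in>polydisc Z r. cmod (pd i f W) \<le> M)"
      using separately_holo_slice(2)[OF f sub M r] r by blast
  qed
  show "pd j (pd i f) Z = pd i (pd j f) Z" if Z: "Z \<in> S"
  proof -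
    obtain g' where g: "((\<lambda>\<zeta>. pd i f (Z + axis j \<zeta>)) has_field_derivative g') (at 0)"
      "(\<lambda>n. (pd j f (Z + axis i (1/of_nat (Suc n))) - pd j f Z) * of_nat (Suc n)) \<longlonglongrightarrow> g'"
      using main[OF Z] by blast
    have "(\<lambda>\<zeta>. pd j f (Z + axis i \<zeta>)) field_differentiable at 0" using 1[of j] Z by (auto simp: separately_holo_def)
    then have D: "((\<lambda>\<zeta>. pd j f (Z + axis i \<zeta>)) has_field_derivative pd i (pd j f) Z) (at 0)"
      by (simp add: pd_def[of i "pd j f"] DERIV_deriv_iff_field_differentiable)
    have z0: "axis i (0::complex) = 0" by (simp add: vec_eq_iff axis_def)
    have L: "(\<lambda>n. 1 / of_nat (Suc n) :: complex) \<longlonglongrightarrow> 0"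
      using LIMSEQ_inverse_real_of_nat[THEN tendsto_of_real, where 'a=complex] by (simp add: inverse_eq_divide)
    have "filterlim (\<lambda>n. 1 / of_nat (Suc n) :: complex) (at 0) sequentially"
      using L by (auto simp: filterlim_at simp del: of_nat_Suc)
    with D have "(\<lambda>n. (pd j f (Z + axis i (1/of_nat (Suc n))) - pd j f Z) / (1 / of_nat (Suc n))) \<longlonglongrightarrow> pd i (pd j f) Z"
      unfolding DERIV_def z0 add_0_right add_0_left by (rule filterlim_compose)
    then have "g' = pd i (pd j f) Z" using g(2) LIMSEQ_unique by (auto simp del: of_nat_Suc)
    moreover have "pd j (pd i f) Z = g'" using g(1) by (simp add: pd_def[of j "pd i f"] DERIV_imp_deriv)
    ultimately show ?thesis by simp
  qed
qed

text \<open>Adding one index at a time to \<open>A\<close> leads from the centre \<open>Z\<close> to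
  \<open>Z + v\<close> by moves along the axes.\<close>

definition vrestr :: "'m set \<Rightarrow> complex^'m \<Rightarrow> complex^'m::finite" where
  "vrestr A v = (\<chi> i. if i \<in> A then v$i else 0)"

lemma restr_insert: "k \<notin> A \<Longrightarrow> vrestr (insert k A) v = vrestr A v + axis k (v$k)"
  by (auto simp: vrestr_def axis_def vec_eq_iff)

lemma restr_UNIV [simp]: "vrestr UNIV v = v" and restr_empty [simp]: "vrestr {} v = 0"
  by (auto simp: vrestr_def vec_eq_iff)

lemma norm_restr_le: "norm (vrestr A v) \<le> norm v"
  by (rule norm_le_componentwise_cart) (simp add: vrestr_def)

lemma restr_in_polydisc: "norm v < r \<Longrightarrow> Z + vrestr A v \<in> polydisc Z r"
  unfolding polydisc_def by (auto simp: vrestr_def intro: le_less_trans[OF Finite_Cartesian_Product.norm_nth_le] le_less_trans[OF norm_ge_zero])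

text \<open>A displacement is split into axis moves, each of which changes \<open>f\<close> by at
  most 4 M / r times its length.\<close>

lemma separately_holo_isCont:
  assumes f: "separately_holo f S" and b: "locally_bounded f S" and Z: "Z \<in> S"
  shows "isCont f Z"
proof -
  obtain r M where r: "0 < r" and sub: "polydisc Z (2*r) \<subseteq> S" and M: "\<forall>W\<in>polydisc Z (2*r). cmod (f W) \<le> M" and M0: "0 \<le> M"
    using locally_boundedE[OF b Z] by metis
  note E = separately_holo_slice[OF f sub M r]
  have *: "cmod (f (Z + vrestr A v) - f Z) \<le> card A * (4 * M / r * norm v)" if v: "norm v < r/2" for v A
    using finite[of A]
  proof induction
    case empty show ?case by simp
  next
    case (insert k A)
    have vk: "cmod (v$k) \<le> norm v" by (rule Finite_Cartesian_Product.norm_nth_le)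
    have "Z + vrestr A v \<in> polydisc Z r" using v r by (intro restr_in_polydisc) auto
    from E(3)[OF this, of "v$k" k] have "cmod (f (Z + vrestr A v + axis k (v$k)) - f (Z + vrestr A v)) \<le> 4*M/r * cmod (v$k)"
      using v vk by linarith
    also have "\<dots> \<le> 4*M/r * norm v" using vk M0 r by (intro mult_left_mono) auto
    finally have "cmod (f (Z + vrestr (insert k A) v) - f (Z + vrestr A v)) \<le> 4*M/r * norm v"
      using insert.hyps by (simp add: restr_insert add.assoc)
    with insert show ?case
      using norm_triangle_ineq[of "f (Z + vrestr (insert k A) v) - f (Z + vrestr A v)" "f (Z + vrestr A v) - f Z"]
      by (simp add: distrib_right add_divide_distrib)
  qed
  define C where "C = card (UNIV :: 'a set) * (4 * M / r) + 1"
  have C: "C > 0" using M0 r by (simp add: C_def add_nonneg_pos)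
  show ?thesis
    unfolding continuous_at_eps_delta
  proof (intro allI impI)
    fix e :: real assume e: "e > 0"
    show "\<exists>d>0. \<forall>x'. dist x' Z < d \<longrightarrow> dist (f x') (f Z) < e"
    proof (intro exI[of _ "min (r/2) (e/C)"] conjI allI impI)
      fix W assume d: "dist W Z < min (r/2) (e/C)"
      have "cmod (f W - f Z) \<le> card (UNIV::'a set) * (4 * M / r * norm (W - Z))"
        using *[of "W - Z" UNIV] d by (simp add: dist_norm)
      also have "\<dots> \<le> C * norm (W - Z)" by (simp add: C_def algebra_simps)
      also have "\<dots> < e" using d C by (simp add: dist_norm field_simps)
      finally show "dist (f W) (f Z) < e" by (simp add: dist_norm)
    qed (use e C r in auto)
  qed
qed

text \<open>The same splitting into axis moves, now with the second-order remainder. A move starts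
  at an intermediate point \<open>W\<close>, whose partial derivative is replaced by that at
  \<open>Z\<close> using continuity of \<open>pd k f\<close>.\<close>

lemma Osgood:
  assumes f: "separately_holo f S" and b: "locally_bounded f S" and Z: "Z \<in> S"
  shows "(f has_derivative (\<lambda>v. \<Sum>i\<in>UNIV. v$i * pd i f Z)) (at Z)"
proof -
  obtain r M where r: "0 < r" and sub: "polydisc Z (2*r) \<subseteq> S" and M: "\<forall>W\<in>polydisc Z (2*r). cmod (f W) \<le> M" and M0: "0 \<le> M"
    using locally_boundedE[OF b Z] by metis
  note E = separately_holo_slice[OF f sub M r]
  have *: "\<exists>d>0. \<forall>v. norm v < d \<longrightarrow> cmod (f (Z + vrestr A v) - f Z - (\<Sum>i\<in>A. v$i * pd i f Z)) \<le> e * norm v"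
    if "e > 0" for A and e :: real
    using finite[of A] that
  proof (induction arbitrary: e)
    case empty then show ?case by (auto intro!: exI[of _ 1])
  next
    case (insert k A)
    from insert.IH[of "e/3"] insert.prems obtain d1 where d1: "d1 > 0"
      "\<And>v. norm v < d1 \<Longrightarrow> cmod (f (Z + vrestr A v) - f Z - (\<Sum>i\<in>A. v$i * pd i f Z)) \<le> e/3 * norm v" by auto
    have "isCont (pd k f) Z" using separately_holo_isCont[OF separately_holo_pd(1,2)[OF f b] Z] .
    then obtain d2 where d2: "d2 > 0" "\<And>W. dist W Z < d2 \<Longrightarrow> dist (pd k f W) (pd k f Z) < e/3"
      using insert.prems unfolding continuous_at_eps_delta by (metis divide_pos_pos zero_less_numeral)
    \<comment> \<open>One third of the error each for the previous coordinates, the quadratic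
      remainder of the new move, and the change of \<open>pd k f\<close>; the added 1 keeps the
      divisor positive when M = 0.\<close>
    define d where "d = Min {d1, d2, r/2, e / 3 / (32*M/r^2 + 1)}"
    have K: "32*M/r^2 + 1 > 0" using M0 by (simp add: add_nonneg_pos)
    then have "d > 0" using d1 d2 r insert.prems by (simp add: d_def)
    moreover have "cmod (f (Z + vrestr (insert k A) v) - f Z - (\<Sum>i\<in>insert k A. v$i * pd i f Z)) \<le> e * norm v"
      if v: "norm v < d" for v
    proof -
      define W where "W = Z + vrestr A v"
      have vk: "cmod (v$k) \<le> norm v" by (rule Finite_Cartesian_Product.norm_nth_le)
      have ds: "norm v < d1" "norm v < d2" "norm v < r/2" "norm v < e / 3 / (32*M/r^2 + 1)"
        using v by (auto simp: d_def)
      have 1: "cmod (f W - f Z - (\<Sum>i\<in>A. v$i * pd i f Z)) \<le> e/3 * norm v" using d1 ds by (simp add: W_def)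
      have "W \<in> polydisc Z r" unfolding W_def using ds r by (intro restr_in_polydisc) auto
      from E(4)[OF this, of "v$k" k] have "cmod (f (W + axis k (v$k)) - f W - pd k f W * v$k) \<le> 32*M/r^2 * (cmod (v$k))^2"
        using ds vk by linarith
      also have "\<dots> \<le> (32*M/r^2 + 1) * (norm v * norm v)"
        using vk M0 by (intro mult_mono) (auto simp: power2_eq_square intro!: mult_mono)
      also have "\<dots> \<le> (32*M/r^2 + 1) * (e / 3 / (32*M/r^2 + 1) * norm v)"
        using ds K by (intro mult_left_mono mult_right_mono) auto
      also have "\<dots> = e/3 * norm v"
      proof -
        have "x * (e / 3 / x * norm v) = e/3 * norm v" if "x > 0" for x using that by simp
        then show ?thesis using K by blast
      qed
      finally have 2: "cmod (f (W + axis k (v$k)) - f W - pd k f W * v$k) \<le> e/3 * norm v" .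
      have "dist W Z < d2" using norm_restr_le[of A v] ds by (simp add: W_def dist_norm)
      then have "cmod (pd k f W - pd k f Z) \<le> e/3" using d2 by (force simp: dist_norm)
      then have 3: "cmod ((pd k f W - pd k f Z) * v$k) \<le> e/3 * norm v"
        unfolding norm_mult using vk insert.prems by (intro mult_mono) auto
      have eq: "f (Z + vrestr (insert k A) v) - f Z - (\<Sum>i\<in>insert k A. v$i * pd i f Z)
        = (f W - f Z - (\<Sum>i\<in>A. v$i * pd i f Z)) + (f (W + axis k (v$k)) - f W - pd k f W * v$k) + (pd k f W - pd k f Z) * v$k"
        using insert.hyps by (simp add: restr_insert W_def algebra_simps)
      have "cmod (f (Z + vrestr (insert k A) v) - f Z - (\<Sum>i\<in>insert k A. v$i * pd i f Z)) \<le> e/3 * norm v + e/3 * norm v + e/3 * norm v"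
        unfolding eq by (rule norm_triangle_mono[OF norm_triangle_mono[OF 1 2] 3])
      then show ?thesis by simp
    qed
    ultimately show ?case by blast
  qed
  have "bounded_linear (\<lambda>v. \<Sum>i\<in>UNIV. v$i * pd i f Z)"
    by (intro bounded_linear_sum bounded_linear_mult_const bounded_linear_vec_nth)
  then show ?thesis
    unfolding has_derivative_at_alt
  proof (intro conjI allI impI)
    fix e :: real assume "e > 0"
    from *[OF this, of UNIV] obtain d where "d > 0" "\<And>v. norm v < d \<Longrightarrow> cmod (f (Z + v) - f Z - (\<Sum>i\<in>UNIV. v$i * pd i f Z)) \<le> e * norm v"
      by auto
    from this(1) this(2)[of "y - Z" for y] show "\<exists>d>0. \<forall>y. norm (y - Z) < d \<longrightarrow> norm (f y - f Z - (\<Sum>i\<in>UNIV. (y - Z)$i * pd i f Z)) \<le> e * norm (y - Z)"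
      by (intro exI[of _ d]) auto
  qed
qed

section \<open>Calculus of \<open>holo_on\<close> and of the partial derivatives
  \<open>pd\<close>\<close>

lemma bounded_linear_scal: "bounded_linear (\<lambda>\<zeta>::complex. \<zeta> *s (v::complex^'m::finite))"
  by (auto simp: linear_conv_bounded_linear[symmetric] vec_eq_iff algebra_simps intro!: linearI)

lemma bounded_linear_axis: "bounded_linear (\<lambda>\<zeta>::complex. axis i \<zeta> :: complex^'m::finite)"
  by (auto simp: linear_conv_bounded_linear[symmetric] vec_eq_iff axis_def algebra_simps intro!: linearI)

lemma axis_zero [simp]: "axis i (0::complex) = 0"
  by (simp add: vec_eq_iff axis_def)

lemma pd_eqI: "((\<lambda>\<zeta>. f (Z + axis i \<zeta>)) has_field_derivative D) (at 0) \<Longrightarrow> pd i f Z = D"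
  by (simp add: pd_def DERIV_imp_deriv)

lemma holo_on_subset: "holo_on S f \<Longrightarrow> T \<subseteq> S \<Longrightarrow> holo_on T f"
  by (auto simp: holo_on_def)

lemma holo_slice:
  assumes "holo_on S f" "Z \<in> S"
  shows "((\<lambda>\<zeta>. f (Z + axis i \<zeta>)) has_field_derivative pd i f Z) (at 0)"
proof -
  obtain L where L: "(f has_derivative L) (at Z)" "\<And>c x. L (c *s x) = c * L x" using assms unfolding holo_on_def by blast
  have d: "((\<lambda>\<zeta>::complex. Z + axis i \<zeta>) has_derivative axis i) (at 0)"
    by (auto intro!: derivative_eq_intros bounded_linear_imp_has_derivative bounded_linear_axis)
  have "((\<lambda>\<zeta>. f (Z + axis i \<zeta>)) has_derivative (\<lambda>\<zeta>. L (axis i \<zeta>))) (at 0)"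
    using has_derivative_compose[OF d, of f L] L by simp
  moreover have "L (axis i \<zeta>) = L (axis i 1) * \<zeta>" for \<zeta>
  proof -
    have "axis i \<zeta> = \<zeta> *s axis i 1" by (simp add: vec_eq_iff axis_def)
    then have "L (axis i \<zeta>) = L (\<zeta> *s axis i 1)" by (rule arg_cong)
    then show ?thesis by (simp only: L(2) mult.commute)
  qed
  then have "(\<lambda>\<zeta>. L (axis i \<zeta>)) = (*) (L (axis i 1))" by (rule ext)
  ultimately have "((\<lambda>\<zeta>. f (Z + axis i \<zeta>)) has_field_derivative L (axis i 1)) (at 0)"
    by (simp only: has_field_derivative_def)
  then show ?thesis by (simp add: pd_eqI)
qed

lemma holo_on_isCont: "holo_on S f \<Longrightarrow> Z \<in> S \<Longrightarrow> isCont f Z"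
  unfolding holo_on_def using has_derivative_continuous by blast

lemma holo_on_continuous: "holo_on S f \<Longrightarrow> continuous_on S f"
  by (simp add: continuous_at_imp_continuous_on holo_on_isCont)

lemma holo_on_imp_separately_holo: "holo_on S f \<Longrightarrow> separately_holo f S"
  unfolding separately_holo_def field_differentiable_def using holo_slice by blast

lemma isCont_imp_locally_bounded:
  assumes S: "open S" and f: "\<And>Z. Z \<in> S \<Longrightarrow> isCont f Z"
  shows "locally_bounded f S"
  unfolding locally_bounded_def
proof
  fix Z assume Z: "Z \<in> S"
  then obtain d where d: "d > 0" "\<And>W. dist W Z < d \<Longrightarrow> dist (f W) (f Z) < 1"
    using f unfolding continuous_at_eps_delta by (metis zero_less_one)
  obtain r where r: "0 < r" "polydisc Z r \<subseteq> S \<inter> ball Z d"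
    using polydisc_subset_open[of "S \<inter> ball Z d" Z] S Z d by auto
  have "cmod (f W) \<le> cmod (f Z) + 1" if "W \<in> polydisc Z r" for W
    using d(2)[of W] r that norm_triangle_sub[of "f W" "f Z"] by (force simp: dist_norm norm_minus_commute)
  then show "\<exists>r>0. \<exists>M. polydisc Z r \<subseteq> S \<and> (\<forall>W\<in>polydisc Z r. cmod (f W) \<le> M)"
    using r by blast
qed

lemma holo_on_imp_locally_bounded: "open S \<Longrightarrow> holo_on S f \<Longrightarrow> locally_bounded f S"
  by (rule isCont_imp_locally_bounded) (auto intro: holo_on_isCont)

lemma separately_holo_imp_holo_on: "separately_holo f S \<Longrightarrow> locally_bounded f S \<Longrightarrow> holo_on S f"
  unfolding holo_on_def
proof
  fix z assume "separately_holo f S" "locally_bounded f S" "z \<in> S"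
  from Osgood[OF this] show "\<exists>L. (f has_derivative L) (at z) \<and> (\<forall>c x. L (c *s x) = c * L x)"
    by (intro exI[of _ "\<lambda>v. \<Sum>i\<in>UNIV. v$i * pd i f z"]) (simp add: sum_distrib_left mult.assoc)
qed

lemma holo_on_has_derivative:
  "open S \<Longrightarrow> holo_on S f \<Longrightarrow> Z \<in> S \<Longrightarrow> (f has_derivative (\<lambda>v. \<Sum>i\<in>UNIV. v$i * pd i f Z)) (at Z)"
  by (rule Osgood[OF holo_on_imp_separately_holo holo_on_imp_locally_bounded])

lemma holo_on_pd: "open S \<Longrightarrow> holo_on S f \<Longrightarrow> holo_on S (pd i f)"
  by (meson separately_holo_imp_holo_on separately_holo_pd(1,2) holo_on_imp_separately_holo holo_on_imp_locally_bounded)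

lemma pd_commute: "open S \<Longrightarrow> holo_on S f \<Longrightarrow> Z \<in> S \<Longrightarrow> pd j (pd i f) Z = pd i (pd j f) Z"
  by (rule separately_holo_pd(3)) (auto intro: holo_on_imp_separately_holo holo_on_imp_locally_bounded)

lemma holo_on_chain:
  assumes S: "open S" and f: "holo_on S f" and g: "(g has_derivative g') (at x within T)" and x: "g x \<in> S"
  shows "((\<lambda>x. f (g x)) has_derivative (\<lambda>h. \<Sum>i\<in>UNIV. g' h $ i * pd i f (g x))) (at x within T)"
  using has_derivative_compose[OF g holo_on_has_derivative[OF S f x]] .

lemma holo_on_line:
  assumes S: "open S" and f: "holo_on S f" and x: "Z + \<zeta> *s v \<in> S"
  shows "((\<lambda>\<zeta>. f (Z + \<zeta> *s v)) has_field_derivative (\<Sum>i\<in>UNIV. v$i * pd i f (Z + \<zeta> *s v))) (at \<zeta>)"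
proof -
  have "((\<lambda>\<zeta>::complex. Z + \<zeta> *s v) has_derivative (\<lambda>\<zeta>. \<zeta> *s v)) (at \<zeta>)"
    by (auto intro!: derivative_eq_intros bounded_linear_imp_has_derivative bounded_linear_scal)
  from holo_on_chain[OF S f this x] have "((\<lambda>\<zeta>. f (Z + \<zeta> *s v)) has_derivative
      (\<lambda>h. \<Sum>i\<in>UNIV. (h *s v) $ i * pd i f (Z + \<zeta> *s v))) (at \<zeta>)" .
  moreover have "(\<lambda>h. \<Sum>i\<in>UNIV. (h *s v) $ i * pd i f (Z + \<zeta> *s v)) = (*) (\<Sum>i\<in>UNIV. v$i * pd i f (Z + \<zeta> *s v))"
    by (rule ext) (simp add: sum_distrib_left mult_ac)
  ultimately show ?thesis by (simp only: has_field_derivative_def)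
qed

lemma holo_on_cong:
  assumes "open S" "\<And>W. W \<in> S \<Longrightarrow> f W = g W" shows "holo_on S f \<longleftrightarrow> holo_on S g"
proof -
  have *: "holo_on S g" if "\<And>W. W \<in> S \<Longrightarrow> f W = g W" "holo_on S f" for f g :: "complex^'a \<Rightarrow> complex"
    using that assms(1) unfolding holo_on_def by (metis has_derivative_transform_within_open)
  show ?thesis using *[of f g] *[of g f] assms(2) by auto
qed

lemma pd_cong:
  assumes S: "open S" and Z: "Z \<in> S" and eq: "\<And>W. W \<in> S \<Longrightarrow> f W = g W" shows "pd i f Z = pd i g Z"
  unfolding pd_def
proof (rule deriv_cong_ev)
  have "isCont (\<lambda>\<zeta>::complex. Z + axis i \<zeta>) 0"
    by (intro continuous_intros bounded_linear.isCont[OF bounded_linear_axis])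
  then have "((\<lambda>\<zeta>::complex. Z + axis i \<zeta>) \<longlongrightarrow> Z) (nhds 0)"
    using tendsto_at_iff_tendsto_nhds[of "\<lambda>\<zeta>::complex. Z + axis i \<zeta>" 0] by (simp add: continuous_at)
  then have "\<forall>\<^sub>F \<zeta> in nhds 0. Z + axis i \<zeta> \<in> S" by (rule topological_tendstoD[OF _ S Z])
  then show "\<forall>\<^sub>F x in nhds 0. f (Z + axis i x) = g (Z + axis i x)"
    by eventually_elim (simp add: eq)
qed simp

lemma holo_on_const [simp]: "holo_on S (\<lambda>_. c)"
  unfolding holo_on_def by (auto intro!: exI[of _ "\<lambda>_. 0"])

lemma holo_on_nth [simp]: "holo_on S (\<lambda>Z. Z$i)"
  unfolding holo_on_def
  by (auto intro!: exI[of _ "\<lambda>Z. Z$i"] bounded_linear_imp_has_derivative bounded_linear_vec_nth)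

lemma holo_on_add [intro]: "holo_on S f \<Longrightarrow> holo_on S g \<Longrightarrow> holo_on S (\<lambda>Z. f Z + g Z)"
  unfolding holo_on_def
proof
  fix z assume *: "\<forall>z\<in>S. \<exists>L. (f has_derivative L) (at z) \<and> (\<forall>c x. L (c *s x) = c * L x)"
    "\<forall>z\<in>S. \<exists>L. (g has_derivative L) (at z) \<and> (\<forall>c x. L (c *s x) = c * L x)" "z \<in> S"
  then obtain L L' where "(f has_derivative L) (at z)" "\<forall>c x. L (c *s x) = c * L x"
    "(g has_derivative L') (at z)" "\<forall>c x. L' (c *s x) = c * L' x" by blast
  then show "\<exists>L. ((\<lambda>Z. f Z + g Z) has_derivative L) (at z) \<and> (\<forall>c x. L (c *s x) = c * L x)"
    by (intro exI[of _ "\<lambda>x. L x + L' x"]) (auto intro!: derivative_eq_intros simp: algebra_simps)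
qed

lemma holo_on_mult [intro]: "holo_on S f \<Longrightarrow> holo_on S g \<Longrightarrow> holo_on S (\<lambda>Z. f Z * g Z)"
  unfolding holo_on_def
proof
  fix z assume *: "\<forall>z\<in>S. \<exists>L. (f has_derivative L) (at z) \<and> (\<forall>c x. L (c *s x) = c * L x)"
    "\<forall>z\<in>S. \<exists>L. (g has_derivative L) (at z) \<and> (\<forall>c x. L (c *s x) = c * L x)" "z \<in> S"
  then obtain L L' where "(f has_derivative L) (at z)" "\<forall>c x. L (c *s x) = c * L x"
    "(g has_derivative L') (at z)" "\<forall>c x. L' (c *s x) = c * L' x" by blast
  then show "\<exists>L. ((\<lambda>Z. f Z * g Z) has_derivative L) (at z) \<and> (\<forall>c x. L (c *s x) = c * L x)"
    by (intro exI[of _ "\<lambda>x. f z * L' x + L x * g z"]) (auto intro!: derivative_eq_intros simp: algebra_simps)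
qed

lemma holo_on_comp:
  assumes f: "holo_on S f" and g: "\<And>Z. Z \<in> S \<Longrightarrow> (g has_field_derivative g' (f Z)) (at (f Z))"
  shows "holo_on S (\<lambda>Z. g (f Z))"
  unfolding holo_on_def
proof
  fix z assume z: "z \<in> S"
  then obtain L where L: "(f has_derivative L) (at z)" "\<forall>c x. L (c *s x) = c * L x" using f unfolding holo_on_def by blast
  have "((\<lambda>Z. g (f Z)) has_derivative (\<lambda>v. g' (f z) * L v)) (at z)"
    using has_derivative_compose[OF L(1)] g[OF z] unfolding has_field_derivative_def by blast
  then show "\<exists>L. ((\<lambda>Z. g (f Z)) has_derivative L) (at z) \<and> (\<forall>c x. L (c *s x) = c * L x)"
    using L(2) by (intro exI[of _ "\<lambda>v. g' (f z) * L v"]) auto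
qed

lemma holo_on_diff [intro]: "holo_on S f \<Longrightarrow> holo_on S g \<Longrightarrow> holo_on S (\<lambda>Z. f Z - g Z)"
  using holo_on_add[of S f "\<lambda>Z. -1 * g Z"] holo_on_mult[of S "\<lambda>_. -1" g] by simp

lemma holo_on_sum [intro]: "(\<And>i. i \<in> A \<Longrightarrow> holo_on S (f i)) \<Longrightarrow> holo_on S (\<lambda>Z. \<Sum>i\<in>A. f i Z)"
  by (induction A rule: infinite_finite_induct) auto

lemma holo_on_prod [intro]: "(\<And>i. i \<in> A \<Longrightarrow> holo_on S (f i)) \<Longrightarrow> holo_on S (\<lambda>Z. \<Prod>i\<in>A. f i Z)"
  by (induction A rule: infinite_finite_induct) auto

lemma holo_on_exp [intro]: "holo_on S f \<Longrightarrow> holo_on S (\<lambda>Z. exp (f Z))"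
  by (rule holo_on_comp[where g' = exp]) auto

lemma holo_on_Ln: "holo_on S f \<Longrightarrow> (\<And>Z. Z \<in> S \<Longrightarrow> f Z \<notin> \<real>\<^sub>\<le>\<^sub>0) \<Longrightarrow> holo_on S (\<lambda>Z. Ln (f Z))"
  by (rule holo_on_comp[where g' = inverse]) (auto intro!: derivative_eq_intros simp: field_simps)

lemma holo_on_divide: "holo_on S f \<Longrightarrow> holo_on S g \<Longrightarrow> (\<And>Z. Z \<in> S \<Longrightarrow> g Z \<noteq> 0) \<Longrightarrow> holo_on S (\<lambda>Z. f Z / g Z)"
  unfolding divide_inverse
  by (intro holo_on_mult holo_on_comp[of S g inverse "\<lambda>w. - (inverse w)\<^sup>2"])
     (auto intro!: derivative_eq_intros simp: power2_eq_square)

lemma pd_const [simp]: "pd i (\<lambda>_. c) Z = 0"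
  by (simp add: pd_def)

lemma pd_add: "holo_on S f \<Longrightarrow> holo_on S g \<Longrightarrow> Z \<in> S \<Longrightarrow> pd i (\<lambda>Z. f Z + g Z) Z = pd i f Z + pd i g Z"
  by (intro pd_eqI DERIV_add holo_slice)

lemma pd_diff: "holo_on S f \<Longrightarrow> holo_on S g \<Longrightarrow> Z \<in> S \<Longrightarrow> pd i (\<lambda>Z. f Z - g Z) Z = pd i f Z - pd i g Z"
  by (intro pd_eqI DERIV_diff holo_slice)

lemma pd_mult: "holo_on S f \<Longrightarrow> holo_on S g \<Longrightarrow> Z \<in> S \<Longrightarrow> pd i (\<lambda>Z. f Z * g Z) Z = pd i f Z * g Z + f Z * pd i g Z"
  by (rule pd_eqI) (auto intro!: derivative_eq_intros holo_slice)

lemma pd_cmult: "holo_on S f \<Longrightarrow> Z \<in> S \<Longrightarrow> pd i (\<lambda>Z. c * f Z) Z = c * pd i f Z"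
  using pd_mult[of S "\<lambda>_. c" f Z i] by simp

lemma pd_sum: "(\<And>k. k \<in> A \<Longrightarrow> holo_on S (f k)) \<Longrightarrow> Z \<in> S \<Longrightarrow> pd i (\<lambda>Z. \<Sum>k\<in>A. f k Z) Z = (\<Sum>k\<in>A. pd i (f k) Z)"
  by (intro pd_eqI DERIV_sum holo_slice)

lemma pd_comp:
  assumes f: "holo_on S f" and Z: "Z \<in> S" and g: "(g has_field_derivative g') (at (f Z))"
  shows "pd i (\<lambda>Z. g (f Z)) Z = g' * pd i f Z"
proof (rule pd_eqI)
  have "(g has_field_derivative g') (at (f (Z + axis i 0)))" using g by simp
  from DERIV_chain2[OF this holo_slice[OF f Z]]
  show "((\<lambda>\<zeta>. g (f (Z + axis i \<zeta>))) has_field_derivative g' * pd i f Z) (at 0)" .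
qed

lemma pd_exp: "holo_on S f \<Longrightarrow> Z \<in> S \<Longrightarrow> pd i (\<lambda>Z. exp (f Z)) Z = exp (f Z) * pd i f Z"
  by (rule pd_comp) auto

section \<open>Polarization and identity theorems\<close>

text \<open>Pairs (z, s) are vectors over the sum of the index types, so that the theory of
  \<open>holo_on\<close> and \<open>pd\<close> applies verbatim to functions of two groups of
  variables.\<close>

definition mk :: "complex^'n \<Rightarrow> complex^'n \<Rightarrow> complex^('n::finite + 'n)" where
  "mk z s = (\<chi> i. case i of Inl a \<Rightarrow> z$a | Inr b \<Rightarrow> s$b)"

definition cnj_vec :: "complex^'n \<Rightarrow> complex^'n::finite" where
  "cnj_vec z = (\<chi> i. cnj (z$i))"

lemma mk_nth [simp]: "mk z s $ Inl a = z$a" "mk z s $ Inr b = s$b"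
  and cnj_vec_nth [simp]: "cnj_vec z $ i = cnj (z$i)"
  by (simp_all add: mk_def cnj_vec_def)

lemma cnj_vec_cnj_vec [simp]: "cnj_vec (cnj_vec z) = z"
  by (simp add: vec_eq_iff)

lemma cnj_vec_axis: "cnj_vec (z + axis a \<zeta>) = cnj_vec z + axis a (cnj \<zeta>)"
  by (simp add: vec_eq_iff axis_def)

lemma vec_sum_eq_iff: "(Z::complex^('n::finite+'n)) = W \<longleftrightarrow> (\<forall>a. Z$Inl a = W$Inl a) \<and> (\<forall>b. Z$Inr b = W$Inr b)"
proof -
  have "(\<forall>i. P i) \<longleftrightarrow> (\<forall>a. P (Inl a)) \<and> (\<forall>b. P (Inr b))" for P :: "'n + 'n \<Rightarrow> bool"
    by (metis sum.exhaust)
  then show ?thesis unfolding vec_eq_iff .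
qed

lemma mk_exhaust: obtains z s where "Z = mk z s"
  by (rule that[of "\<chi> a. Z$Inl a" "\<chi> b. Z$Inr b"]) (simp add: vec_sum_eq_iff)

lemma mk_axis: "mk z s + axis (Inl a) \<zeta> = mk (z + axis a \<zeta>) s" "mk z s + axis (Inr b) \<zeta> = mk z (s + axis b \<zeta>)"
  by (auto simp: vec_sum_eq_iff axis_def)

lemma pd_mk: "pd (Inl a) f (mk z s) = pd a (\<lambda>z. f (mk z s)) z" "pd (Inr b) f (mk z s) = pd b (\<lambda>s. f (mk z s)) s"
  by (simp_all add: pd_def mk_axis)

lemma mk_in_polydisc: "mk z s \<in> polydisc (mk p q) r \<longleftrightarrow> z \<in> polydisc p r \<and> s \<in> polydisc q r"
proof -
  have *: "(\<forall>i. P i) \<longleftrightarrow> (\<forall>a. P (Inl a)) \<and> (\<forall>b. P (Inr b))" for P :: "'a + 'a \<Rightarrow> bool"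
    by (metis sum.exhaust)
  show ?thesis unfolding polydisc_def mem_Collect_eq by (subst *) simp
qed

lemma cnj_vec_in_polydisc: "cnj_vec z \<in> polydisc (cnj_vec p) r \<longleftrightarrow> z \<in> polydisc p r"
  by (simp add: polydisc_def flip: complex_cnj_diff)

lemma sum_UNIV_sum: "(\<Sum>i\<in>(UNIV::('n::finite+'n) set). F i) = (\<Sum>a\<in>UNIV. F (Inl a)) + (\<Sum>b\<in>UNIV. F (Inr b))"
  unfolding UNIV_Plus_UNIV[symmetric] by (subst sum.Plus) auto

lemma linear_mk: "linear f \<Longrightarrow> linear g \<Longrightarrow> linear (\<lambda>v. mk (f v) (g v))"
  by (auto simp: linear_iff vec_sum_eq_iff)

lemma linear_cnj_vec: "linear cnj_vec"
  by (auto simp: linear_iff vec_eq_iff)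

lemma bounded_linear_mk_cj:
  "bounded_linear (\<lambda>v. mk v (cnj_vec v))" "bounded_linear (\<lambda>v. mk 0 (cnj_vec v))" "bounded_linear (\<lambda>v. mk v 0)" "bounded_linear (\<lambda>v. mk 0 v)"
  by (auto simp: linear_conv_bounded_linear[symmetric] intro!: linear_mk linear_cnj_vec linear_id[unfolded id_def] linear_zero)

lemma has_derivative_mk:
  "((\<lambda>z. mk z (cnj_vec z)) has_derivative (\<lambda>v. mk v (cnj_vec v))) (at z0 within T)"
  "((\<lambda>z. mk w (cnj_vec z)) has_derivative (\<lambda>v. mk 0 (cnj_vec v))) (at z0 within T)"
  "((\<lambda>z. mk z w) has_derivative (\<lambda>v. mk v 0)) (at z0 within T)"
  "((\<lambda>z. mk w z) has_derivative (\<lambda>v. mk 0 v)) (at z0 within T)"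
proof -
  show "((\<lambda>z. mk z (cnj_vec z)) has_derivative (\<lambda>v. mk v (cnj_vec v))) (at z0 within T)"
    by (rule bounded_linear_imp_has_derivative[OF bounded_linear_mk_cj(1)])
  have aff: "(f has_derivative g) (at z0 within T)" if "bounded_linear g" "\<And>z. f z = c + g z" for f g :: "complex^'a \<Rightarrow> complex^('a + 'a)" and c
    
  proof -
    have "f = (\<lambda>z. c + g z)" using that(2) by auto
    then show ?thesis using has_derivative_add[OF has_derivative_const[of c] bounded_linear_imp_has_derivative[OF that(1)]] by simp
  qed
  show "((\<lambda>z. mk w (cnj_vec z)) has_derivative (\<lambda>v. mk 0 (cnj_vec v))) (at z0 within T)"
    by (rule aff[OF bounded_linear_mk_cj(2), where c = "mk w 0"]) (simp add: vec_sum_eq_iff)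
  show "((\<lambda>z. mk z w) has_derivative (\<lambda>v. mk v 0)) (at z0 within T)"
    by (rule aff[OF bounded_linear_mk_cj(3), where c = "mk 0 w"]) (simp add: vec_sum_eq_iff)
  show "((\<lambda>z. mk w z) has_derivative (\<lambda>v. mk 0 v)) (at z0 within T)"
    by (rule aff[OF bounded_linear_mk_cj(4), where c = "mk w 0"]) (simp add: vec_sum_eq_iff)
qed

lemma continuous_mk:
  "isCont (\<lambda>z. mk z (cnj_vec z)) x" "isCont (\<lambda>z. mk w (cnj_vec z)) x" "isCont (\<lambda>z. mk z w) x" "isCont (\<lambda>z. mk w z) x"
  using has_derivative_continuous[OF has_derivative_mk(1)[of x UNIV]] has_derivative_continuous[OF has_derivative_mk(2)[of w x UNIV]]
    has_derivative_continuous[OF has_derivative_mk(3)[of w x UNIV]] has_derivative_continuous[OF has_derivative_mk(4)[of w x UNIV]] by auto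

section \<open>Wirtinger derivatives as holomorphic partials of a polarization\<close>

lemma frechet_derivative_eqI:
  assumes d: "(h has_derivative D) (at z)" and U: "open U" "z \<in> U" and eq: "\<And>w. w \<in> U \<Longrightarrow> f w = h w"
  shows "frechet_derivative f (at z) = D"
  using frechet_derivative_at has_derivative_transform_within_open[OF d U] eq by metis

lemma axis_if: "axis a x $ b * y = (if b = a then x * y else (0::complex))" "cnj (axis a x $ b) * y = (if b = a then cnj x * y else 0)"
  by (auto simp: axis_def)

text \<open>The real derivative of \<open>h\<close> along w -> (w, cnj w) is a complex linear part
  from the first group plus a conjugate linear part from the second; \<open>wz\<close> and
  \<open>wzb\<close> extract their coefficients.\<close>

lemma wirtinger_diag:
  assumes D: "open D" "holo_on D h" and U: "open U" "z \<in> U" and zO: "mk z (cnj_vec z) \<in> D"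
    and eq: "\<And>w. w \<in> U \<Longrightarrow> f w = h (mk w (cnj_vec w))"
  shows "wz a f z = pd (Inl a) h (mk z (cnj_vec z))" "wzb a f z = pd (Inr a) h (mk z (cnj_vec z))"
proof -
  have "ddir f v z = (\<Sum>a\<in>UNIV. v$a * pd (Inl a) h (mk z (cnj_vec z))) + (\<Sum>b\<in>UNIV. cnj (v$b) * pd (Inr b) h (mk z (cnj_vec z)))" for v
    unfolding ddir_def
    using frechet_derivative_eqI[OF holo_on_chain[OF D has_derivative_mk(1) zO] U eq] by (simp add: sum_UNIV_sum)
  then show "wz a f z = pd (Inl a) h (mk z (cnj_vec z))" "wzb a f z = pd (Inr a) h (mk z (cnj_vec z))"
    by (simp_all add: wz_def wzb_def axis_if algebra_simps flip: mult.assoc)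
qed

lemma wirtinger_anti:
  assumes D: "open D" "holo_on D h" and U: "open U" "t \<in> U" and zO: "mk z (cnj_vec t) \<in> D"
    and eq: "\<And>w. w \<in> U \<Longrightarrow> f w = h (mk z (cnj_vec w))"
  shows "wzb b f t = pd (Inr b) h (mk z (cnj_vec t))"
proof -
  have "ddir f v t = (\<Sum>b\<in>UNIV. cnj (v$b) * pd (Inr b) h (mk z (cnj_vec t)))" for v
    unfolding ddir_def
    using frechet_derivative_eqI[OF holo_on_chain[OF D has_derivative_mk(2) zO] U eq] by (simp add: sum_UNIV_sum)
  then show "wzb b f t = pd (Inr b) h (mk z (cnj_vec t))"
    by (simp_all add: wz_def wzb_def axis_if algebra_simps flip: mult.assoc)
qed

lemma holo_on_mk_left:
  assumes D: "open D" "holo_on D h" and S: "\<And>z. z \<in> S \<Longrightarrow> mk z w \<in> D"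
  shows "holo_on S (\<lambda>z. h (mk z w))"
  unfolding holo_on_def
proof
  fix z assume "z \<in> S"
  from holo_on_chain[OF D has_derivative_mk(3) S[OF this]]
  show "\<exists>L. ((\<lambda>z. h (mk z w)) has_derivative L) (at z) \<and> (\<forall>c x. L (c *s x) = c * L x)"
    by (intro exI conjI) (auto simp: sum_UNIV_sum sum_distrib_left algebra_simps)
qed

section \<open>Uniqueness: the conjugate diagonal, and open subsets of a domain\<close>

lemma islimpt_reals:
  assumes "open S" "(0::complex) \<in> S" shows "0 islimpt (S \<inter> \<real>)"
  unfolding islimpt_approachable
proof (intro allI impI)
  fix e :: real assume e: "e > 0"
  obtain d where d: "d > 0" "ball 0 d \<subseteq> S" using assms by (meson open_contains_ball)
  show "\<exists>x'\<in>S \<inter> \<real>. x' \<noteq> 0 \<and> dist x' 0 < e"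
    using d e by (intro bexI[of _ "of_real (min d e / 2)"]) (auto simp: dist_norm subset_iff)
qed

text \<open>In the coordinates x = (z + s)/2, y = (z - s)/(2i) the conjugate diagonal becomes the
  real plane. Every slice of \<open>D\<close> is an intersection of two discs, so vanishing spreads
  from real x to all x for real y, and then from real y to all y.\<close>

lemma two_var_real_identity:
  fixes h :: "complex \<Rightarrow> complex \<Rightarrow> complex" and r :: real
  defines "D \<equiv> \<lambda>x y. cmod (x + \<i> * y) < r \<and> cmod (x - \<i> * y) < r"
  assumes hx: "\<And>y. (\<lambda>x. h x y) holomorphic_on {x. D x y}" and hy: "\<And>x. (\<lambda>y. h x y) holomorphic_on {y. D x y}"
    and z: "\<And>x y. x \<in> \<real> \<Longrightarrow> y \<in> \<real> \<Longrightarrow> D x y \<Longrightarrow> h x y = 0" and D: "D x y"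
  shows "h x y = 0"
proof -
  have S1: "{x. D x y} = ball (- (\<i> * y)) r \<inter> ball (\<i> * y) r" for y
    by (auto simp: D_def dist_norm norm_minus_commute)
  have S2: "{y. D x y} = ball (\<i> * x) r \<inter> ball (- (\<i> * x)) r" for x
  proof -
    have "cmod (x + \<i> * y) = cmod (\<i> * x - y)" "cmod (x - \<i> * y) = cmod (- (\<i> * x) - y)" for y
    proof -
      have "cmod (x + \<i> * y) = cmod (\<i> * (x + \<i> * y))" "cmod (x - \<i> * y) = cmod (- \<i> * (x - \<i> * y))" by (simp_all only: norm_mult) simp_all
      then show "cmod (x + \<i> * y) = cmod (\<i> * x - y)" "cmod (x - \<i> * y) = cmod (- (\<i> * x) - y)" by (simp_all add: algebra_simps)
    qed
    then show ?thesis by (auto simp: D_def dist_norm)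
  qed
  have op: "open {x. D x y}" "connected {x. D x y}" "open {y. D x y}" "connected {y. D x y}" for x y
    unfolding S1 S2 by (auto intro: convex_connected convex_Int)
  \<comment> \<open>Ensures that 0 lies in every nonempty slice; the real points of the slice
    accumulate there.\<close>
  have avg: "cmod x < r" "cmod y < r" if "D x y" for x y
  proof -
    have "2 * x = (x + \<i> * y) + (x - \<i> * y)" "2 * (\<i> * y) = (x + \<i> * y) - (x - \<i> * y)" by simp_all
    then have "cmod (2 * x) \<le> cmod (x + \<i> * y) + cmod (x - \<i> * y)" "cmod (2 * (\<i> * y)) \<le> cmod (x + \<i> * y) + cmod (x - \<i> * y)"
      by (metis norm_triangle_ineq, metis norm_triangle_ineq4)
    then show "cmod x < r" "cmod y < r" using that by (auto simp: D_def norm_mult)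
  qed
  have 1: "h x y = 0" if "y \<in> \<real>" "D x y" for x y
  proof (rule analytic_continuation[OF hx[of y] op(1) op(2)])
    show "0 \<in> {x. D x y}" using avg(2)[OF that(2)] by (simp add: D_def norm_mult)
    then show "0 islimpt ({x. D x y} \<inter> \<real>)" by (rule islimpt_reals[OF op(1)])
  qed (use that z in auto)
  show ?thesis
  proof (rule analytic_continuation[OF hy[of x] op(3) op(4)])
    show "0 \<in> {y. D x y}" using avg(1)[OF D] by (simp add: D_def)
    then show "0 islimpt ({y. D x y} \<inter> \<real>)" by (rule islimpt_reals[OF op(3)])
  qed (use D 1 in auto)
qed

definition vec_upd :: "complex^'n \<Rightarrow> 'n \<Rightarrow> complex \<Rightarrow> complex^'n::finite" where
  "vec_upd z k u = (\<chi> i. if i = k then u else z$i)"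

text \<open>The conjugate diagonal is maximally totally real; the coordinates are freed one at a time.\<close>
lemma conj_diag_identity:
  fixes p :: "complex^'n::finite"
  assumes f: "holo_on (polydisc (mk p (cnj_vec p)) r) f" and z0: "\<And>z. z \<in> polydisc p r \<Longrightarrow> f (mk z (cnj_vec z)) = 0"
    and Z: "Z \<in> polydisc (mk p (cnj_vec p)) r"
  shows "f Z = 0"
proof -
  \<comment> \<open>\<open>A\<close> collects the coordinates in which s is already independent of
    z; in the others s is still the conjugate of z.\<close>
  have *: "f (mk z s) = 0" if "z \<in> polydisc p r" "s \<in> polydisc (cnj_vec p) r" "\<And>i. i \<notin> A \<Longrightarrow> s$i = cnj (z$i)" for A and z s :: "complex^'n"
    using finite[of A] that
  proof (induction arbitrary: z s)
    case empty
    then have "s = cnj_vec z" by (simp add: vec_eq_iff)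
    then show ?case using z0 empty by simp
  next
    case (insert k A)
    define c where "c = p$k"
    define h where "h x y = f (mk (vec_upd z k (c + (x + \<i> * y))) (vec_upd s k (cnj c + (x - \<i> * y))))" for x y
    have inP: "mk (vec_upd z k (c + u)) (vec_upd s k (cnj c + v)) \<in> polydisc (mk p (cnj_vec p)) r" if "cmod u < r" "cmod v < r" for u v
      unfolding mk_in_polydisc using insert.prems that by (auto simp: polydisc_def vec_upd_def c_def)
    have line: "(\<lambda>\<zeta>. f (V + \<zeta> *s v)) holomorphic_on {\<zeta>. V + \<zeta> *s v \<in> polydisc (mk p (cnj_vec p)) r}" for V v
      using holo_on_line[OF open_polydisc f] unfolding holomorphic_on_def field_differentiable_def
      by (blast intro: has_field_derivative_at_within)
    have "h ((z$k - c + (s$k - cnj c)) / 2) ((z$k - c - (s$k - cnj c)) / (2 * \<i>)) = 0"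
    proof (rule two_var_real_identity[where h = h and r = r])
      show "(\<lambda>x. h x y) holomorphic_on {x. cmod (x + \<i> * y) < r \<and> cmod (x - \<i> * y) < r}" for y
      proof -
        let ?V = "mk (vec_upd z k (c + \<i> * y)) (vec_upd s k (cnj c - \<i> * y))" and ?v = "mk (axis k 1) (axis k 1)"
        have eq: "mk (vec_upd z k (c + (x + \<i> * y))) (vec_upd s k (cnj c + (x - \<i> * y))) = ?V + x *s ?v" for x
          by (auto simp: vec_sum_eq_iff vec_upd_def axis_def)
        show ?thesis unfolding h_def eq
          by (rule holomorphic_on_subset[OF line]) (auto simp flip: eq intro: inP)
      qed
      show "(\<lambda>y. h x y) holomorphic_on {y. cmod (x + \<i> * y) < r \<and> cmod (x - \<i> * y) < r}" for x
      proof -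
        let ?V = "mk (vec_upd z k (c + x)) (vec_upd s k (cnj c + x))" and ?v = "mk (axis k \<i>) (axis k (- \<i>))"
        have eq: "mk (vec_upd z k (c + (x + \<i> * y))) (vec_upd s k (cnj c + (x - \<i> * y))) = ?V + y *s ?v" for y
          by (auto simp: vec_sum_eq_iff vec_upd_def axis_def)
        show ?thesis unfolding h_def eq
          by (rule holomorphic_on_subset[OF line]) (auto simp flip: eq intro: inP)
      qed
      show "h x y = 0" if R: "x \<in> \<real>" "y \<in> \<real>" and d: "cmod (x + \<i> * y) < r \<and> cmod (x - \<i> * y) < r" for x y
        unfolding h_def
      proof (rule insert.IH)
        show "vec_upd z k (c + (x + \<i> * y)) \<in> polydisc p r" "vec_upd s k (cnj c + (x - \<i> * y)) \<in> polydisc (cnj_vec p) r"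
          using inP[of "x + \<i> * y" "x - \<i> * y"] d by (auto simp: mk_in_polydisc)
        show "vec_upd s k (cnj c + (x - \<i> * y)) $ i = cnj (vec_upd z k (c + (x + \<i> * y)) $ i)" if "i \<notin> A" for i
          using insert.prems(3)[of i] that R by (auto simp: vec_upd_def Reals_cnj_iff)
      qed
      show "cmod ((z$k - c + (s$k - cnj c)) / 2 + \<i> * ((z$k - c - (s$k - cnj c)) / (2 * \<i>))) < r \<and>
        cmod ((z$k - c + (s$k - cnj c)) / 2 - \<i> * ((z$k - c - (s$k - cnj c)) / (2 * \<i>))) < r"
        using insert.prems(1,2) by (auto simp: polydisc_def c_def add_divide_distrib diff_divide_distrib)
    qed
    moreover have "vec_upd z k (z$k) = z" "vec_upd s k (s$k) = s" by (auto simp: vec_upd_def vec_eq_iff)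
    ultimately show ?case by (simp add: h_def add_divide_distrib diff_divide_distrib)
  qed
  obtain z s where "Z = mk z s" using mk_exhaust by blast
  then show ?thesis using *[of z s UNIV] Z by (simp add: mk_in_polydisc)
qed

text \<open>The interior \<open>E\<close> of the zero set is open, nonempty and relatively closed:
  from one point of \<open>E\<close> in a ball inside \<Omega>, complex lines carry the vanishing to
  the whole ball.\<close>

lemma identity_theorem:
  assumes \<Omega>: "open \<Omega>" "connected \<Omega>" and f: "holo_on \<Omega> f" and U: "open U" "U \<noteq> {}" "U \<subseteq> \<Omega>"
    and z: "\<And>z. z \<in> U \<Longrightarrow> f z = 0" and w: "w \<in> \<Omega>"
  shows "f w = 0"
proof -
  define E where "E = interior {z \<in> \<Omega>. f z = 0}"
  have E: "open E" "E \<subseteq> \<Omega>" "\<And>z. z \<in> E \<Longrightarrow> f z = 0" using interior_subset by (auto simp: E_def)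
  have UE: "U \<subseteq> E" unfolding E_def using U z by (intro interior_maximal) auto
  have ball: "ball z e \<subseteq> E" if e: "ball z e \<subseteq> \<Omega>" and y: "y \<in> ball z e" "y \<in> E" for z e y
    unfolding E_def
  proof (rule interior_maximal)
    show "ball z e \<subseteq> {z \<in> \<Omega>. f z = 0}"
    proof
      fix x assume x: "x \<in> ball z e"
      let ?g = "\<lambda>\<zeta>. f (y + \<zeta> *s (x - y))" and ?S = "{\<zeta>. y + \<zeta> *s (x - y) \<in> ball z e}"
      have cont: "continuous_on UNIV (\<lambda>\<zeta>. y + \<zeta> *s (x - y))"
        by (intro continuous_intros bounded_linear.continuous_on[OF bounded_linear_scal])
      have opS: "open {\<zeta>. y + \<zeta> *s (x - y) \<in> V}" if "open V" for V
        using open_vimage[OF that cont] by (simp add: vimage_def)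
      have "convex ?S"
      proof (rule convexI)
        fix a b and u v :: real assume *: "a \<in> ?S" "b \<in> ?S" "0 \<le> u" "0 \<le> v" "u + v = 1"
        have uv: "complex_of_real u + complex_of_real v = 1" using *(5) by (metis of_real_1 of_real_add)
        have "y + (u *\<^sub>R a + v *\<^sub>R b) *s (x - y) = u *\<^sub>R (y + a *s (x - y)) + v *\<^sub>R (y + b *s (x - y))"
        proof -
          have "y$i = (complex_of_real u + complex_of_real v) * y$i" for i by (simp add: uv)
          then show ?thesis by (auto simp: vec_eq_iff scaleR_conv_of_real[where 'a=complex] algebra_simps)
        qed
        then show "u *\<^sub>R a + v *\<^sub>R b \<in> ?S" using * convexD[OF convex_ball, of "y + a *s (x - y)" z e "y + b *s (x - y)" u v] by simp
      qed
      have g: "?g holomorphic_on ?S"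
        unfolding holomorphic_on_def field_differentiable_def
        using holo_on_line[OF \<Omega>(1) f] e by (blast intro: has_field_derivative_at_within)
      let ?V = "{\<zeta>. y + \<zeta> *s (x - y) \<in> E \<inter> ball z e}"
      have "?g 1 = 0"
      proof (rule analytic_continuation_open[of ?V ?S ?g "\<lambda>_. 0"])
        show "open ?V" by (rule opS) (use E in auto)
        show "?V \<noteq> {}" using y by (auto intro: exI[of _ 0])
        show "connected ?S" using \<open>convex ?S\<close> by (rule convex_connected)
        show "1 \<in> ?S" using x by simp
        show "open ?S" by (rule opS) simp
      qed (use g E in auto)
      then show "x \<in> {z \<in> \<Omega>. f z = 0}" using x e by auto
    qed
  qed simp
  have "open (\<Omega> - E)"
  proof (rule openI)
    fix z assume zz: "z \<in> \<Omega> - E"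
    then obtain e where e: "e > 0" "ball z e \<subseteq> \<Omega>" using \<Omega>(1) by (auto simp: open_contains_ball)
    have "z \<in> ball z e" using e by simp
    then have "y \<notin> E" if "y \<in> ball z e" for y using ball[OF e(2) that] zz by blast
    then show "\<exists>e>0. ball z e \<subseteq> \<Omega> - E" using e by blast
  qed
  then have "\<Omega> - E = {}"
    using connectedD[OF \<Omega>(2) E(1), of "\<Omega> - E"] UE U E(2) by blast
  then show ?thesis using E w by auto
qed

section \<open>Point evaluation of square integrable holomorphic functions\<close>

lemma nn_integral_lborel_shift:
  fixes f :: "'a::euclidean_space \<Rightarrow> ennreal"
  assumes "f \<in> borel_measurable borel"
  shows "(\<integral>\<^sup>+x. f (x + c) \<partial>lborel) = (\<integral>\<^sup>+x. f x \<partial>lborel)"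
proof -
  have "(\<integral>\<^sup>+x. f x \<partial>lborel) = (\<integral>\<^sup>+x. f x \<partial>distr lborel borel ((+) c))" by (simp add: lborel_distr_plus)
  also have "\<dots> = (\<integral>\<^sup>+x. f (c + x) \<partial>lborel)" using assms by (subst nn_integral_distr) auto
  finally show ?thesis by (simp add: add.commute)
qed

text \<open>Evaluate the double integral of \<open>1\<^sub>A(x) 1\<^sub>B(x + T y)\<close> in both orders, with \<open>A\<close> a ball:
  only translation invariance is needed.\<close>
lemma lborel_isometry:
  fixes T T' :: "'a::euclidean_space \<Rightarrow> 'a"
  assumes T: "linear T" "linear T'" "\<And>x. T (T' x) = x" "\<And>x. T' (T x) = x" "\<And>x. norm (T x) = norm x"
  shows "distr lborel borel T = (lborel :: 'a measure)"
proof (rule measure_eqI)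
  have cT: "continuous_on UNIV T" "continuous_on UNIV T'" using T by (auto intro: linear_continuous_on simp: linear_conv_bounded_linear)
  then have mT [measurable]: "T \<in> borel_measurable borel" "T' \<in> borel_measurable borel" by (auto intro: borel_measurable_continuous_onI)
  fix B assume "B \<in> sets (distr lborel borel T)"
  then have B [measurable]: "B \<in> sets borel" by simp
  define A where "A = ball (0::'a) 1"
  have A [measurable]: "A \<in> sets borel" by (simp add: A_def)
  have mA: "emeasure lborel A \<noteq> 0" "emeasure lborel A \<noteq> \<infinity>"
  proof -
    show "emeasure lborel A \<noteq> 0"
      using open_ball[of "0::'a" 1] unfolding A_def by (metis ball_eq_empty emeasure_lborel_ball_finite centre_in_ball zero_less_one empty_iff open_not_negligible negligible_iff_null_sets null_sets_completionI null_setsI sets_lborel borel_open)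
    show "emeasure lborel A \<noteq> \<infinity>" using emeasure_lborel_ball_finite[of 0 1] by (auto simp: A_def top.not_eq_extremum)
  qed
  define h :: "'a \<Rightarrow> 'a \<Rightarrow> ennreal" where "h x y = indicator A x * indicator B (x + T y)" for x y
  have [measurable]: "case_prod h \<in> borel_measurable (lborel \<Otimes>\<^sub>M lborel)" unfolding h_def by measurable
  have "(\<integral>\<^sup>+x. \<integral>\<^sup>+y. h x y \<partial>lborel \<partial>lborel) = (\<integral>\<^sup>+x. indicator A x * emeasure lborel (T -` B) \<partial>lborel)"
  proof (rule nn_integral_cong)
    fix x
    have "(\<integral>\<^sup>+y. h x y \<partial>lborel) = indicator A x * (\<integral>\<^sup>+y. indicator B (T (y + T' x)) \<partial>lborel)"
      unfolding h_def by (subst nn_integral_cmult[symmetric]) (auto simp: linear_add[OF T(1)] T(3) add.commute)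
    also have "(\<integral>\<^sup>+y. indicator B (T (y + T' x)) \<partial>lborel) = (\<integral>\<^sup>+y. indicator B (T y) \<partial>lborel)"
      by (rule nn_integral_lborel_shift) measurable
    also have "\<dots> = (\<integral>\<^sup>+y. indicator (T -` B) y \<partial>lborel)" by (simp add: indicator_vimage)
    also have "\<dots> = emeasure lborel (T -` B)" using measurable_sets[OF mT(1) B] by simp
    finally show "(\<integral>\<^sup>+y. h x y \<partial>lborel) = indicator A x * emeasure lborel (T -` B)" .
  qed
  also have "\<dots> = emeasure lborel A * emeasure lborel (T -` B)" by (subst nn_integral_multc) auto
  finally have 1: "(\<integral>\<^sup>+x. \<integral>\<^sup>+y. h x y \<partial>lborel \<partial>lborel) = emeasure lborel A * emeasure lborel (T -` B)" .
  \<comment> \<open>\<open>h x y\<close> is \<open>k (x + T y) y\<close>, so translation invariance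
    exchanges the two under the x-integral.\<close>
  define k :: "'a \<Rightarrow> 'a \<Rightarrow> ennreal" where "k x y = indicator A (x - T y) * indicator B x" for x y
  have [measurable]: "case_prod k \<in> borel_measurable (lborel \<Otimes>\<^sub>M lborel)" unfolding k_def by measurable
  have "(\<integral>\<^sup>+x. \<integral>\<^sup>+y. h x y \<partial>lborel \<partial>lborel) = (\<integral>\<^sup>+y. \<integral>\<^sup>+x. h x y \<partial>lborel \<partial>lborel)"
    by (rule lborel_pair.Fubini'[symmetric]) measurable
  also have "\<dots> = (\<integral>\<^sup>+y. \<integral>\<^sup>+x. k x y \<partial>lborel \<partial>lborel)"
  proof (rule nn_integral_cong)
    fix y
    have "(\<integral>\<^sup>+x. h x y \<partial>lborel) = (\<integral>\<^sup>+x. k (x + T y) y \<partial>lborel)" by (simp add: h_def k_def)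
    also have "\<dots> = (\<integral>\<^sup>+x. k x y \<partial>lborel)" by (rule nn_integral_lborel_shift) (unfold k_def, measurable)
    finally show "(\<integral>\<^sup>+x. h x y \<partial>lborel) = (\<integral>\<^sup>+x. k x y \<partial>lborel)" .
  qed
  also have "\<dots> = (\<integral>\<^sup>+x. \<integral>\<^sup>+y. k x y \<partial>lborel \<partial>lborel)" by (rule lborel_pair.Fubini') measurable
  also have "\<dots> = (\<integral>\<^sup>+x. emeasure lborel A * indicator B x \<partial>lborel)"
  proof (rule nn_integral_cong)
    fix x
    \<comment> \<open>Here the isometry enters: as a function of y this is the indicator of a
      translate of the same ball.\<close>
    have "indicator A (x - T y) = (indicator A (y + - T' x) :: ennreal)" for y
    proof -
      have "norm (x - T y) = norm (T (T' x - y))" by (simp add: linear_diff[OF T(1)] T(3))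
      then have "norm (x - T y) = norm (y - T' x)" by (simp add: T(5) norm_minus_commute)
      then show ?thesis by (simp add: A_def indicator_def dist_norm norm_minus_commute[of "T' x"] norm_minus_commute[of "T y"])
    qed
    then have "(\<integral>\<^sup>+y. k x y \<partial>lborel) = (\<integral>\<^sup>+y. indicator A (y + - T' x) * indicator B x \<partial>lborel)" by (simp add: k_def)
    also have "\<dots> = (\<integral>\<^sup>+y. indicator A (y + - T' x) \<partial>lborel) * indicator B x" by (rule nn_integral_multc) measurable
    also have "(\<integral>\<^sup>+y. indicator A (y + - T' x) \<partial>lborel) = (\<integral>\<^sup>+y. indicator A y \<partial>lborel)"
      by (rule nn_integral_lborel_shift) measurable
    finally show "(\<integral>\<^sup>+y. k x y \<partial>lborel) = emeasure lborel A * indicator B x" by simp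
  qed
  also have "\<dots> = emeasure lborel A * emeasure lborel B" by (subst nn_integral_cmult) auto
  finally have "emeasure lborel A * emeasure lborel (T -` B) = emeasure lborel A * emeasure lborel B" using 1 by simp
  then have "emeasure lborel (T -` B) = emeasure lborel B" using mA by (simp add: ennreal_mult_cancel_left)
  then show "emeasure (distr lborel borel T) B = emeasure lborel B" by (simp add: emeasure_distr)
qed simp

lemma norm_scal: "norm (c *s (x::complex^'m::finite)) = cmod c * norm x"
  unfolding norm_vec_def by (simp add: L2_set_right_distrib norm_mult)

lemma lborel_rotation:
  assumes "cmod c = 1"
  shows "distr lborel borel (\<lambda>x. c *s x) = (lborel :: (complex^'m::finite) measure)"
proof -
  have c: "c \<noteq> 0" using assms by auto
  show ?thesis
    by (rule lborel_isometry[where T' = "\<lambda>x. inverse c *s x"])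
       (use assms c in \<open>auto simp: linear_iff vec_eq_iff algebra_simps norm_scal\<close>)
qed

section \<open>Mean value inequalities\<close>

lemma circle_mean_bound:
  assumes h: "h holomorphic_on S" and S: "open S" "cball 0 1 \<subseteq> S"
  shows "ennreal (cmod (h 0)) \<le> (\<integral>\<^sup>+t. ennreal (cmod (h (exp (2 * of_real pi * \<i> * of_real t)))) * indicator {0..1} t \<partial>lborel)"
proof -
  let ?e = "\<lambda>t::real. exp (2 * of_real pi * \<i> * of_real t)"
  have "((\<lambda>u. h u / (u - 0)) has_contour_integral 2 * of_real pi * \<i> * h 0) (circlepath 0 1)"
  proof (intro Cauchy_integral_circlepath)
    show "continuous_on (cball 0 1) h" "h holomorphic_on ball 0 1"
      using h S(2) ball_subset_cball by (blast intro: holomorphic_on_imp_continuous_on holomorphic_on_subset)+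
  qed simp
  then have "((\<lambda>t. h (?e t) / ?e t * (2 * of_real pi * \<i> * ?e t)) has_integral 2 * of_real pi * \<i> * h 0) {0..1}"
    unfolding has_contour_integral vector_derivative_circlepath by (simp add: circlepath)
  then have "((\<lambda>t. 2 * of_real pi * \<i> * h (?e t)) has_integral 2 * of_real pi * \<i> * h 0) {0..1}"
    by (simp add: mult_ac)
  from has_integral_mult_right[OF this, of "1 / (2 * of_real pi * \<i>)"]
  have I: "((\<lambda>t. h (?e t)) has_integral h 0) {0..1}" by simp
  have cont: "continuous_on {0..1} (\<lambda>t. h (?e t))"
    by (rule continuous_on_compose2[OF holomorphic_on_imp_continuous_on[OF h]])
       (use S in \<open>auto intro!: continuous_intros simp: norm_exp_eq_Re subset_iff\<close>)
  have si: "set_integrable lborel {0..1} (\<lambda>t. h (?e t))"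
    by (rule borel_integrable_atLeastAtMost') (rule cont)
  have "h 0 = (LINT t:{0..1}|lborel. h (?e t))"
    using set_borel_integral_eq_integral(2)[OF si] I by (simp add: integral_unique)
  then have "ennreal (cmod (h 0)) \<le> (\<integral>\<^sup>+t. ennreal (cmod (indicator {0..1} t *\<^sub>R h (?e t))) \<partial>lborel)"
    using integral_norm_bound_ennreal[OF si[unfolded set_integrable_def]] by (simp add: set_lebesgue_integral_def)
  also have "\<dots> = (\<integral>\<^sup>+t. ennreal (cmod (h (?e t))) * indicator {0..1} t \<partial>lborel)"
    by (intro nn_integral_cong) (auto simp: indicator_def)
  finally show ?thesis .
qed

lemma ball_mean_bound:
  fixes f :: "complex^'m::finite \<Rightarrow> complex"
  assumes \<Omega>: "open \<Omega>" and f: "holo_on \<Omega> f" and sub: "cball t r \<subseteq> \<Omega>"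
  shows "ennreal (cmod (f t)) * emeasure lborel (ball t r) \<le> (\<integral>\<^sup>+x. ennreal (cmod (f x)) * indicator \<Omega> x \<partial>lborel)"
proof -
  define F :: "complex^'m \<Rightarrow> ennreal" where "F x = ennreal (cmod (indicator \<Omega> x *\<^sub>R f x))" for x
  have [measurable]: "(\<lambda>x. indicator \<Omega> x *\<^sub>R f x) \<in> borel_measurable borel"
    by (rule borel_measurable_continuous_on_indicator[OF _ holo_on_continuous[OF f]]) (use \<Omega> in auto)
  have [measurable]: "F \<in> borel_measurable borel" unfolding F_def by measurable
  define B where "B = ball (0::complex^'m) r"
  have [measurable]: "B \<in> sets borel" by (simp add: B_def)
  let ?e = "\<lambda>\<theta>::real. exp (2 * of_real pi * \<i> * of_real \<theta>)"
  have rot: "(\<lambda>p::real \<times> (complex^'m). ?e (fst p) *s snd p) \<in> borel_measurable borel"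
  proof (rule borel_measurable_continuous_onI)
    have "(\<lambda>p::real \<times> (complex^'m). ?e (fst p) *s snd p) = (\<lambda>p. \<chi> i. ?e (fst p) * snd p $ i)" by (simp add: vector_scalar_mult_def)
    then show "continuous_on UNIV (\<lambda>p::real \<times> (complex^'m). ?e (fst p) *s snd p)"
      by (simp only:) (intro continuous_intros)
  qed
  have e1: "cmod (?e \<theta>) = 1" for \<theta> by (simp add: norm_exp_eq_Re)
  define G where "G \<theta> x = F (t + ?e \<theta> *s x) * indicator B x * indicator {0..1} \<theta>" for \<theta> :: real and x
  have [measurable]: "case_prod G \<in> borel_measurable (lborel \<Otimes>\<^sub>M lborel)"
  proof -
    let ?M = "borel :: (real \<times> (complex^'m)) measure"
    have "fst \<in> borel_measurable ?M" "snd \<in> borel_measurable ?M"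
      by (auto intro!: borel_measurable_continuous_onI continuous_intros)
    from measurable_compose[OF this(2), of "indicator B :: _ \<Rightarrow> ennreal" borel] measurable_compose[OF this(1), of "indicator {0..1} :: _ \<Rightarrow> ennreal" borel]
    have 1: "(\<lambda>p. indicator B (snd p) :: ennreal) \<in> borel_measurable ?M" "(\<lambda>p. indicator {0..1} (fst p) :: ennreal) \<in> borel_measurable ?M"
      by auto
    have "(\<lambda>p. t + ?e (fst p) *s snd p) \<in> borel_measurable ?M" by (intro borel_measurable_add borel_measurable_const) (rule rot)
    from measurable_compose[OF this \<open>F \<in> _\<close>] have "(\<lambda>p. F (t + ?e (fst p) *s snd p) * indicator B (snd p) * indicator {0..1} (fst p)) \<in> borel_measurable ?M"
      by (intro borel_measurable_times_ennreal 1)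
    moreover have "case_prod G = (\<lambda>p. F (t + ?e (fst p) *s snd p) * indicator B (snd p) * indicator {0..1} (fst p))"
      by (simp add: G_def fun_eq_iff)
    ultimately show ?thesis by (simp add: lborel_prod)
  qed
  have "emeasure lborel (ball t r) = emeasure lborel B"
  proof -
    have "emeasure lborel (ball t r) = (\<integral>\<^sup>+x. indicator B (x + - t) \<partial>lborel)"
      by (subst nn_integral_indicator[symmetric], simp, rule nn_integral_cong) (auto simp: B_def indicator_def dist_norm norm_minus_commute)
    also have "\<dots> = (\<integral>\<^sup>+x. indicator B x \<partial>lborel)" by (rule nn_integral_lborel_shift) measurable
    finally show ?thesis by simp
  qed
  then have "ennreal (cmod (f t)) * emeasure lborel (ball t r) = (\<integral>\<^sup>+x. ennreal (cmod (f t)) * indicator B x \<partial>lborel)"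
    by (subst nn_integral_cmult) auto
  also have "\<dots> \<le> (\<integral>\<^sup>+x. \<integral>\<^sup>+\<theta>. G \<theta> x \<partial>lborel \<partial>lborel)"
  proof (rule nn_integral_mono)
    fix x :: "complex^'m"
    show "ennreal (cmod (f t)) * indicator B x \<le> (\<integral>\<^sup>+\<theta>. G \<theta> x \<partial>lborel)"
    proof (cases "x \<in> B")
      case True
      let ?S = "{\<zeta>. t + \<zeta> *s x \<in> \<Omega>}"
      have "continuous_on UNIV (\<lambda>\<zeta>. t + \<zeta> *s x)"
        by (intro continuous_intros bounded_linear.continuous_on[OF bounded_linear_scal])
      then have "open ?S" using open_vimage[OF \<Omega>] by (simp add: vimage_def)
      have dom: "t + \<zeta> *s x \<in> \<Omega>" if "cmod \<zeta> \<le> 1" for \<zeta>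
      proof -
        have "norm (\<zeta> *s x) \<le> 1 * r" unfolding norm_scal using that True by (intro mult_mono) (auto simp: B_def)
        then show ?thesis using sub by (auto simp: dist_norm)
      qed
      have hol: "(\<lambda>\<zeta>. f (t + \<zeta> *s x)) holomorphic_on ?S"
        unfolding holomorphic_on_def field_differentiable_def
        using holo_on_line[OF \<Omega> f] by (blast intro: has_field_derivative_at_within)
      have "ennreal (cmod (f t)) \<le> (\<integral>\<^sup>+\<theta>. ennreal (cmod (f (t + ?e \<theta> *s x))) * indicator {0..1} \<theta> \<partial>lborel)"
        using circle_mean_bound[OF hol \<open>open ?S\<close>] dom by (auto simp: subset_iff)
      also have "\<dots> = (\<integral>\<^sup>+\<theta>. G \<theta> x \<partial>lborel)"
        using True dom e1 by (intro nn_integral_cong) (auto simp: G_def F_def)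
      finally show ?thesis using True by simp
    qed simp
  qed
  also have "\<dots> = (\<integral>\<^sup>+\<theta>. \<integral>\<^sup>+x. G \<theta> x \<partial>lborel \<partial>lborel)"
    by (rule lborel_pair.Fubini') measurable
  also have "\<dots> \<le> (\<integral>\<^sup>+\<theta>. (\<integral>\<^sup>+x. F x \<partial>lborel) * indicator {0..1} (\<theta>::real) \<partial>lborel)"
  proof (rule nn_integral_mono)
    fix \<theta> :: real
    let ?T = "\<lambda>x::complex^'m. ?e \<theta> *s x"
    have "bounded_linear ?T" by (auto simp: linear_conv_bounded_linear[symmetric] linear_iff vec_eq_iff algebra_simps)
    then have [measurable]: "?T \<in> borel_measurable borel" by (intro borel_measurable_continuous_onI linear_continuous_on)
    have "(\<integral>\<^sup>+x. G \<theta> x \<partial>lborel) \<le> (\<integral>\<^sup>+x. F (t + ?T x) * indicator {0..1} \<theta> \<partial>lborel)"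
      by (intro nn_integral_mono) (auto simp: G_def indicator_def)
    also have "\<dots> = (\<integral>\<^sup>+x. F (t + ?T x) \<partial>lborel) * indicator {0..1} \<theta>" by (rule nn_integral_multc) measurable
    also have "(\<integral>\<^sup>+x. F (t + ?T x) \<partial>lborel) = (\<integral>\<^sup>+x. F (t + x) \<partial>distr lborel borel ?T)"
      by (subst nn_integral_distr) auto
    also have "\<dots> = (\<integral>\<^sup>+x. F (t + x) \<partial>lborel)" by (simp add: lborel_rotation[OF e1])
    also have "\<dots> = (\<integral>\<^sup>+x. F x \<partial>lborel)" using nn_integral_lborel_shift[of F t] by (simp add: add.commute)
    finally show "(\<integral>\<^sup>+x. G \<theta> x \<partial>lborel) \<le> (\<integral>\<^sup>+x. F x \<partial>lborel) * indicator {0..1} \<theta>" .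
  qed
  also have "\<dots> = (\<integral>\<^sup>+x. F x \<partial>lborel)" by (subst nn_integral_cmult) auto
  also have "\<dots> = (\<integral>\<^sup>+x. ennreal (cmod (f x)) * indicator \<Omega> x \<partial>lborel)"
    by (intro nn_integral_cong) (auto simp: F_def indicator_def)
  finally show ?thesis .
qed

text \<open>The mean value inequality applied to the holomorphic function f * f, whose modulus is
  the square of that of f.\<close>

lemma bergman_point_bound:
  fixes f :: "complex^'m::finite \<Rightarrow> complex"
  assumes \<Omega>: "open \<Omega>" and f: "f \<in> bergman_space \<Omega>" and sub: "cball t r \<subseteq> \<Omega>" and r: "r > 0"
  shows "(cmod (f t))^2 \<le> (LINT z:\<Omega>|lborel. (cmod (f z))^2) / measure lborel (ball (0::complex^'m) r)"
proof -
  have h: "holo_on \<Omega> f" and I: "set_integrable lborel \<Omega> (\<lambda>z. (cmod (f z))^2)" using f by (auto simp: bergman_space_def)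
  have "ennreal (cmod (f t * f t)) * emeasure lborel (ball t r) \<le> (\<integral>\<^sup>+x. ennreal (cmod (f x * f x)) * indicator \<Omega> x \<partial>lborel)"
    by (rule ball_mean_bound[OF \<Omega> holo_on_mult[OF h h] sub])
  also have "\<dots> = (\<integral>\<^sup>+x. ennreal (indicator \<Omega> x *\<^sub>R (cmod (f x))^2) \<partial>lborel)"
    by (intro nn_integral_cong) (auto simp: indicator_def norm_mult power2_eq_square)
  also have "\<dots> = ennreal (LINT z:\<Omega>|lborel. (cmod (f z))^2)"
    unfolding set_lebesgue_integral_def by (rule nn_integral_eq_integral[OF I[unfolded set_integrable_def]]) auto
  also have "emeasure lborel (ball t r) = ennreal (measure lborel (ball t r))"
    using emeasure_lborel_ball_finite[of t r] by (intro emeasure_eq_ennreal_measure) auto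
  finally have "(cmod (f t))^2 * measure lborel (ball t r) \<le> (LINT z:\<Omega>|lborel. (cmod (f z))^2)"
    by (simp add: norm_mult power2_eq_square set_lebesgue_integral_def flip: ennreal_mult)
  moreover have "measure lborel (ball t r) = measure lborel (ball (0::complex^'m) r)" using content_ball[of r t] content_ball[of r "0::complex^'m"] r by simp
  moreover have "measure lborel (ball (0::complex^'m) r) > 0" using content_ball_pos[OF r] .
  ultimately show ?thesis by (simp add: field_simps)
qed

section \<open>Polarized potentials of constant holomorphic sectional curvature\<close>

text \<open>The quantity |Y|^2 exp(-2 C t) does not increase, and it starts at 0.\<close>

lemma gronwall_zero:
  fixes Y :: "real \<Rightarrow> 'a::real_inner"
  assumes Y: "\<And>t. t \<in> {0..1} \<Longrightarrow> (Y has_vector_derivative Y' t) (at t)"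
    and le: "\<And>t. t \<in> {0..1} \<Longrightarrow> norm (Y' t) \<le> C * norm (Y t)" and 0: "Y 0 = 0" and t: "t \<in> {0..1}"
  shows "Y t = 0"
proof -
  define \<phi> where "\<phi> t = (Y t \<bullet> Y t) * exp (- 2 * C * t)" for t
  have d: "(\<phi> has_real_derivative (2 * (Y x \<bullet> Y' x) - 2 * C * (Y x \<bullet> Y x)) * exp (- 2 * C * x)) (at x)" if "x \<in> {0..1}" for x
  proof -
    have "((\<lambda>t. Y t \<bullet> Y t) has_real_derivative (Y x \<bullet> Y' x + Y' x \<bullet> Y x)) (at x)"
      using Y[OF that] unfolding has_vector_derivative_def has_field_derivative_def
      by (auto intro!: derivative_eq_intros simp: algebra_simps inner_commute)
    then show ?thesis unfolding \<phi>_def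
      by (auto intro!: derivative_eq_intros simp: algebra_simps inner_commute)
  qed
  have "\<phi> t \<le> \<phi> 0"
  proof (rule DERIV_nonpos_imp_decreasing_open[of 0 t \<phi>])
    fix x assume x: "0 < x" "x < t"
    then have x': "x \<in> {0..1}" using t by auto
    have "Y x \<bullet> Y' x \<le> norm (Y x) * norm (Y' x)" by (rule norm_cauchy_schwarz)
    also have "\<dots> \<le> norm (Y x) * (C * norm (Y x))" using le[OF x'] by (rule mult_left_mono) simp
    also have "\<dots> = C * (Y x \<bullet> Y x)" by (simp add: dot_square_norm power2_eq_square)
    finally have "(2 * (Y x \<bullet> Y' x) - 2 * C * (Y x \<bullet> Y x)) * exp (- 2 * C * x) \<le> 0"
      by (intro mult_nonpos_nonneg) auto
    then show "\<exists>y. (\<phi> has_real_derivative y) (at x) \<and> y \<le> 0" using d[OF x'] by blast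
  next
    show "continuous_on {0..t} \<phi>"
      using t by (intro continuous_at_imp_continuous_on ballI DERIV_isCont[OF d]) auto
  qed (use t in auto)
  then have "(Y t \<bullet> Y t) * exp (- 2 * C * t) \<le> 0" by (simp add: \<phi>_def 0)
  then have "Y t \<bullet> Y t \<le> 0" by (simp add: mult_le_0_iff)
  then show ?thesis using inner_ge_zero[of "Y t"] inner_eq_zero_iff[of "Y t"] by linarith
qed

lemma has_vector_derivative_vec:
  assumes "\<And>b. ((\<lambda>t. f b t) has_vector_derivative f' b) F"
  shows "((\<lambda>t. \<chi> b. f b t :: complex^'m::finite) has_vector_derivative (\<chi> b. f' b)) F"
proof -
  have eq: "(\<chi> b. x b) = (\<Sum>b\<in>UNIV. axis b (x b))" for x :: "'m \<Rightarrow> complex"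
    by (simp add: vec_eq_iff axis_def)
  show ?thesis unfolding eq
    by (intro has_vector_derivative_sum bounded_linear.has_vector_derivative[OF bounded_linear_axis] assms)
qed

text \<open>Here s is independent of z, and no reality condition ties \<open>q\<close> to
  \<open>p\<close>. The normalizations \<open>norm1\<close> and \<open>norm2\<close> remove the pure
  terms, as for the diastasis; \<open>pde\<close> is the polarized equation of constant holomorphic
  sectional curvature -2\<kappa>.\<close>

locale polarized_potential =
  fixes \<Phi> :: "complex^('n::finite+'n) \<Rightarrow> complex" and gi :: "'n \<Rightarrow> 'n \<Rightarrow> complex^('n+'n) \<Rightarrow> complex"
    and p q :: "complex^'n" and r :: real and \<kappa> :: complex and g :: "'n \<Rightarrow> 'n \<Rightarrow> complex^('n+'n) \<Rightarrow> complex"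
  defines g_def: "g \<equiv> \<lambda>a b. pd (Inl a) (pd (Inr b) \<Phi>)"
  assumes r: "0 < r" and holo: "holo_on (polydisc (mk p q) r) \<Phi>"
    and norm1: "z \<in> polydisc p r \<Longrightarrow> \<Phi> (mk z q) = 0" and norm2: "s \<in> polydisc q r \<Longrightarrow> \<Phi> (mk p s) = 0"
    and holo_gi: "holo_on (polydisc (mk p q) r) (gi \<nu> m)"
    and inv1: "Z \<in> polydisc (mk p q) r \<Longrightarrow> (\<Sum>m\<in>UNIV. gi \<nu> m Z * g m b Z) = (if \<nu> = b then 1 else 0)"
    and inv2: "Z \<in> polydisc (mk p q) r \<Longrightarrow> (\<Sum>\<nu>\<in>UNIV. g a \<nu> Z * gi \<nu> m Z) = (if a = m then 1 else 0)"
    and pde: "Z \<in> polydisc (mk p q) r \<Longrightarrow> pd (Inl c) (pd (Inr d) (g a b)) Z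
      = (\<Sum>m\<in>UNIV. \<Sum>\<nu>\<in>UNIV. gi \<nu> m Z * pd (Inl c) (g a \<nu>) Z * pd (Inr d) (g m b) Z)
        + \<kappa> * (g a b Z * g c d Z + g a d Z * g c b Z)"
begin

abbreviation P where "P \<equiv> polydisc (mk p q) r"

lemma opP: "open P" by (rule open_polydisc)

lemma holo_g: "holo_on P (g a b)"
  unfolding g_def by (intro holo_on_pd opP holo)

text \<open>The Christoffel symbols of the conjugate variables.\<close>
definition \<Gamma> where "\<Gamma> \<nu> b d Z = (\<Sum>m\<in>UNIV. gi \<nu> m Z * pd (Inr d) (g m b) Z)"

lemma holo_\<Gamma>: "holo_on P (\<Gamma> \<nu> b d)"
  unfolding \<Gamma>_def by (intro holo_on_sum holo_on_mult holo_gi holo_on_pd opP holo_g)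

lemma g_\<Gamma>: assumes Z: "Z \<in> P" shows "(\<Sum>\<nu>\<in>UNIV. g a \<nu> Z * \<Gamma> \<nu> b d Z) = pd (Inr d) (g a b) Z"
proof -
  have "(\<Sum>\<nu>\<in>UNIV. g a \<nu> Z * \<Gamma> \<nu> b d Z) = (\<Sum>\<nu>\<in>UNIV. \<Sum>m\<in>UNIV. g a \<nu> Z * gi \<nu> m Z * pd (Inr d) (g m b) Z)"
    by (simp add: \<Gamma>_def sum_distrib_left mult.assoc)
  also have "\<dots> = (\<Sum>m\<in>UNIV. (\<Sum>\<nu>\<in>UNIV. g a \<nu> Z * gi \<nu> m Z) * pd (Inr d) (g m b) Z)"
    by (subst sum.swap) (simp add: sum_distrib_right)
  also have "\<dots> = (\<Sum>m\<in>UNIV. (if a = m then pd (Inr d) (g m b) Z else 0))" using inv2[OF Z] by (intro sum.cong) auto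
  finally show ?thesis by simp
qed

lemma g_inject:
  assumes Z: "Z \<in> P" and eq: "\<And>a. (\<Sum>\<nu>\<in>UNIV. g a \<nu> Z * x \<nu>) = (\<Sum>\<nu>\<in>UNIV. g a \<nu> Z * y \<nu>)"
  shows "x \<nu> = y \<nu>"
proof -
  have "(\<Sum>m\<in>UNIV. gi \<nu> m Z * (\<Sum>b\<in>UNIV. g m b Z * x b)) = x \<nu>" for x
  proof -
    have "(\<Sum>m\<in>UNIV. gi \<nu> m Z * (\<Sum>b\<in>UNIV. g m b Z * x b)) = (\<Sum>b\<in>UNIV. (\<Sum>m\<in>UNIV. gi \<nu> m Z * g m b Z) * x b)"
      unfolding sum_distrib_left sum_distrib_right mult.assoc by (rule sum.swap)
    also have "\<dots> = (\<Sum>b\<in>UNIV. if \<nu> = b then x b else 0)" using inv1[OF Z] by (intro sum.cong) auto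
    finally show ?thesis by simp
  qed
  then show ?thesis by (metis (no_types, lifting) eq sum.cong)
qed

text \<open>Differentiate \<open>g_\<Gamma>\<close> in z. The product-rule term with
  \<open>pd (Inl c) (g a \<nu>)\<close> is the quadratic term of \<open>pde\<close>; it cancels, and
  the metric is divided out by \<open>g_inject\<close>.\<close>

lemma d_\<Gamma>:
  assumes Z: "Z \<in> P"
  shows "pd (Inl c) (\<Gamma> \<nu> b d) Z = \<kappa> * ((if \<nu> = b then g c d Z else 0) + (if \<nu> = d then g c b Z else 0))"
proof (rule g_inject[OF Z, where x = "\<lambda>\<nu>. pd (Inl c) (\<Gamma> \<nu> b d) Z"
      and y = "\<lambda>\<nu>. \<kappa> * ((if \<nu> = b then g c d Z else 0) + (if \<nu> = d then g c b Z else 0))"])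
  fix a
  have "pd (Inl c) (pd (Inr d) (g a b)) Z = pd (Inl c) (\<lambda>Z. \<Sum>\<nu>\<in>UNIV. g a \<nu> Z * \<Gamma> \<nu> b d Z) Z"
    by (rule pd_cong[OF opP Z]) (simp add: g_\<Gamma>)
  also have "\<dots> = (\<Sum>\<nu>\<in>UNIV. pd (Inl c) (\<lambda>Z. g a \<nu> Z * \<Gamma> \<nu> b d Z) Z)"
    by (rule pd_sum[OF _ Z]) (intro holo_on_mult holo_g holo_\<Gamma>)
  also have "\<dots> = (\<Sum>\<nu>\<in>UNIV. pd (Inl c) (g a \<nu>) Z * \<Gamma> \<nu> b d Z + g a \<nu> Z * pd (Inl c) (\<Gamma> \<nu> b d) Z)"
    by (intro sum.cong refl pd_mult[OF holo_g holo_\<Gamma> Z])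
  finally have 1: "pd (Inl c) (pd (Inr d) (g a b)) Z
    = (\<Sum>\<nu>\<in>UNIV. pd (Inl c) (g a \<nu>) Z * \<Gamma> \<nu> b d Z) + (\<Sum>\<nu>\<in>UNIV. g a \<nu> Z * pd (Inl c) (\<Gamma> \<nu> b d) Z)"
    by (simp add: sum.distrib)
  have 2: "(\<Sum>m\<in>UNIV. \<Sum>\<nu>\<in>UNIV. gi \<nu> m Z * pd (Inl c) (g a \<nu>) Z * pd (Inr d) (g m b) Z)
    = (\<Sum>\<nu>\<in>UNIV. pd (Inl c) (g a \<nu>) Z * \<Gamma> \<nu> b d Z)"
    by (subst sum.swap) (simp add: \<Gamma>_def sum_distrib_left mult_ac)
  have 3: "(\<Sum>\<nu>\<in>UNIV. g a \<nu> Z * (\<kappa> * ((if \<nu> = b then g c d Z else 0) + (if \<nu> = d then g c b Z else 0))))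
    = \<kappa> * (g a b Z * g c d Z + g a d Z * g c b Z)"
  proof -
    have "(\<Sum>\<nu>\<in>UNIV. g a \<nu> Z * (\<kappa> * ((if \<nu> = b then g c d Z else 0) + (if \<nu> = d then g c b Z else 0))))
      = (\<Sum>\<nu>\<in>UNIV. (if \<nu> = b then \<kappa> * g a b Z * g c d Z else 0) + (if \<nu> = d then \<kappa> * g a d Z * g c b Z else 0))"
      by (intro sum.cong) (auto simp: algebra_simps)
    then show ?thesis by (simp add: sum.distrib algebra_simps)
  qed
  show "(\<Sum>\<nu>\<in>UNIV. g a \<nu> Z * pd (Inl c) (\<Gamma> \<nu> b d) Z) =
    (\<Sum>\<nu>\<in>UNIV. g a \<nu> Z * (\<kappa> * ((if \<nu> = b then g c d Z else 0) + (if \<nu> = d then g c b Z else 0))))"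
    using 1 2 3 pde[OF Z, of c d a b] by simp
qed

text \<open>The z-derivative of \<open>pd (Inr d) \<Phi>\<close> is \<open>g c d\<close>, so the
  subtracted terms have exactly the z-derivatives found in \<open>d_\<Gamma>\<close>; what remains
  depends on s alone.\<close>

definition A where "A \<nu> b d Z = \<Gamma> \<nu> b d Z
  - ((if \<nu> = b then \<kappa> else 0) * pd (Inr d) \<Phi> Z + (if \<nu> = d then \<kappa> else 0) * pd (Inr b) \<Phi> Z)"

lemma holo_d: "holo_on P (pd i \<Phi>)" "holo_on P (pd j (pd i \<Phi>))"
  by (intro holo_on_pd opP holo)+

lemma holo_A: "holo_on P (A \<nu> b d)"
  unfolding A_def by (intro holo_on_diff holo_on_add holo_on_mult holo_on_const holo_\<Gamma> holo_d)

lemma d_A: assumes Z: "Z \<in> P" shows "pd (Inl c) (A \<nu> b d) Z = 0"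
proof -
  have "pd (Inl c) (A \<nu> b d) Z = pd (Inl c) (\<Gamma> \<nu> b d) Z - ((if \<nu> = b then \<kappa> else 0) * g c d Z + (if \<nu> = d then \<kappa> else 0) * g c b Z)"
    unfolding A_def g_def
    by (subst pd_diff[OF holo_\<Gamma> _ Z] pd_add[OF _ _ Z] pd_cmult[OF _ Z]; (intro holo_on_add holo_on_mult holo_on_const holo_d)?)+ simp
  then show ?thesis by (cases "\<nu> = b"; cases "\<nu> = d") (simp_all add: d_\<Gamma>[OF Z] distrib_left)
qed

lemma indep:
  assumes f: "holo_on P f" and 0: "\<And>c Z. Z \<in> P \<Longrightarrow> pd (Inl c) f Z = 0" and z: "z \<in> polydisc p r" and s: "s \<in> polydisc q r"
  shows "f (mk z s) = f (mk p s)"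
proof (rule has_derivative_zero_unique[OF convex_polydisc _ z])
  fix x assume x: "x \<in> polydisc p r"
  then have xP: "mk x s \<in> P" using s by (simp add: mk_in_polydisc)
  from holo_on_chain[OF opP f has_derivative_mk(3) this]
  show "((\<lambda>z. f (mk z s)) has_derivative (\<lambda>h. 0)) (at x within polydisc p r)"
    by (simp add: sum_UNIV_sum 0[OF xP])
qed (use r in simp)

lemma in_P: "z \<in> polydisc p r \<Longrightarrow> s \<in> polydisc q r \<Longrightarrow> mk z s \<in> P" "p \<in> polydisc p r" "q \<in> polydisc q r"
  using r by (auto simp: mk_in_polydisc)

lemma d_at_p: assumes s: "s \<in> polydisc q r" shows "pd (Inr b) \<Phi> (mk p s) = 0" "pd (Inr d) (pd (Inr b) \<Phi>) (mk p s) = 0"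
proof -
  have 1: "pd (Inr b) \<Phi> (mk p s) = 0" if "s \<in> polydisc q r" for s
  proof -
    have "pd b (\<lambda>s. \<Phi> (mk p s)) s = pd b (\<lambda>s. 0) s" by (rule pd_cong[OF open_polydisc that]) (rule norm2)
    then show ?thesis by (simp add: pd_mk)
  qed
  show "pd (Inr b) \<Phi> (mk p s) = 0" using 1 s by blast
  have "pd d (\<lambda>s. pd (Inr b) \<Phi> (mk p s)) s = pd d (\<lambda>s. 0) s" by (rule pd_cong[OF open_polydisc s]) (rule 1)
  then show "pd (Inr d) (pd (Inr b) \<Phi>) (mk p s) = 0" by (simp add: pd_mk(2)[of d "pd (Inr b) \<Phi>"])
qed

lemma d_at_q: "pd (Inl a) \<Phi> (mk p q) = 0"
proof -
  have "pd a (\<lambda>z. \<Phi> (mk z q)) p = pd a (\<lambda>s. 0) p" by (rule pd_cong[OF open_polydisc in_P(2)]) (rule norm1)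
  then show ?thesis by (simp add: pd_mk)
qed

text \<open>The difference \<open>B\<close> of the two sides does not depend on z, and at z = p
  every term carries an s-derivative of the potential, all of which vanish there.\<close>

lemma second_order:
  assumes Z: "Z \<in> P"
  shows "pd (Inr d) (pd (Inr b) \<Phi>) Z = \<kappa> * pd (Inr b) \<Phi> Z * pd (Inr d) \<Phi> Z + (\<Sum>\<nu>\<in>UNIV. A \<nu> b d Z * pd (Inr \<nu>) \<Phi> Z)"
proof -
  define B where "B Z = pd (Inr d) (pd (Inr b) \<Phi>) Z - (\<kappa> * (pd (Inr b) \<Phi> Z * pd (Inr d) \<Phi> Z) + (\<Sum>\<nu>\<in>UNIV. A \<nu> b d Z * pd (Inr \<nu>) \<Phi> Z))" for Z
  note H = holo_on_diff holo_on_add holo_on_sum holo_on_mult holo_on_const holo_d holo_A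
  have "holo_on P B" unfolding B_def by (intro H)
  moreover have "pd (Inl a) B Z = 0" if Z: "Z \<in> P" for a Z
  proof -
    have "pd (Inl a) B Z = pd (Inl a) (pd (Inr d) (pd (Inr b) \<Phi>)) Z - (\<kappa> * (g a b Z * pd (Inr d) \<Phi> Z + pd (Inr b) \<Phi> Z * g a d Z)
       + (\<Sum>\<nu>\<in>UNIV. pd (Inl a) (A \<nu> b d) Z * pd (Inr \<nu>) \<Phi> Z + A \<nu> b d Z * g a \<nu> Z))"
      unfolding B_def g_def
      by (subst pd_diff[OF _ _ Z] pd_add[OF _ _ Z] pd_sum[OF _ Z] pd_cmult[OF _ Z] pd_mult[OF _ _ Z]; (intro H)?)+ simp
    moreover have "pd (Inl a) (pd (Inr d) (pd (Inr b) \<Phi>)) Z = pd (Inr d) (g a b) Z"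
      unfolding g_def by (rule pd_commute[OF opP holo_d(1) Z])
    moreover have "(\<Sum>\<nu>\<in>UNIV. A \<nu> b d Z * g a \<nu> Z) = pd (Inr d) (g a b) Z - \<kappa> * (g a b Z * pd (Inr d) \<Phi> Z + pd (Inr b) \<Phi> Z * g a d Z)"
    proof -
      have "(\<Sum>\<nu>\<in>UNIV. A \<nu> b d Z * g a \<nu> Z) = (\<Sum>\<nu>\<in>UNIV. g a \<nu> Z * \<Gamma> \<nu> b d Z
         - ((if \<nu> = b then \<kappa> * g a b Z * pd (Inr d) \<Phi> Z else 0) + (if \<nu> = d then \<kappa> * g a d Z * pd (Inr b) \<Phi> Z else 0)))"
        by (intro sum.cong) (auto simp: A_def algebra_simps)
      then show ?thesis by (simp add: sum_subtractf sum.distrib g_\<Gamma>[OF Z] algebra_simps)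
    qed
    ultimately show ?thesis by (simp add: d_A[OF Z])
  qed
  moreover obtain z s where zs: "Z = mk z s" "z \<in> polydisc p r" "s \<in> polydisc q r" using mk_exhaust Z by (metis mk_in_polydisc)
  ultimately have "B Z = B (mk p s)" using indep by blast
  also have "\<dots> = 0" using d_at_p zs by (simp add: B_def)
  finally show ?thesis by (simp add: B_def)
qed

text \<open>Riccati substitution: the second derivatives of \<open>F\<close> absorb the quadratic
  term of \<open>second_order\<close>, leaving a linear system.\<close>

definition F where "F Z = exp (- \<kappa> * \<Phi> Z)"

lemma holo_F: "holo_on P F"
  unfolding F_def by (intro holo_on_exp holo_on_mult holo_on_const holo)

lemma d_F: assumes Z: "Z \<in> P" shows "pd i F Z = F Z * (- \<kappa> * pd i \<Phi> Z)"
  unfolding F_def by (subst pd_exp[OF _ Z] pd_cmult[OF holo Z]; (intro holo_on_mult holo_on_const holo)?)+ simp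

lemma linear_system:
  assumes Z: "Z \<in> P" shows "pd (Inr d) (pd (Inr b) F) Z = (\<Sum>\<nu>\<in>UNIV. A \<nu> b d Z * pd (Inr \<nu>) F Z)"
proof -
  have "pd (Inr d) (pd (Inr b) F) Z = pd (Inr d) (\<lambda>Z. F Z * (- \<kappa> * pd (Inr b) \<Phi> Z)) Z"
    by (rule pd_cong[OF opP Z]) (rule d_F)
  also have "\<dots> = pd (Inr d) F Z * (- \<kappa> * pd (Inr b) \<Phi> Z) + F Z * (- \<kappa> * pd (Inr d) (pd (Inr b) \<Phi>) Z)"
    by (subst pd_mult[OF holo_F _ Z] pd_cmult[OF holo_d(1) Z]; (intro holo_on_mult holo_on_const holo_d)?)+ simp
  also have "\<dots> = (\<Sum>\<nu>\<in>UNIV. A \<nu> b d Z * (F Z * (- \<kappa> * pd (Inr \<nu>) \<Phi> Z)))"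
    by (simp add: second_order[OF Z] d_F[OF Z] algebra_simps sum_distrib_left sum_negf)
  finally show ?thesis by (simp add: d_F[OF Z])
qed

text \<open>Both sides satisfy, in the conjugate variable, one and the same linear system of second
  order (its coefficients \<open>A\<close> do not involve \<open>z\<close>) with the same initial values.\<close>
lemma exp_potential:
  assumes z: "z \<in> polydisc p r" and s: "s \<in> polydisc q r"
  shows "exp (- \<kappa> * \<Phi> (mk z s)) = 1 - \<kappa> * (\<Sum>a\<in>UNIV. \<Sum>b\<in>UNIV. gi b a (mk p q) * pd (Inr b) \<Phi> (mk z q) * pd (Inl a) \<Phi> (mk p s))"
proof -
  define v where "v = s - q"
  define S where "S t = q + t *\<^sub>R v" for t
  have S: "S t \<in> polydisc q r" if "t \<in> {0..1}" for t
  proof -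
    have "S t = (1 - t) *\<^sub>R q + t *\<^sub>R s" by (simp add: S_def v_def algebra_simps)
    then show ?thesis using convexD_alt[OF convex_polydisc in_P(3) s, of t] that by simp
  qed
  have curve: "((\<lambda>t. f (mk w (S t))) has_vector_derivative (\<Sum>d\<in>UNIV. v$d * pd (Inr d) f (mk w (S t)))) (at t)"
    if f: "holo_on P f" and w: "w \<in> polydisc p r" and t: "t \<in> {0..1}" for f w t
  proof -
    have "(S has_derivative (\<lambda>h. h *\<^sub>R v)) (at t)"
      unfolding S_def by (auto intro!: derivative_eq_intros)
    from has_derivative_compose[OF this has_derivative_mk(4)]
    have "((\<lambda>t. mk w (S t)) has_derivative (\<lambda>h. mk 0 (h *\<^sub>R v))) (at t)" .
    from holo_on_chain[OF opP f this in_P(1)[OF w S[OF t]]]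
    show ?thesis unfolding has_vector_derivative_def
      by (simp add: sum_UNIV_sum scaleR_sum_right)
  qed
  \<comment> \<open>Chosen so that both sides have the same s-derivatives at s = q, as
    \<open>Cg\<close> confirms.\<close>
  define C where "C a = \<kappa> * (\<Sum>b\<in>UNIV. gi b a (mk p q) * pd (Inr b) \<Phi> (mk z q))" for a
  \<comment> \<open>\<open>Yc\<close> is the s-gradient of the difference \<open>D\<close> of the
    two sides, followed along the segment \<open>S\<close> from q to s.\<close>
  define Yc where "Yc b t = pd (Inr b) F (mk z (S t)) + (\<Sum>a\<in>UNIV. C a * g a b (mk p (S t)))" for b t
  define Y where "Y t = (\<chi> b. Yc b t)" for t
  define Y' where "Y' t = (\<chi> b. \<Sum>d\<in>UNIV. v$d * (\<Sum>\<nu>\<in>UNIV. A \<nu> b d (mk z (S t)) * Yc \<nu> t))" for t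
  define D where "D t = F (mk z (S t)) - 1 + (\<Sum>a\<in>UNIV. C a * pd (Inl a) \<Phi> (mk p (S t)))" for t
  have F1: "F (mk z q) = 1" by (simp add: F_def norm1[OF z])
  have Cg: "(\<Sum>a\<in>UNIV. C a * g a b (mk p q)) = \<kappa> * pd (Inr b) \<Phi> (mk z q)" for b
  proof -
    have "(\<Sum>a\<in>UNIV. C a * g a b (mk p q)) = (\<Sum>a\<in>UNIV. \<Sum>b'\<in>UNIV. \<kappa> * pd (Inr b') \<Phi> (mk z q) * (gi b' a (mk p q) * g a b (mk p q)))"
      by (simp add: C_def sum_distrib_left sum_distrib_right mult_ac)
    also have "\<dots> = (\<Sum>b'\<in>UNIV. \<kappa> * pd (Inr b') \<Phi> (mk z q) * (\<Sum>a\<in>UNIV. gi b' a (mk p q) * g a b (mk p q)))"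
      by (subst sum.swap) (simp add: sum_distrib_left)
    also have "\<dots> = (\<Sum>b'\<in>UNIV. if b' = b then \<kappa> * pd (Inr b') \<Phi> (mk z q) else 0)"
      using inv1[OF in_P(1)[OF in_P(2,3)]] by (intro sum.cong) auto
    finally show ?thesis by simp
  qed
  have "S 0 = q" by (simp add: S_def)
  then have "Yc b 0 = 0" for b
    using d_F[OF in_P(1)[OF z in_P(3)]] by (simp add: Yc_def Cg F1)
  then have Y0: "Y 0 = 0" by (simp add: Y_def vec_eq_iff)
  have dYc: "((\<lambda>t. Yc b t) has_vector_derivative (\<Sum>d\<in>UNIV. v$d * (\<Sum>\<nu>\<in>UNIV. A \<nu> b d (mk z (S t)) * Yc \<nu> t))) (at t)"
    if t: "t \<in> {0..1}" for b t
  proof -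
    note zP = in_P(1)[OF z S[OF t]] and pP = in_P(1)[OF in_P(2) S[OF t]]
    have "((\<lambda>t. Yc b t) has_vector_derivative (\<Sum>d\<in>UNIV. v$d * pd (Inr d) (pd (Inr b) F) (mk z (S t)))
      + (\<Sum>a\<in>UNIV. C a * (\<Sum>d\<in>UNIV. v$d * pd (Inr d) (g a b) (mk p (S t))))) (at t)"
      unfolding Yc_def
      by (intro has_vector_derivative_add has_vector_derivative_sum has_vector_derivative_mult_right
          curve[OF holo_on_pd[OF opP holo_F] z t] curve[OF holo_g in_P(2) t])
    also have "(\<Sum>a\<in>UNIV. C a * (\<Sum>d\<in>UNIV. v$d * pd (Inr d) (g a b) (mk p (S t))))
      = (\<Sum>d\<in>UNIV. v$d * (\<Sum>a\<in>UNIV. C a * pd (Inr d) (g a b) (mk p (S t))))"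
      unfolding sum_distrib_left by (subst sum.swap) (simp add: mult_ac)
    also have "(\<Sum>d\<in>UNIV. v$d * pd (Inr d) (pd (Inr b) F) (mk z (S t))) + (\<Sum>d\<in>UNIV. v$d * (\<Sum>a\<in>UNIV. C a * pd (Inr d) (g a b) (mk p (S t))))
      = (\<Sum>d\<in>UNIV. v$d * (pd (Inr d) (pd (Inr b) F) (mk z (S t)) + (\<Sum>a\<in>UNIV. C a * pd (Inr d) (g a b) (mk p (S t)))))"
      by (simp add: distrib_left sum.distrib)
    also have "\<dots> = (\<Sum>d\<in>UNIV. v$d * (\<Sum>\<nu>\<in>UNIV. A \<nu> b d (mk z (S t)) * Yc \<nu> t))"
    proof (intro sum.cong refl arg_cong2[where f = "(*)"])
      fix d
      \<comment> \<open>At z = p the correction terms of \<open>A\<close> vanish, so the symbols at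
        (p, s) are the coefficients \<open>A\<close>, which are the same at (z, s): the metric at
        (p, s) solves the same linear system as the gradient of \<open>F\<close> at (z, s).\<close>
      have G: "\<Gamma> \<nu> b d (mk p (S t)) = A \<nu> b d (mk z (S t))" for \<nu>
        using indep[OF holo_A d_A z S[OF t], of \<nu> b d] d_at_p[OF S[OF t]] by (simp add: A_def)
      have "(\<Sum>a\<in>UNIV. C a * pd (Inr d) (g a b) (mk p (S t))) = (\<Sum>a\<in>UNIV. \<Sum>\<nu>\<in>UNIV. A \<nu> b d (mk z (S t)) * (C a * g a \<nu> (mk p (S t))))"
        by (simp add: g_\<Gamma>[OF pP, symmetric] G sum_distrib_left mult_ac)
      also have "\<dots> = (\<Sum>\<nu>\<in>UNIV. A \<nu> b d (mk z (S t)) * (\<Sum>a\<in>UNIV. C a * g a \<nu> (mk p (S t))))"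
        by (subst sum.swap) (simp add: sum_distrib_left)
      finally show "pd (Inr d) (pd (Inr b) F) (mk z (S t)) + (\<Sum>a\<in>UNIV. C a * pd (Inr d) (g a b) (mk p (S t)))
        = (\<Sum>\<nu>\<in>UNIV. A \<nu> b d (mk z (S t)) * Yc \<nu> t)"
        by (simp add: linear_system[OF zP] Yc_def distrib_left sum.distrib)
    qed
    finally show ?thesis .
  qed
  have dY: "(Y has_vector_derivative Y' t) (at t)" if "t \<in> {0..1}" for t
    unfolding Y_def Y'_def by (rule has_vector_derivative_vec) (rule dYc[OF that])
  have "\<exists>M. \<forall>t\<in>{0..1}. cmod (A \<nu> b d (mk z (S t))) \<le> M" for \<nu> b d
  proof -
    have "continuous_on {0..1} (\<lambda>t. A \<nu> b d (mk z (S t)))"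
      using curve[OF holo_A z] by (intro continuous_at_imp_continuous_on ballI has_vector_derivative_continuous) blast
    then have "bounded ((\<lambda>t. A \<nu> b d (mk z (S t))) ` {0..1})" by (intro compact_imp_bounded compact_continuous_image) auto
    then show ?thesis unfolding bounded_iff by auto
  qed
  then obtain M where M: "\<And>\<nu> b d t. t \<in> {0..1} \<Longrightarrow> cmod (A \<nu> b d (mk z (S t))) \<le> M \<nu> b d" by metis
  have bound: "norm (Y' t) \<le> (\<Sum>b\<in>UNIV. \<Sum>d\<in>UNIV. cmod (v$d) * (\<Sum>\<nu>\<in>UNIV. M \<nu> b d)) * norm (Y t)" if t: "t \<in> {0..1}" for t
  proof -
    have Yn: "cmod (Yc \<nu> t) \<le> norm (Y t)" for \<nu> using Finite_Cartesian_Product.norm_nth_le[of "Y t" \<nu>] by (simp add: Y_def)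
    have "norm (Y' t) \<le> (\<Sum>b\<in>UNIV. cmod (\<Sum>d\<in>UNIV. v$d * (\<Sum>\<nu>\<in>UNIV. A \<nu> b d (mk z (S t)) * Yc \<nu> t)))"
      using norm_cart_le_sum[of "Y' t"] by (simp add: Y'_def)
    also have "\<dots> \<le> (\<Sum>b\<in>UNIV. \<Sum>d\<in>UNIV. cmod (v$d) * (\<Sum>\<nu>\<in>UNIV. M \<nu> b d * norm (Y t)))"
    proof (intro sum_mono order_trans[OF norm_sum])
      fix b d
      have "cmod (\<Sum>\<nu>\<in>UNIV. A \<nu> b d (mk z (S t)) * Yc \<nu> t) \<le> (\<Sum>\<nu>\<in>UNIV. M \<nu> b d * norm (Y t))"
        using M[OF t] Yn by (intro order_trans[OF norm_sum] sum_mono) (auto simp: norm_mult intro!: mult_mono order_trans[OF norm_ge_zero M[OF t]])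
      then show "cmod (v$d * (\<Sum>\<nu>\<in>UNIV. A \<nu> b d (mk z (S t)) * Yc \<nu> t)) \<le> cmod (v$d) * (\<Sum>\<nu>\<in>UNIV. M \<nu> b d * norm (Y t))"
        unfolding norm_mult by (rule mult_left_mono) simp
    qed
    also have "\<dots> = (\<Sum>b\<in>UNIV. \<Sum>d\<in>UNIV. cmod (v$d) * (\<Sum>\<nu>\<in>UNIV. M \<nu> b d)) * norm (Y t)"
      by (simp add: sum_distrib_left sum_distrib_right mult_ac)
    finally show ?thesis .
  qed
  have Yz: "Yc b t = 0" if "t \<in> {0..1}" for b t
    using gronwall_zero[OF dY bound Y0 that] by (simp add: Y_def vec_eq_iff)
  have dD: "(D has_vector_derivative 0) (at t)" if t: "t \<in> {0..1}" for t
  proof -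
    have "(D has_vector_derivative (\<Sum>b\<in>UNIV. v$b * pd (Inr b) F (mk z (S t))) - 0
      + (\<Sum>a\<in>UNIV. C a * (\<Sum>b\<in>UNIV. v$b * pd (Inr b) (pd (Inl a) \<Phi>) (mk p (S t))))) (at t)"
      unfolding D_def
      by (intro has_vector_derivative_add has_vector_derivative_diff has_vector_derivative_sum has_vector_derivative_mult_right
          has_vector_derivative_const curve[OF holo_F z t] curve[OF holo_d(1) in_P(2) t])
    also have "(\<Sum>a\<in>UNIV. C a * (\<Sum>b\<in>UNIV. v$b * pd (Inr b) (pd (Inl a) \<Phi>) (mk p (S t))))
      = (\<Sum>b\<in>UNIV. v$b * (\<Sum>a\<in>UNIV. C a * g a b (mk p (S t))))"
      unfolding sum_distrib_left g_def
      by (subst sum.swap) (simp add: mult_ac pd_commute[OF opP holo in_P(1)[OF in_P(2) S[OF t]], of "Inr _" "Inl _"])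
    also have "(\<Sum>b\<in>UNIV. v$b * pd (Inr b) F (mk z (S t))) - 0 + (\<Sum>b\<in>UNIV. v$b * (\<Sum>a\<in>UNIV. C a * g a b (mk p (S t))))
      = (\<Sum>b\<in>UNIV. v$b * Yc b t)" by (simp add: Yc_def distrib_left sum.distrib)
    also have "\<dots> = 0" by (simp add: Yz[OF t])
    finally show ?thesis .
  qed
  have D0: "D 0 = 0" by (simp add: D_def \<open>S 0 = q\<close> F1 d_at_q)
  have "D 1 = 0" by (rule gronwall_zero[OF dD _ D0, where C = 0]) auto
  moreover have "S 1 = s" by (simp add: S_def v_def)
  ultimately have "F (mk z s) = 1 - (\<Sum>a\<in>UNIV. C a * pd (Inl a) \<Phi> (mk p s))" by (simp add: D_def algebra_simps)
  then show ?thesis by (simp add: F_def C_def sum_distrib_left sum_distrib_right mult_ac)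
qed

end

section \<open>Matrices and curvature-like tensors\<close>

lemma matrix_inv_both:
  fixes A :: "complex^'n::finite^'n"
  assumes "det A \<noteq> 0"
  shows "A ** matrix_inv A = mat 1" "matrix_inv A ** A = mat 1"
proof -
  have "invertible A" using assms by (simp add: invertible_det_nz)
  then have "\<exists>B. A ** B = mat 1 \<and> B ** A = mat 1" by (simp add: invertible_def)
  then show "A ** matrix_inv A = mat 1" "matrix_inv A ** A = mat 1"
    unfolding matrix_inv_def by (metis (mono_tags, lifting) someI_ex)+
qed

lemma matrix_inv_sums:
  fixes A :: "complex^'n::finite^'n"
  assumes "det A \<noteq> 0"
  shows "(\<Sum>m\<in>UNIV. matrix_inv A $ \<nu> $ m * A $ m $ b) = (if \<nu> = b then 1 else 0)"
    and "(\<Sum>\<nu>\<in>UNIV. A $ a $ \<nu> * matrix_inv A $ \<nu> $ m) = (if a = m then 1 else 0)"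
  using matrix_inv_both[OF assms] by (auto simp: vec_eq_iff matrix_matrix_mult_def mat_def)

text \<open>Cramer's rule exhibits the entries of the inverse as quotients of determinants, from
  which \<open>holo_on_matrix_inv\<close> reads off their holomorphy.\<close>

lemma matrix_inv_cramer:
  fixes A :: "complex^'n::finite^'n"
  assumes "det A \<noteq> 0"
  shows "matrix_inv A $ \<nu> $ m = det (\<chi> i j. if j = \<nu> then (if i = m then 1 else 0) else A $ i $ j) / det A"
proof -
  have "A *v (\<chi> k. matrix_inv A $ k $ m) = (\<chi> i. if i = m then 1 else 0)"
    using matrix_inv_sums(2)[OF assms] by (simp add: vec_eq_iff matrix_vector_mult_def)
  then have "(\<chi> k. matrix_inv A $ k $ m) = (\<chi> k. det(\<chi> i j. if j=k then (\<chi> i. if i = m then 1 else 0)$i else A$i$j) / det A)"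
    unfolding cramer[OF assms] .
  then show ?thesis by (simp add: vec_eq_iff cong: if_cong)
qed

lemma holo_on_det:
  fixes M :: "complex^'m::finite \<Rightarrow> complex^'n::finite^'n"
  assumes "\<And>i j. holo_on S (\<lambda>Z. M Z $ i $ j)" shows "holo_on S (\<lambda>Z. det (M Z))"
  unfolding det_def by (intro holo_on_sum holo_on_mult holo_on_prod holo_on_const assms)

lemma holo_on_matrix_inv:
  fixes M :: "complex^'m::finite \<Rightarrow> complex^'n::finite^'n"
  assumes S: "open S" and M: "\<And>i j. holo_on S (\<lambda>Z. M Z $ i $ j)" and nz: "\<And>Z. Z \<in> S \<Longrightarrow> det (M Z) \<noteq> 0"
  shows "holo_on S (\<lambda>Z. matrix_inv (M Z) $ \<nu> $ m)"
proof -
  have entry: "holo_on S (\<lambda>Z. (\<chi> i j. if j = \<nu> then (if i = m then 1 else 0) else M Z $ i $ j) $ i $ j)" for i j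
    by (cases "j = \<nu>") (simp_all add: M)
  have "holo_on S (\<lambda>Z. det (\<chi> i j. if j = \<nu> then (if i = m then 1 else 0) else M Z $ i $ j) / det (M Z))"
    by (rule holo_on_divide[OF holo_on_det[OF entry] holo_on_det[OF M] nz])
  then show ?thesis
    by (subst holo_on_cong[OF S matrix_inv_cramer[OF nz]])
qed

text \<open>Polarization with the test vectors e_a and e_a + e_c; entries equal to 2 occur when a =
  c, which explains the bound 3.\<close>

lemma quadratic_zero:
  fixes M :: "'n::finite \<Rightarrow> 'n \<Rightarrow> complex"
  assumes sym: "\<And>a c. M a c = M c a"
    and z: "\<And>\<xi>. (\<And>i. cmod (\<xi> i) < 3) \<Longrightarrow> (\<Sum>a\<in>UNIV. \<Sum>c\<in>UNIV. M a c * \<xi> a * \<xi> c) = 0"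
  shows "M a c = 0"
proof -
  have e: "(\<Sum>i\<in>UNIV. \<Sum>j\<in>UNIV. M i j * (if i = a then 1 else 0) * (if j = c then 1 else 0)) = M a c" for a c
  proof -
    have "(\<Sum>i\<in>UNIV. \<Sum>j\<in>UNIV. M i j * (if i = a then 1 else 0) * (if j = c then 1 else 0)) =
      (\<Sum>i\<in>UNIV. \<Sum>j\<in>UNIV. if j = c then (if i = a then M i j else 0) else 0)"
      by (intro sum.cong) auto
    then show ?thesis by simp
  qed
  have d: "M a a = 0" for a using z[of "\<lambda>i. if i = a then 1 else 0"] by (simp only: e) simp
  have "(\<Sum>i\<in>UNIV. \<Sum>j\<in>UNIV. M i j * ((if i = a then 1 else 0) + (if i = c then 1 else 0)) * ((if j = a then 1 else 0) + (if j = c then 1 else 0))) = 0"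
    by (rule z) auto
  then have "M a a + M a c + M c a + M c c = 0"
    by (simp only: distrib_left distrib_right sum.distrib e) (simp add: algebra_simps)
  then show ?thesis using d sym[of a c] by simp
qed

text \<open>The quartic form is turned into a polynomial in independent \<xi> and \<eta> that
  vanishes on the conjugate diagonal, hence on the polydisc of radius 3;
  \<open>quadratic_zero\<close>, whose bound is 3, then applies in \<xi> and afterwards in
  \<eta>.\<close>

lemma curvature_tensor_zero:
  fixes T :: "'n::finite \<Rightarrow> 'n \<Rightarrow> 'n \<Rightarrow> 'n \<Rightarrow> complex"
  assumes s1: "\<And>a b c d. T a b c d = T c b a d" and s2: "\<And>a b c d. T a b c d = T a d c b"
    and z: "\<And>\<xi>::complex^'n. (\<Sum>a\<in>UNIV. \<Sum>b\<in>UNIV. \<Sum>c\<in>UNIV. \<Sum>d\<in>UNIV. T a b c d * \<xi>$a * cnj (\<xi>$b) * \<xi>$c * cnj (\<xi>$d)) = 0"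
  shows "T a b c d = 0"
proof -
  define f where "f Z = (\<Sum>a\<in>UNIV. \<Sum>b\<in>UNIV. \<Sum>c\<in>UNIV. \<Sum>d\<in>UNIV. T a b c d * Z$Inl a * Z$Inr b * Z$Inl c * Z$Inr d)" for Z :: "complex^('n+'n)"
  have h: "holo_on (polydisc (mk 0 (cnj_vec 0)) 3) f"
    unfolding f_def by (intro holo_on_sum holo_on_mult holo_on_const holo_on_nth)
  have f0: "f (mk \<xi> \<eta>) = 0" if "\<xi> \<in> polydisc 0 3" "\<eta> \<in> polydisc 0 3" for \<xi> \<eta>
  proof (rule conj_diag_identity[OF h])
    show "f (mk z (cnj_vec z)) = 0" for z using z[of z] by (simp add: f_def)
    have "cnj_vec (0::complex^'n) = 0" by (simp add: vec_eq_iff)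
    then show "mk \<xi> \<eta> \<in> polydisc (mk 0 (cnj_vec 0)) 3" using that by (simp add: mk_in_polydisc)
  qed
  have "(\<Sum>b\<in>UNIV. \<Sum>d\<in>UNIV. T a b c d * \<eta> b * \<eta> d) = 0" if \<eta>: "\<And>i. cmod (\<eta> i) < 3" for \<eta> :: "'n \<Rightarrow> complex" and a c
  proof (rule quadratic_zero[where M = "\<lambda>a c. (\<Sum>b\<in>UNIV. \<Sum>d\<in>UNIV. T a b c d * \<eta> b * \<eta> d)"])
    show "(\<Sum>b\<in>UNIV. \<Sum>d\<in>UNIV. T a b c d * \<eta> b * \<eta> d) = (\<Sum>b\<in>UNIV. \<Sum>d\<in>UNIV. T c b a d * \<eta> b * \<eta> d)" for a c
      by (intro sum.cong refl) (simp only: s1[of a])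
    fix \<xi> :: "'n \<Rightarrow> complex" assume \<xi>: "\<And>i. cmod (\<xi> i) < 3"
    have "f (mk (\<chi> i. \<xi> i) (\<chi> i. \<eta> i)) = 0" by (rule f0) (use \<xi> \<eta> in \<open>auto simp: polydisc_def\<close>)
    also have "f (mk (\<chi> i. \<xi> i) (\<chi> i. \<eta> i)) = (\<Sum>a\<in>UNIV. \<Sum>b\<in>UNIV. \<Sum>c\<in>UNIV. \<Sum>d\<in>UNIV. T a b c d * \<xi> a * \<eta> b * \<xi> c * \<eta> d)"
      by (simp add: f_def)
    also have "\<dots> = (\<Sum>a\<in>UNIV. \<Sum>c\<in>UNIV. \<Sum>b\<in>UNIV. \<Sum>d\<in>UNIV. T a b c d * \<xi> a * \<eta> b * \<xi> c * \<eta> d)"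
      by (rule sum.cong[OF refl]) (rule sum.swap)
    also have "\<dots> = (\<Sum>a\<in>UNIV. \<Sum>c\<in>UNIV. (\<Sum>b\<in>UNIV. \<Sum>d\<in>UNIV. T a b c d * \<eta> b * \<eta> d) * \<xi> a * \<xi> c)"
      by (simp add: sum_distrib_left sum_distrib_right mult_ac)
    finally show "(\<Sum>a\<in>UNIV. \<Sum>c\<in>UNIV. (\<Sum>b\<in>UNIV. \<Sum>d\<in>UNIV. T a b c d * \<eta> b * \<eta> d) * \<xi> a * \<xi> c) = 0" .
  qed
  then show ?thesis
    by (intro quadratic_zero[where M = "\<lambda>b d. T a b c d"] s2) auto
qed

section \<open>The polarized Bergman kernel\<close>

definition lpart :: "complex^('n + 'n) \<Rightarrow> complex^'n::finite" where "lpart Z = (\<chi> a. Z$Inl a)"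
definition rpart :: "complex^('n + 'n) \<Rightarrow> complex^'n::finite" where "rpart Z = (\<chi> b. Z$Inr b)"

lemma lpart_mk [simp]: "lpart (mk z s) = z" and rpart_mk [simp]: "rpart (mk z s) = s"
  by (simp_all add: lpart_def rpart_def vec_eq_iff)

lemma mk_lp_rp [simp]: "mk (lpart Z) (rpart Z) = Z"
  by (simp add: lpart_def rpart_def vec_sum_eq_iff)

lemma continuous_lp: "continuous_on S lpart" and continuous_rp: "continuous_on S rpart"
  unfolding lpart_def[abs_def] rpart_def[abs_def] by (intro continuous_intros)+

lemma continuous_cnj_vec: "continuous_on S cnj_vec"
  unfolding cnj_vec_def[abs_def] by (intro continuous_intros)

locale bergman =
  fixes \<Omega> :: "(complex^'n::finite) set" and K :: "complex^'n \<Rightarrow> complex^'n \<Rightarrow> complex"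
  assumes domain: "bounded_domain \<Omega>" and kernel: "is_bergman_kernel \<Omega> K"
begin

section \<open>Symmetry, positivity and bounds from the reproducing property\<close>

lemma open_domain: "open \<Omega>" and connected_domain: "connected \<Omega>"
  using domain by (auto simp: bounded_domain_def)

lemma K_in: "t \<in> \<Omega> \<Longrightarrow> (\<lambda>z. K z t) \<in> bergman_space \<Omega>"
  using kernel by (simp add: is_bergman_kernel_def)

lemma K_holo: "t \<in> \<Omega> \<Longrightarrow> holo_on \<Omega> (\<lambda>z. K z t)"
  using K_in by (simp add: bergman_space_def)

lemma K_int: "t \<in> \<Omega> \<Longrightarrow> set_integrable lborel \<Omega> (\<lambda>z. (cmod (K z t))^2)"
  using K_in by (simp add: bergman_space_def)

lemma reproducing: "f \<in> bergman_space \<Omega> \<Longrightarrow> t \<in> \<Omega> \<Longrightarrow> f t = (LINT z:\<Omega>|lborel. f z * cnj (K z t))"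
  using kernel unfolding is_bergman_kernel_def by blast

text \<open>K(.,z) reproduced at t and K(.,t) reproduced at z give conjugate integrals.\<close>

lemma K_cnj: assumes "z \<in> \<Omega>" "t \<in> \<Omega>" shows "K z t = cnj (K t z)"
proof -
  have "cnj (K t z) = cnj (LINT w:\<Omega>|lborel. K w z * cnj (K w t))"
    using reproducing[OF K_in[OF assms(1)] assms(2)] by simp
  also have "\<dots> = (LINT w:\<Omega>|lborel. cnj (K w z * cnj (K w t)))"
    unfolding set_lebesgue_integral_def by (subst Bochner_Integration.integral_cnj[symmetric]) simp
  also have "\<dots> = K z t" using reproducing[OF K_in[OF assms(2)] assms(1)] by (simp add: mult.commute)
  finally show ?thesis by simp
qed

lemma K_diag: assumes "t \<in> \<Omega>" shows "K t t = of_real (LINT z:\<Omega>|lborel. (cmod (K z t))^2)"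
  using reproducing[OF K_in[OF assms] assms] by (simp flip: complex_norm_square set_integral_complex_of_real of_real_power)

text \<open>K(t,t) is the squared norm of K(.,t). It is nonzero because a bounded domain has the
  constant 1 in its Bergman space, and reproducing 1 at t forces K(.,t) to be nonzero.\<close>

lemma K_pos: assumes t: "t \<in> \<Omega>" shows "K t t = of_real (Re (K t t))" "Re (K t t) > 0"
proof -
  show 1: "K t t = of_real (Re (K t t))" using K_diag[OF t] by simp
  have R: "Re (K t t) = (LINT z:\<Omega>|lborel. (cmod (K z t))^2)" using K_diag[OF t] by simp
  then have ge: "Re (K t t) \<ge> 0" by (simp add: set_lebesgue_integral_def)
  have [measurable]: "\<Omega> \<in> sets lborel" using open_domain by simp
  have "Re (K t t) \<noteq> 0"
  proof
    assume "Re (K t t) = 0"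
    then have "AE z in lborel. indicator \<Omega> z *\<^sub>R (cmod (K z t))^2 = 0"
      using R integral_nonneg_eq_0_iff_AE[OF K_int[OF t, unfolded set_integrable_def]] by (simp add: set_lebesgue_integral_def)
    then have ae: "AE z in lborel. indicator \<Omega> z *\<^sub>R (1 * cnj (K z t)) = 0"
      by eventually_elim (auto simp: indicator_def)
    have finite_measure_bound: "emeasure lborel \<Omega> < \<infinity>"
      by (rule emeasure_bounded_finite) (use domain in \<open>simp add: bounded_domain_def\<close>)
    have "(\<lambda>_. 1) \<in> bergman_space \<Omega>"
      using finite_measure_bound open_domain by (auto simp: bergman_space_def set_integrable_def intro!: integrable_real_indicator)
    then have "(1::complex) = (LINT z:\<Omega>|lborel. 1 * cnj (K z t))" by (rule reproducing) (rule t)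
    also have "\<dots> = 0" unfolding set_lebesgue_integral_def by (rule integral_eq_zero_AE[OF ae])
    finally show False by simp
  qed
  with ge show "Re (K t t) > 0" by simp
qed

lemma K_CS: assumes z: "z \<in> \<Omega>" and t: "t \<in> \<Omega>" shows "(cmod (K z t))^2 \<le> Re (K z z) * Re (K t t)"
proof -
  note pz = K_pos(2)[OF z] and pt = K_pos(2)[OF t]
  \<comment> \<open>The weight that balances |a b| \<le> (l/2) |a|^2 + |b|^2 / (2 l) after
    integration: both terms then contribute equally.\<close>
  define l where "l = sqrt (Re (K z z) / Re (K t t))"
  have lpos: "l > 0" using pz pt by (simp add: l_def)
  have l2: "l\<^sup>2 = Re (K z z) / Re (K t t)" using pz pt by (simp add: l_def)
  have R: "Re (K t t) = (LINT w:\<Omega>|lborel. (cmod (K w t))^2)" if "t \<in> \<Omega>" for t using K_diag[OF that] by simp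
  let ?f = "\<lambda>w. l / 2 * (cmod (K w t))^2 + 1 / (2 * l) * (cmod (K w z))^2"
  have int: "set_integrable lborel \<Omega> ?f"
    by (intro set_integral_add(1) set_integrable_mult_right K_int z t)
  have "cmod (K z t) = cmod (LINT w:\<Omega>|lborel. K w t * cnj (K w z))"
    using reproducing[OF K_in[OF t] z] by simp
  also have "\<dots> \<le> (LINT w|lborel. cmod (indicator \<Omega> w *\<^sub>R (K w t * cnj (K w z))))"
    unfolding set_lebesgue_integral_def by (rule integral_norm_bound)
  also have "\<dots> \<le> (LINT w|lborel. indicator \<Omega> w *\<^sub>R ?f w)"
  proof (rule integral_mono'[OF int[unfolded set_integrable_def]])
    fix w
    have "0 \<le> (l * cmod (K w t) - cmod (K w z))^2 / (2 * l)" using lpos by simp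
    also have "\<dots> = ?f w - cmod (K w t) * cmod (K w z)" using lpos by (simp add: power2_eq_square field_simps)
    finally show "cmod (indicator \<Omega> w *\<^sub>R (K w t * cnj (K w z))) \<le> indicator \<Omega> w *\<^sub>R ?f w"
      by (simp add: norm_mult indicator_def)
    show "0 \<le> indicator \<Omega> w *\<^sub>R ?f w" using lpos by simp
  qed
  also have "\<dots> = (LINT w:\<Omega>|lborel. ?f w)" by (simp add: set_lebesgue_integral_def)
  also have "\<dots> = l / 2 * Re (K t t) + 1 / (2 * l) * Re (K z z)"
    by (subst set_integral_add(2)) (auto intro!: set_integrable_mult_right K_int z t simp: R[OF z] R[OF t])
  also have "\<dots> = l * Re (K t t)"
  proof -
    have "Re (K z z) = l\<^sup>2 * Re (K t t)" using l2 pt by simp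
    then show ?thesis using lpos by (simp add: power2_eq_square field_simps)
  qed
  finally have "(cmod (K z t))^2 \<le> (l * Re (K t t))^2" by (intro power_mono) auto
  also have "\<dots> = Re (K z z) * Re (K t t)" 
    using pt by (simp only: power_mult_distrib l2) (simp add: power2_eq_square)
  finally show ?thesis .
qed

text \<open>The point bound for f = K(.,t) reads K(t,t)^2 \<le> K(t,t) / V with V the volume of the
  ball.\<close>

lemma K_diag_bound:
  assumes r: "r > 0" and sub: "cball t r \<subseteq> \<Omega>"
  shows "Re (K t t) \<le> 1 / measure lborel (ball (0::complex^'n) r)"
proof -
  have t: "t \<in> \<Omega>" using sub r by auto
  have V: "measure lborel (ball (0::complex^'n) r) > 0" using content_ball_pos[OF r] .
  have "(cmod (K t t))^2 \<le> (LINT z:\<Omega>|lborel. (cmod (K z t))^2) / measure lborel (ball (0::complex^'n) r)"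
    by (rule bergman_point_bound[OF open_domain K_in[OF t] sub r])
  also have "(LINT z:\<Omega>|lborel. (cmod (K z t))^2) = Re (K t t)" using K_diag[OF t] by simp
  also have "cmod (K t t) = Re (K t t)" using K_pos[OF t] by (metis abs_of_pos norm_of_real)
  finally have "Re (K t t) * Re (K t t) \<le> 1 / measure lborel (ball (0::complex^'n) r) * Re (K t t)" by (simp add: power2_eq_square)
  then show ?thesis using K_pos(2)[OF t] by (simp only: mult_le_cancel_right_pos)
qed

text \<open>\<open>H\<close> is the kernel with its second argument conjugated, hence holomorphic in both.\<close>
definition H where "H Z = K (lpart Z) (cnj_vec (rpart Z))"
definition D where "D = {Z. lpart Z \<in> \<Omega> \<and> cnj_vec (rpart Z) \<in> \<Omega>}"

lemma H_mk [simp]: "H (mk z s) = K z (cnj_vec s)" and D_mk [simp]: "mk z s \<in> D \<longleftrightarrow> z \<in> \<Omega> \<and> cnj_vec s \<in> \<Omega>"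
  by (simp_all add: H_def D_def)

lemma open_D: "open D"
proof -
  have "D = lpart -` \<Omega> \<inter> (\<lambda>Z. cnj_vec (rpart Z)) -` \<Omega>" by (auto simp: D_def)
  moreover have "continuous_on UNIV (\<lambda>Z. cnj_vec (rpart Z))"
    by (rule continuous_on_compose2[OF continuous_cnj_vec continuous_rp]) auto
  ultimately show ?thesis using open_domain by (auto intro!: open_vimage continuous_lp)
qed

text \<open>Cauchy-Schwarz reduces the bound to the diagonal, where \<open>K_diag_bound\<close>
  works as long as balls of a fixed radius stay inside \<Omega>.\<close>

lemma locally_bounded_H: "locally_bounded H D"
  unfolding locally_bounded_def
proof
  fix Z assume Z: "Z \<in> D"
  obtain z s where zs: "Z = mk z s" using mk_exhaust by blast
  with Z have "z \<in> \<Omega>" "cnj_vec s \<in> \<Omega>" by auto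
  then obtain e1 e2 where e: "e1 > 0" "cball z e1 \<subseteq> \<Omega>" "e2 > 0" "cball (cnj_vec s) e2 \<subseteq> \<Omega>"
    using open_domain open_contains_cball by metis
  \<comment> \<open>Half the room, so that a closed ball of radius r about a point within r of the
    centre still lies in \<Omega>.\<close>
  define r where "r = min e1 e2 / 2"
  have r: "r > 0" using e by (simp add: r_def)
  define V where "V = measure lborel (ball (0::complex^'n) r)"
  have bd: "Re (K x x) \<le> 1 / V" "x \<in> \<Omega>" if "x \<in> ball z r \<or> x \<in> ball (cnj_vec s) r" for x
  proof -
    have "cball x r \<subseteq> cball z e1 \<or> cball x r \<subseteq> cball (cnj_vec s) e2"
      using that by (auto simp: subset_iff r_def field_simps min_def split: if_splits) (metric, metric, metric, metric)?
    then have "cball x r \<subseteq> \<Omega>" using e by blast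
    then show "Re (K x x) \<le> 1 / V" "x \<in> \<Omega>" using K_diag_bound[OF r] r by (auto simp: V_def)
  qed
  have "open (lpart -` ball z r \<inter> (\<lambda>Z. cnj_vec (rpart Z)) -` ball (cnj_vec s) r)"
    by (intro open_Int open_vimage continuous_lp open_ball continuous_on_compose2[OF continuous_cnj_vec continuous_rp]) auto
  moreover have "Z \<in> lpart -` ball z r \<inter> (\<lambda>Z. cnj_vec (rpart Z)) -` ball (cnj_vec s) r" using r by (simp add: zs)
  ultimately obtain \<rho> where \<rho>: "\<rho> > 0" "polydisc Z \<rho> \<subseteq> lpart -` ball z r \<inter> (\<lambda>Z. cnj_vec (rpart Z)) -` ball (cnj_vec s) r"
    using polydisc_subset_open by metis
  have V: "V > 0" using content_ball_pos[OF r] by (simp add: V_def)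
  have "W \<in> D \<and> cmod (H W) \<le> 1 / V" if "W \<in> polydisc Z \<rho>" for W
  proof -
    have W: "lpart W \<in> ball z r" "cnj_vec (rpart W) \<in> ball (cnj_vec s) r" using \<rho>(2) that by auto
    note b = bd[of "lpart W"] bd[of "cnj_vec (rpart W)"]
    have "(cmod (H W))^2 \<le> Re (K (lpart W) (lpart W)) * Re (K (cnj_vec (rpart W)) (cnj_vec (rpart W)))"
      unfolding H_def using b W by (intro K_CS) auto
    also have "\<dots> \<le> 1 / V * (1 / V)"
      using b W V K_pos(2)[of "cnj_vec (rpart W)"] by (intro mult_mono) auto
    also have "\<dots> = (1 / V)^2" by (simp add: power2_eq_square)
    finally have "cmod (H W) \<le> 1 / V" using V by (simp only: abs_le_square_iff[symmetric] power2_abs) (auto intro: power2_le_imp_le)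
    then show ?thesis using b W by (auto simp: D_def)
  qed
  then show "\<exists>r>0. \<exists>M. polydisc Z r \<subseteq> D \<and> (\<forall>W\<in>polydisc Z r. cmod (H W) \<le> M)" using \<rho>(1) by blast
qed

lemma continuous_axis_cnj: "continuous_on UNIV (\<lambda>\<zeta>. w + axis b (cnj \<zeta>) :: complex^'n)"
  by (intro continuous_intros bounded_linear.continuous_on[OF bounded_linear_axis])

text \<open>In the second group, s -> K(z, cnj s) is by Hermitian symmetry the conjugate of K(.,z)
  at the conjugate point, hence holomorphic.\<close>

lemma separately_holo_H: "separately_holo H D"
  unfolding separately_holo_def
proof (intro ballI allI)
  fix Z i assume Z: "Z \<in> D"
  obtain z s where zs: "Z = mk z s" using mk_exhaust by blast
  with Z have in\<Omega>: "z \<in> \<Omega>" "cnj_vec s \<in> \<Omega>" by auto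
  show "(\<lambda>\<zeta>. H (Z + axis i \<zeta>)) field_differentiable at 0"
  proof (cases i)
    case (Inl a)
    show ?thesis using holo_slice[OF K_holo[OF in\<Omega>(2)] in\<Omega>(1), of a]
      by (auto simp: zs Inl mk_axis field_differentiable_def)
  next
    case (Inr b)
    have "((\<lambda>\<zeta>. K (cnj_vec s + axis b \<zeta>) z) has_field_derivative pd b (\<lambda>t. K t z) (cnj_vec s)) (at 0)"
      by (rule holo_slice[OF K_holo[OF in\<Omega>(1)] in\<Omega>(2)])
    then have "(cnj \<circ> (\<lambda>\<zeta>. K (cnj_vec s + axis b \<zeta>) z) \<circ> cnj has_field_derivative cnj (pd b (\<lambda>t. K t z) (cnj_vec s))) (at 0)"
      using has_field_derivative_cnj_cnj[of "\<lambda>\<zeta>. K (cnj_vec s + axis b \<zeta>) z" _ 0] by simp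
    moreover have "open {\<zeta>. cnj_vec s + axis b (cnj \<zeta>) \<in> \<Omega>}"
      using open_vimage[OF open_domain continuous_axis_cnj] by (simp add: vimage_def)
    ultimately have "((\<lambda>\<zeta>. K z (cnj_vec s + axis b (cnj \<zeta>))) has_field_derivative cnj (pd b (\<lambda>t. K t z) (cnj_vec s))) (at 0)"
      by (rule has_field_derivative_transform_within_open) (use in\<Omega> K_cnj[OF in\<Omega>(1), symmetric] in auto)
    then show ?thesis by (auto simp: zs Inr mk_axis field_differentiable_def cnj_vec_axis)
  qed
qed

lemma holo_H: "holo_on D H"
  by (rule separately_holo_imp_holo_on[OF separately_holo_H locally_bounded_H])

end

section \<open>The curvature equation near a point\<close>

text \<open>The antiholomorphic involution whose fixed points form the conjugate diagonal; Hermitian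
  symmetry of K becomes \<open>H W = cnj (H (swap_cnj W))\<close>.\<close>

definition swap_cnj :: "complex^('n + 'n) \<Rightarrow> complex^('n::finite + 'n)" where
  "swap_cnj W = mk (cnj_vec (rpart W)) (cnj_vec (lpart W))"

lemma sg_mk [simp]: "swap_cnj (mk z s) = mk (cnj_vec s) (cnj_vec z)"
  by (simp add: swap_cnj_def)

lemma sg_in_polydisc: "swap_cnj W \<in> polydisc (mk p (cnj_vec p)) r \<longleftrightarrow> W \<in> polydisc (mk p (cnj_vec p)) r"
proof -
  obtain z s where "W = mk z s" using mk_exhaust by blast
  then show ?thesis using cnj_vec_in_polydisc[of s "cnj_vec p" r] cnj_vec_in_polydisc[of z p r] by (auto simp: mk_in_polydisc)
qed

lemma pd_sg:
  assumes U: "open U" "W \<in> U" and h: "holo_on S h" "swap_cnj W \<in> S" and eq: "\<And>W. W \<in> U \<Longrightarrow> f W = cnj (h (swap_cnj W))"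
  shows "pd (Inl a) f W = cnj (pd (Inr a) h (swap_cnj W))" "pd (Inr a) f W = cnj (pd (Inl a) h (swap_cnj W))"
proof -
  obtain z s where W: "W = mk z s" using mk_exhaust by blast
  have "swap_cnj (mk z s + axis (Inl a) \<zeta>) = swap_cnj (mk z s) + axis (Inr a) (cnj \<zeta>)"
    "swap_cnj (mk z s + axis (Inr a) \<zeta>) = swap_cnj (mk z s) + axis (Inl a) (cnj \<zeta>)" for \<zeta>
    by (simp_all add: mk_axis cnj_vec_axis)
  then have e: "(\<lambda>\<zeta>. cnj (h (swap_cnj (mk z s + axis (Inl a) \<zeta>)))) = cnj \<circ> (\<lambda>\<zeta>. h (swap_cnj (mk z s) + axis (Inr a) \<zeta>)) \<circ> cnj"
    "(\<lambda>\<zeta>. cnj (h (swap_cnj (mk z s + axis (Inr a) \<zeta>)))) = cnj \<circ> (\<lambda>\<zeta>. h (swap_cnj (mk z s) + axis (Inl a) \<zeta>)) \<circ> cnj"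
    by (auto simp: fun_eq_iff)
  have d: "((\<lambda>\<zeta>. h (swap_cnj (mk z s) + axis i \<zeta>)) has_field_derivative pd i h (swap_cnj (mk z s))) (at (cnj 0))" for i
    using holo_slice[OF h] by (simp add: W)
  have "pd (Inl a) (\<lambda>W. cnj (h (swap_cnj W))) W = cnj (pd (Inr a) h (swap_cnj W))" "pd (Inr a) (\<lambda>W. cnj (h (swap_cnj W))) W = cnj (pd (Inl a) h (swap_cnj W))"
    unfolding W by (rule pd_eqI; unfold e; rule has_field_derivative_cnj_cnj[OF d])+
  then show "pd (Inl a) f W = cnj (pd (Inr a) h (swap_cnj W))" "pd (Inr a) f W = cnj (pd (Inl a) h (swap_cnj W))"
    using pd_cong[OF U eq] by auto
qed

lemma holo_on_lp:
  assumes "open S" "holo_on S h" "\<And>Z. Z \<in> T \<Longrightarrow> mk (lpart Z) w \<in> S" shows "holo_on T (\<lambda>Z. h (mk (lpart Z) w))"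
  unfolding holo_on_def
proof
  fix Z assume "Z \<in> T"
  have "linear (\<lambda>Z. mk (lpart Z) 0)" by (auto simp: linear_iff vec_sum_eq_iff lpart_def)
  then have b: "bounded_linear (\<lambda>Z. mk (lpart Z) 0)" by (simp add: linear_conv_bounded_linear)
  have eq: "(\<lambda>Z. mk (lpart Z) w) = (\<lambda>Z. mk 0 w + mk (lpart Z) 0)" by (auto simp: vec_sum_eq_iff fun_eq_iff)
  have "((\<lambda>Z. mk (lpart Z) w) has_derivative (\<lambda>v. mk (lpart v) 0)) (at Z)"
    by (subst eq) (use has_derivative_add[OF has_derivative_const bounded_linear_imp_has_derivative[OF b]] in simp)
  from holo_on_chain[OF assms(1,2) this assms(3)[OF \<open>Z \<in> T\<close>]]
  show "\<exists>L. ((\<lambda>Z. h (mk (lpart Z) w)) has_derivative L) (at Z) \<and> (\<forall>c x. L (c *s x) = c * L x)"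
    by (intro exI conjI) (auto simp: sum_UNIV_sum sum_distrib_left lpart_def algebra_simps)
qed

lemma holo_on_rp:
  assumes "open S" "holo_on S h" "\<And>Z. Z \<in> T \<Longrightarrow> mk w (rpart Z) \<in> S" shows "holo_on T (\<lambda>Z. h (mk w (rpart Z)))"
  unfolding holo_on_def
proof
  fix Z assume "Z \<in> T"
  have "linear (\<lambda>Z. mk 0 (rpart Z))" by (auto simp: linear_iff vec_sum_eq_iff rpart_def)
  then have b: "bounded_linear (\<lambda>Z. mk 0 (rpart Z))" by (simp add: linear_conv_bounded_linear)
  have eq: "(\<lambda>Z. mk w (rpart Z)) = (\<lambda>Z. mk w 0 + mk 0 (rpart Z))" by (auto simp: vec_sum_eq_iff fun_eq_iff)
  have "((\<lambda>Z. mk w (rpart Z)) has_derivative (\<lambda>v. mk 0 (rpart v))) (at Z)"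
    by (subst eq) (use has_derivative_add[OF has_derivative_const bounded_linear_imp_has_derivative[OF b]] in simp)
  from holo_on_chain[OF assms(1,2) this assms(3)[OF \<open>Z \<in> T\<close>]]
  show "\<exists>L. ((\<lambda>Z. h (mk w (rpart Z))) has_derivative L) (at Z) \<and> (\<forall>c x. L (c *s x) = c * L x)"
    by (intro exI conjI) (auto simp: sum_UNIV_sum sum_distrib_left rpart_def algebra_simps)
qed

locale bergman_const = bergman \<Omega> K for \<Omega> :: "(complex^'n::finite) set" and K +
  fixes \<gamma> :: real and p :: "complex^'n"
  assumes \<gamma>: "\<gamma> \<noteq> 0" and const: "\<forall>z\<in>\<Omega>. \<forall>\<xi>::complex^'n. \<xi> \<noteq> 0 \<longrightarrow> hsc K z \<xi> = - complex_of_real (\<gamma>^2)"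
    and p: "p \<in> \<Omega>"
begin

text \<open>\<open>L\<close> is the polarized Kaehler potential, holomorphic where Re H > 0, and
  \<open>g\<close> is the metric continued off the conjugate diagonal.\<close>

definition L where "L Z = Ln (H Z)"
definition g where "g a b = pd (Inl a) (pd (Inr b) L)"
definition G where "G Z = (\<chi> a b. g a b Z)"

lemma ex_r0: "\<exists>r>0. \<forall>Z\<in>polydisc (mk p (cnj_vec p)) r. Z \<in> D \<and> Re (H Z) > 0"
proof -
  have "open (D \<inter> H -` {w. Re w > 0})"
    by (rule continuous_open_preimage[OF holo_on_continuous[OF holo_H] open_D open_halfspace_Re_gt])
  moreover have "mk p (cnj_vec p) \<in> D \<inter> H -` {w. Re w > 0}" using p K_pos by simp
  ultimately obtain r where "r > 0" "polydisc (mk p (cnj_vec p)) r \<subseteq> D \<inter> H -` {w. Re w > 0}" by (rule polydisc_subset_open)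
  then show ?thesis by blast
qed

text \<open>Since \<open>x / 0 = 0\<close>, a nonzero value of \<^const>\<open>hsc\<close> forces a nonzero denominator.\<close>
lemma gform_nz: "z \<in> \<Omega> \<Longrightarrow> \<xi> \<noteq> 0 \<Longrightarrow> (\<Sum>a\<in>UNIV. \<Sum>b\<in>UNIV. bmetric K a b z * \<xi>$a * cnj (\<xi>$b)) \<noteq> 0"
  using const \<gamma> unfolding hsc_def by fastforce

lemma holo_L: assumes "\<forall>Z\<in>polydisc (mk p (cnj_vec p)) r. Z \<in> D \<and> Re (H Z) > 0" shows "holo_on (polydisc (mk p (cnj_vec p)) r) L"
  unfolding L_def
  by (rule holo_on_Ln[OF holo_on_subset[OF holo_H]]) (use assms in \<open>auto simp: complex_nonpos_Reals_iff\<close>)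

lemma diag:
  assumes h: "holo_on (polydisc (mk p (cnj_vec p)) r) h" and z: "z \<in> polydisc p r" and eq: "\<And>w. w \<in> polydisc p r \<Longrightarrow> f w = h (mk w (cnj_vec w))"
  shows "wz a f z = pd (Inl a) h (mk z (cnj_vec z))" "wzb a f z = pd (Inr a) h (mk z (cnj_vec z))"
proof -
  have i: "mk z (cnj_vec z) \<in> polydisc (mk p (cnj_vec p)) r" using z by (simp add: mk_in_polydisc cnj_vec_in_polydisc)
  show "wz a f z = pd (Inl a) h (mk z (cnj_vec z))" "wzb a f z = pd (Inr a) h (mk z (cnj_vec z))"
    using wirtinger_diag[OF open_polydisc h open_polydisc z i eq] by auto
qed

lemma bmetric_eq:
  assumes r: "\<forall>Z\<in>polydisc (mk p (cnj_vec p)) r. Z \<in> D \<and> Re (H Z) > 0" and z: "z \<in> polydisc p r"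
  shows "bmetric K a b z = g a b (mk z (cnj_vec z))"
  unfolding bmetric_def g_def
proof (rule diag(1)[OF holo_on_pd[OF open_polydisc holo_L[OF r]] z])
  show "wzb b (\<lambda>u. Ln (K u u)) w = pd (Inr b) L (mk w (cnj_vec w))" if "w \<in> polydisc p r" for w
    by (rule diag(2)[OF holo_L[OF r] that]) (simp add: L_def)
qed

text \<open>A vector in the kernel of the metric matrix would, conjugated, annihilate the metric
  form, which \<open>gform_nz\<close> excludes.\<close>

lemma det_G: 
  assumes r: "\<forall>Z\<in>polydisc (mk p (cnj_vec p)) r. Z \<in> D \<and> Re (H Z) > 0" and z: "z \<in> polydisc p r"
  shows "det (G (mk z (cnj_vec z))) \<noteq> 0"
proof -
  have "mk z (cnj_vec z) \<in> polydisc (mk p (cnj_vec p)) r" using z by (simp add: mk_in_polydisc cnj_vec_in_polydisc)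
  then have i: "mk z (cnj_vec z) \<in> D" using r by blast
  have "x = 0" if x: "G (mk z (cnj_vec z)) *v x = 0" for x
  proof (rule ccontr)
    assume "x \<noteq> 0"
    then have nz: "cnj_vec x \<noteq> 0" by (auto simp: vec_eq_iff)
    have "(\<Sum>b\<in>UNIV. g a b (mk z (cnj_vec z)) * x$b) = 0" for a
      using x by (simp add: vec_eq_iff matrix_vector_mult_def G_def)
    then have "(\<Sum>a\<in>UNIV. \<Sum>b\<in>UNIV. bmetric K a b z * cnj_vec x$a * cnj (cnj_vec x$b)) = 0"
      by (simp add: bmetric_eq[OF r z] mult.assoc mult.left_commute[of _ "cnj _"] sum_distrib_left[symmetric])
    then show False using gform_nz[OF _ nz] i by simp
  qed
  then have "\<exists>B. B ** G (mk z (cnj_vec z)) = mat 1" by (simp add: matrix_left_invertible_ker)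
  then show ?thesis by (simp add: invertible_left_inverse flip: invertible_det_nz)
qed

lemma ex_r: "\<exists>r>0. \<forall>Z\<in>polydisc (mk p (cnj_vec p)) r. Z \<in> D \<and> Re (H Z) > 0 \<and> det (G Z) \<noteq> 0"
proof -
  obtain r where r: "r > 0" and R: "\<forall>Z\<in>polydisc (mk p (cnj_vec p)) r. Z \<in> D \<and> Re (H Z) > 0" using ex_r0 by blast
  let ?P = "polydisc (mk p (cnj_vec p)) r"
  have "holo_on ?P (\<lambda>Z. det (G Z))"
    by (rule holo_on_det) (simp add: G_def g_def holo_on_pd open_polydisc holo_L[OF R])
  then have "open (?P \<inter> (\<lambda>Z. det (G Z)) -` (- {0}))"
    by (intro continuous_open_preimage holo_on_continuous open_polydisc) auto
  moreover have "mk p (cnj_vec p) \<in> ?P \<inter> (\<lambda>Z. det (G Z)) -` (- {0})" using r det_G[OF R, of p] by simp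
  ultimately obtain r' where "r' > 0" "polydisc (mk p (cnj_vec p)) r' \<subseteq> ?P \<inter> (\<lambda>Z. det (G Z)) -` (- {0})"
    by (rule polydisc_subset_open)
  then show ?thesis using R by blast
qed

definition r where "r = (SOME r. r > 0 \<and> (\<forall>Z\<in>polydisc (mk p (cnj_vec p)) r. Z \<in> D \<and> Re (H Z) > 0 \<and> det (G Z) \<noteq> 0))"

abbreviation P where "P \<equiv> polydisc (mk p (cnj_vec p)) r"

lemma radius: "r > 0" "\<forall>Z\<in>P. Z \<in> D \<and> Re (H Z) > 0" "\<And>Z. Z \<in> P \<Longrightarrow> det (G Z) \<noteq> 0"
  using someI_ex[OF ex_r, folded r_def] by auto

lemma opP: "open P" by (rule open_polydisc)

lemma diag_in: "mk z (cnj_vec z) \<in> P \<longleftrightarrow> z \<in> polydisc p r"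
  by (simp add: mk_in_polydisc cnj_vec_in_polydisc)

lemmas hL = holo_L[OF radius(2)]

lemma hdL: "holo_on P (pd i L)" "holo_on P (pd j (pd i L))" "holo_on P (pd k (pd j (pd i L)))" "holo_on P (pd l (pd k (pd j (pd i L))))"
  by (intro holo_on_pd opP hL)+

definition gi where "gi \<nu> m Z = matrix_inv (G Z) $ \<nu> $ m"

lemma holo_gi: "holo_on P (gi \<nu> m)"
  unfolding gi_def[abs_def] by (rule holo_on_matrix_inv[OF opP _ radius(3)]) (simp add: G_def g_def hdL)

lemma gi_inv:
  assumes "Z \<in> P"
  shows "(\<Sum>m\<in>UNIV. gi \<nu> m Z * g m b Z) = (if \<nu> = b then 1 else 0)" "(\<Sum>\<nu>\<in>UNIV. g a \<nu> Z * gi \<nu> m Z) = (if a = m then 1 else 0)"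
  using matrix_inv_sums[OF radius(3)[OF assms]] unfolding gi_def by (simp_all add: G_def)

lemma binv_eq: "z \<in> polydisc p r \<Longrightarrow> binv K z $ \<nu> $ m = gi \<nu> m (mk z (cnj_vec z))"
  by (simp add: binv_def bmatrix_def gi_def G_def bmetric_eq[OF radius(2)])

text \<open>The two products of the metric in the curvature tensor each contribute the square of the
  metric form in the direction \<xi>; each therefore carries half of
  \<open>\<gamma>^2\<close>.\<close>

definition \<kappa> where "\<kappa> = \<gamma>^2 / 2"

text \<open>The polarized curvature tensor with the opposite sign.\<close>

definition pdeL where "pdeL a b c d Z = pd (Inl c) (pd (Inr d) (g a b)) Z
   - (\<Sum>m\<in>UNIV. \<Sum>\<nu>\<in>UNIV. gi \<nu> m Z * pd (Inl c) (g a \<nu>) Z * pd (Inr d) (g m b) Z)"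

lemma bcurv_eq:
  assumes z: "z \<in> polydisc p r"
  shows "bcurv K a b c d z = - pdeL a b c d (mk z (cnj_vec z))"
proof -
  have d: "wz c (bmetric K a b) z = pd (Inl c) (g a b) (mk z (cnj_vec z))" "wzb c (bmetric K a b) z = pd (Inr c) (g a b) (mk z (cnj_vec z))"
    if "z \<in> polydisc p r" for a b c z
    by (rule diag[OF _ that], simp add: g_def hdL, rule bmetric_eq[OF radius(2)], assumption)+
  have "wz c (wzb d (bmetric K a b)) z = pd (Inl c) (pd (Inr d) (g a b)) (mk z (cnj_vec z))"
    by (rule diag(1)[OF _ z]) (simp_all add: g_def hdL d)
  then show ?thesis by (simp add: bcurv_def pdeL_def d[OF z] binv_eq[OF z])
qed

lemma pd_commute2:
  assumes Z: "Z \<in> P" shows "pd k (pd j (pd i L)) Z = pd k (pd i (pd j L)) Z"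
  by (rule pd_cong[OF opP Z]) (rule pd_commute[OF opP hL])

text \<open>The Kaehler symmetries: the metric consists of second derivatives of the one potential
  \<open>L\<close>, and partial derivatives commute.\<close>

lemma pdeL_sym:
  assumes Z: "Z \<in> P"
  shows "pdeL a b c d Z = pdeL c b a d Z" "pdeL a b c d Z = pdeL a d c b Z"
proof -
  have g1: "pd (Inl c) (g a b) W = pd (Inl a) (g c b) W" if "W \<in> P" for a b c W
    unfolding g_def by (rule pd_commute[OF opP hdL(1) that])
  have g2: "pd (Inr d) (g a b) W = pd (Inr b) (g a d) W" if "W \<in> P" for a b d W
  proof -
    have "pd (Inr d) (pd (Inl a) (pd (Inr b) L)) W = pd (Inl a) (pd (Inr d) (pd (Inr b) L)) W" by (rule pd_commute[OF opP hdL(1) that])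
    also have "\<dots> = pd (Inl a) (pd (Inr b) (pd (Inr d) L)) W" by (rule pd_commute2[OF that])
    also have "\<dots> = pd (Inr b) (pd (Inl a) (pd (Inr d) L)) W" by (rule pd_commute[OF opP hdL(1) that])
    finally show ?thesis by (simp add: g_def)
  qed
  have hg: "holo_on P (g a b)" for a b by (simp add: g_def hdL)
  have "pd (Inl c) (pd (Inr d) (g a b)) Z = pd (Inr d) (pd (Inl c) (g a b)) Z" by (rule pd_commute[OF opP hg Z])
  also have "\<dots> = pd (Inr d) (pd (Inl a) (g c b)) Z" by (rule pd_cong[OF opP Z]) (rule g1)
  also have "\<dots> = pd (Inl a) (pd (Inr d) (g c b)) Z" by (rule pd_commute[OF opP hg Z])
  finally show "pdeL a b c d Z = pdeL c b a d Z" by (simp add: pdeL_def g1[OF Z, of c a])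
  have "pd (Inl c) (pd (Inr d) (g a b)) Z = pd (Inl c) (pd (Inr b) (g a d)) Z" by (rule pd_cong[OF opP Z]) (rule g2)
  then show "pdeL a b c d Z = pdeL a d c b Z" by (simp add: pdeL_def g2[OF Z, of d _ b])
qed

lemma sum_swap_bd: "(\<Sum>b\<in>B. \<Sum>c\<in>C. \<Sum>d\<in>B. V d c b) = (\<Sum>b\<in>B. \<Sum>c\<in>C. \<Sum>d\<in>B. (V b c d :: complex))"
proof -
  have "(\<Sum>b\<in>B. \<Sum>c\<in>C. \<Sum>d\<in>B. V d c b) = (\<Sum>c\<in>C. \<Sum>b\<in>B. \<Sum>d\<in>B. V d c b)" by (rule sum.swap)
  also have "\<dots> = (\<Sum>c\<in>C. \<Sum>d\<in>B. \<Sum>b\<in>B. V d c b)" by (rule sum.cong[OF refl]) (rule sum.swap)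
  also have "\<dots> = (\<Sum>b\<in>B. \<Sum>c\<in>C. \<Sum>d\<in>B. V b c d)" by (rule sum.swap)
  finally show ?thesis .
qed

text \<open>The defect \<open>T\<close> has the Kaehler symmetries, and the constant value of
  \<open>hsc\<close> says that its quartic form vanishes; such a tensor is zero by
  \<open>curvature_tensor_zero\<close>.\<close>

lemma pde_diag:
  assumes z: "z \<in> polydisc p r"
  defines "Z \<equiv> mk z (cnj_vec z)"
  shows "pdeL a b c d Z = \<kappa> * (g a b Z * g c d Z + g a d Z * g c b Z)"
proof -
  have ZP: "Z \<in> P" using z by (simp add: Z_def diag_in)
  have z\<Omega>: "z \<in> \<Omega>" using radius(2) ZP by (auto simp: Z_def)
  define T where "T a b c d = \<kappa> * (g a b Z * g c d Z + g a d Z * g c b Z) - pdeL a b c d Z" for a b c d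
  have "T a b c d = 0"
  proof (rule curvature_tensor_zero)
    show "T a b c d = T c b a d" for a b c d using pdeL_sym(1)[OF ZP, of a b c d] by (simp add: T_def algebra_simps)
    show "T a b c d = T a d c b" for a b c d using pdeL_sym(2)[OF ZP, of a b c d] by (simp add: T_def algebra_simps)
    fix \<xi> :: "complex^'n"
    let ?S = "\<lambda>F. \<Sum>a\<in>UNIV. \<Sum>b\<in>UNIV. \<Sum>c\<in>UNIV. \<Sum>d\<in>UNIV. (F a b c d :: complex) * \<xi>$a * cnj (\<xi>$b) * \<xi>$c * cnj (\<xi>$d)"
    show "?S T = 0"
    proof (cases "\<xi> = 0")
      case False
      define q where "q = (\<Sum>a\<in>UNIV. \<Sum>b\<in>UNIV. bmetric K a b z * \<xi>$a * cnj (\<xi>$b))"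
      have q: "q \<noteq> 0" using gform_nz[OF z\<Omega> False] by (simp add: q_def)
      have q2: "q = (\<Sum>a\<in>UNIV. \<Sum>b\<in>UNIV. g a b Z * \<xi>$a * cnj (\<xi>$b))"
        unfolding q_def Z_def by (simp add: bmetric_eq[OF radius(2) z])
      have "?S (\<lambda>a b c d. bcurv K a b c d z) / q^2 = - complex_of_real (\<gamma>^2)"
        using const z\<Omega> False by (simp add: hsc_def q_def)
      then have 1: "?S (\<lambda>a b c d. bcurv K a b c d z) = - complex_of_real (\<gamma>^2) * q^2" using q by (simp add: field_simps)
      have 2: "?S (\<lambda>a b c d. g a b Z * g c d Z) = q^2"
      proof -
        have "q^2 = (\<Sum>a\<in>UNIV. \<Sum>b\<in>UNIV. g a b Z * \<xi>$a * cnj (\<xi>$b) * q)"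
          by (simp add: power2_eq_square q2 sum_distrib_right)
        also have "\<dots> = ?S (\<lambda>a b c d. g a b Z * g c d Z)"
          by (subst q2) (simp add: sum_distrib_left mult_ac)
        finally show ?thesis by simp
      qed
      have 3: "?S (\<lambda>a b c d. g a d Z * g c b Z) = ?S (\<lambda>a b c d. g a b Z * g c d Z)"
      proof (rule sum.cong[OF refl])
        fix a
        show "(\<Sum>b\<in>UNIV. \<Sum>c\<in>UNIV. \<Sum>d\<in>UNIV. g a d Z * g c b Z * \<xi>$a * cnj (\<xi>$b) * \<xi>$c * cnj (\<xi>$d)) =
          (\<Sum>b\<in>UNIV. \<Sum>c\<in>UNIV. \<Sum>d\<in>UNIV. g a b Z * g c d Z * \<xi>$a * cnj (\<xi>$b) * \<xi>$c * cnj (\<xi>$d))"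
          using sum_swap_bd[of "\<lambda>b c d. g a b Z * g c d Z * \<xi>$a * cnj (\<xi>$b) * \<xi>$c * cnj (\<xi>$d)" UNIV UNIV]
          by (simp add: mult_ac)
      qed
      have "?S T = ?S (\<lambda>a b c d. \<kappa> * (g a b Z * g c d Z) + \<kappa> * (g a d Z * g c b Z) + bcurv K a b c d z)"
        by (simp add: T_def bcurv_eq[OF z] Z_def distrib_left)
      also have "\<dots> = \<kappa> * ?S (\<lambda>a b c d. g a b Z * g c d Z) + \<kappa> * ?S (\<lambda>a b c d. g a d Z * g c b Z) + ?S (\<lambda>a b c d. bcurv K a b c d z)"
        by (simp add: sum.distrib sum_distrib_left distrib_right mult.assoc)
      also have "\<dots> = 0" unfolding 1 2 3 by (simp add: \<kappa>_def)
      finally show ?thesis .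
    qed simp
  qed
  then show ?thesis by (simp add: T_def)
qed

text \<open>Both sides are holomorphic and agree on the conjugate diagonal.\<close>

lemma pde:
  assumes Z: "Z \<in> P"
  shows "pd (Inl c) (pd (Inr d) (g a b)) Z
     = (\<Sum>m\<in>UNIV. \<Sum>\<nu>\<in>UNIV. gi \<nu> m Z * pd (Inl c) (g a \<nu>) Z * pd (Inr d) (g m b) Z)
       + \<kappa> * (g a b Z * g c d Z + g a d Z * g c b Z)"
proof -
  have hg: "holo_on P (g a b)" for a b by (simp add: g_def hdL)
  have "pdeL a b c d Z - \<kappa> * (g a b Z * g c d Z + g a d Z * g c b Z) = 0"
  proof (rule conj_diag_identity[OF _ _ Z])
    show "holo_on P (\<lambda>Z. pdeL a b c d Z - \<kappa> * (g a b Z * g c d Z + g a d Z * g c b Z))"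
      unfolding pdeL_def by (intro holo_on_diff holo_on_sum holo_on_mult holo_on_add holo_on_const holo_gi hg holo_on_pd opP)
    show "pdeL a b c d (mk z (cnj_vec z)) - \<kappa> * (g a b (mk z (cnj_vec z)) * g c d (mk z (cnj_vec z)) + g a d (mk z (cnj_vec z)) * g c b (mk z (cnj_vec z))) = 0"
      if "z \<in> polydisc p r" for z using pde_diag[OF that] by simp
  qed
  then show ?thesis by (simp add: pdeL_def diff_eq_eq add.commute)
qed

end

section \<open>The diastasis near a point\<close>

context bergman_const
begin

abbreviation q where "q \<equiv> cnj_vec p"

text \<open>The polarized diastasis relative to \<open>p\<close>.\<close>
definition \<Phi> where "\<Phi> Z = L Z - L (mk (lpart Z) q) - L (mk p (rpart Z)) + L (mk p q)"

lemma pP: "p \<in> polydisc p r" "q \<in> polydisc q r"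
  using radius(1) by auto

lemma in_P_parts: "Z \<in> P \<Longrightarrow> mk (lpart Z) q \<in> P" "Z \<in> P \<Longrightarrow> mk p (rpart Z) \<in> P"
  using mk_in_polydisc[of "lpart Z" "rpart Z" p q r] pP by (auto simp: mk_in_polydisc)

lemma hL_parts: "holo_on P (\<lambda>Z. L (mk (lpart Z) q))" "holo_on P (\<lambda>Z. L (mk p (rpart Z)))"
  by (rule holo_on_lp[OF opP hL in_P_parts(1)], assumption) (rule holo_on_rp[OF opP hL in_P_parts(2)], assumption)

lemma h\<Phi>: "holo_on P \<Phi>"
  unfolding \<Phi>_def by (intro holo_on_add holo_on_diff holo_on_const hL hL_parts)

lemma pd_lp_rp: "pd (Inr b) (\<lambda>Z. f (lpart Z)) Z = 0" "pd (Inl b) (\<lambda>Z. f (rpart Z)) Z = 0"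
proof -
  obtain z s where Z: "Z = mk z s" using mk_exhaust by blast
  show "pd (Inr b) (\<lambda>Z. f (lpart Z)) Z = 0" "pd (Inl b) (\<lambda>Z. f (rpart Z)) Z = 0"
    unfolding Z pd_mk by simp_all
qed

lemma pd_rp: "pd (Inr b) (\<lambda>Z. f (mk w (rpart Z))) Z = pd (Inr b) f (mk w (rpart Z))"
proof -
  obtain z s where Z: "Z = mk z s" using mk_exhaust by blast
  show ?thesis unfolding Z by (simp add: pd_mk)
qed

lemma pd_\<Phi>:
  assumes Z: "Z \<in> P"
  shows "pd (Inr b) \<Phi> Z = pd (Inr b) L Z - pd (Inr b) L (mk p (rpart Z))"
proof -
  have "pd (Inr b) \<Phi> Z = pd (Inr b) L Z - pd (Inr b) (\<lambda>Z. L (mk (lpart Z) q)) Z - pd (Inr b) (\<lambda>Z. L (mk p (rpart Z))) Z"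
    unfolding \<Phi>_def
    by (subst pd_add[OF _ _ Z] pd_diff[OF _ _ Z]; (intro holo_on_diff holo_on_const hL hL_parts)?)+ simp
  then show ?thesis using pd_lp_rp(1)[of b "\<lambda>z. L (mk z q)" Z] by (simp add: pd_rp)
qed

lemma g_\<Phi>: assumes Z: "Z \<in> P" shows "pd (Inl a) (pd (Inr b) \<Phi>) Z = g a b Z"
proof -
  have "pd (Inl a) (pd (Inr b) \<Phi>) Z = pd (Inl a) (\<lambda>Z. pd (Inr b) L Z - pd (Inr b) L (mk p (rpart Z))) Z"
    by (rule pd_cong[OF opP Z]) (rule pd_\<Phi>)
  also have "\<dots> = pd (Inl a) (pd (Inr b) L) Z - pd (Inl a) (\<lambda>Z. pd (Inr b) L (mk p (rpart Z))) Z"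
    by (rule pd_diff[OF hdL(1) holo_on_rp[OF opP hdL(1) in_P_parts(2)] Z])
  finally show ?thesis using pd_lp_rp(2)[of a "\<lambda>s. pd (Inr b) L (mk p s)" Z] by (simp add: g_def)
qed

lemma pd_g_\<Phi>:
  assumes Z: "Z \<in> P"
  shows "pd i (pd (Inl a) (pd (Inr b) \<Phi>)) Z = pd i (g a b) Z"
    "pd j (pd i (pd (Inl a) (pd (Inr b) \<Phi>))) Z = pd j (pd i (g a b)) Z"
proof -
  have 1: "pd i (pd (Inl a) (pd (Inr b) \<Phi>)) Z = pd i (g a b) Z" if Z: "Z \<in> P" for Z
    by (rule pd_cong[OF opP Z]) (rule g_\<Phi>)
  show "pd j (pd i (pd (Inl a) (pd (Inr b) \<Phi>))) Z = pd j (pd i (g a b)) Z"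
    by (rule pd_cong[OF opP Z]) (rule 1)
  show "pd i (pd (Inl a) (pd (Inr b) \<Phi>)) Z = pd i (g a b) Z" by (rule 1[OF Z])
qed

sublocale pp: polarized_potential \<Phi> gi p q r "complex_of_real \<kappa>" "\<lambda>a b. pd (Inl a) (pd (Inr b) \<Phi>)"
proof unfold_locales
  show "\<Phi> (mk z q) = 0" for z by (simp add: \<Phi>_def)
  show "\<Phi> (mk p s) = 0" for s by (simp add: \<Phi>_def)
  show "holo_on P (gi \<nu> m)" for \<nu> m by (rule holo_gi)
  show "(\<Sum>m\<in>UNIV. gi \<nu> m Z * pd (Inl m) (pd (Inr b) \<Phi>) Z) = (if \<nu> = b then 1 else 0)" if "Z \<in> P" for Z \<nu> b
    using gi_inv(1)[OF that] by (simp add: g_\<Phi>[OF that])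
  show "(\<Sum>\<nu>\<in>UNIV. pd (Inl a) (pd (Inr \<nu>) \<Phi>) Z * gi \<nu> m Z) = (if a = m then 1 else 0)" if "Z \<in> P" for Z a m
    using gi_inv(2)[OF that] by (simp add: g_\<Phi>[OF that])
  show "pd (Inl c) (pd (Inr d) (pd (Inl a) (pd (Inr b) \<Phi>))) Z
      = (\<Sum>m\<in>UNIV. \<Sum>\<nu>\<in>UNIV. gi \<nu> m Z * pd (Inl c) (pd (Inl a) (pd (Inr \<nu>) \<Phi>)) Z * pd (Inr d) (pd (Inl m) (pd (Inr b) \<Phi>)) Z)
        + complex_of_real \<kappa> * (pd (Inl a) (pd (Inr b) \<Phi>) Z * pd (Inl c) (pd (Inr d) \<Phi>) Z
          + pd (Inl a) (pd (Inr d) \<Phi>) Z * pd (Inl c) (pd (Inr b) \<Phi>) Z)" if "Z \<in> P" for Z a b c d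
    using pde[OF that] by (simp add: pd_g_\<Phi>[OF that] g_\<Phi>[OF that])
qed (use radius(1) h\<Phi> in auto)

text \<open>The representative coordinates with lowered index: w_a is the sum over j of g^(j a) v_j.
  Near p these are the s-derivatives of the polarized diastasis at s = q.\<close>

definition v where "v b z = wzb b (\<lambda>t. K z t) p / K z p - wzb b (\<lambda>t. Ln (K t t)) p"

lemma wzb_K: "z \<in> \<Omega> \<Longrightarrow> wzb b (\<lambda>t. K z t) p = pd (Inr b) H (mk z q)"
  by (rule wirtinger_anti[OF open_D holo_H open_domain p]) (use p in auto)

lemma wzb_L: "wzb b (\<lambda>t. Ln (K t t)) p = pd (Inr b) L (mk p q)"
  by (rule diag(2)[OF hL pP(1)]) (simp add: L_def)

lemma v_eq: "z \<in> \<Omega> \<Longrightarrow> v b z = pd (Inr b) H (mk z q) / K z p - pd (Inr b) L (mk p q)"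
  by (simp add: v_def wzb_K wzb_L)

lemma P_sub: "P \<subseteq> D" and polydisc_sub: "polydisc p r \<subseteq> \<Omega>"
proof -
  show "P \<subseteq> D" using radius(2) by blast
  then show "polydisc p r \<subseteq> \<Omega>" using diag_in by (metis D_mk subset_iff)
qed

lemma H_nz: "Z \<in> P \<Longrightarrow> H Z \<notin> \<real>\<^sub>\<le>\<^sub>0" "Z \<in> P \<Longrightarrow> H Z \<noteq> 0"
  using radius(2) by (auto simp: complex_nonpos_Reals_iff)

lemma v_\<Phi>: assumes z: "z \<in> polydisc p r" shows "pd (Inr b) \<Phi> (mk z q) = v b z"
proof -
  have zP: "mk z q \<in> P" using z pP by (simp add: mk_in_polydisc)
  have "pd (Inr b) L (mk z q) = inverse (H (mk z q)) * pd (Inr b) H (mk z q)"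
    unfolding L_def by (rule pd_comp[OF holo_on_subset[OF holo_H P_sub] zP])
      (use H_nz[OF zP] in \<open>auto intro!: derivative_eq_intros simp: field_simps\<close>)
  then show ?thesis using polydisc_sub z by (auto simp: pd_\<Phi>[OF zP] v_eq field_simps)
qed

lemma H_sg: "W \<in> D \<Longrightarrow> H W = cnj (H (swap_cnj W))"
proof -
  assume W: "W \<in> D"
  obtain z s where "W = mk z s" using mk_exhaust by blast
  then show ?thesis using W K_cnj[of z "cnj_vec s"] by simp
qed

lemma L_sg: "W \<in> P \<Longrightarrow> L W = cnj (L (swap_cnj W))"
  using H_sg[of W] P_sub H_nz(1)[of "swap_cnj W"] unfolding L_def by (auto simp: sg_in_polydisc cnj_Ln)

lemma \<Phi>_sg: assumes W: "W \<in> P" shows "\<Phi> W = cnj (\<Phi> (swap_cnj W))"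
proof -
  obtain z s where "W = mk z s" using mk_exhaust by blast
  then show ?thesis using L_sg[OF W] L_sg[OF in_P_parts(1)[OF W]] L_sg[OF in_P_parts(2)[OF W]] L_sg[of "mk p q"] radius(1)
    by (simp add: \<Phi>_def)
qed

lemma v_cnj: assumes t: "t \<in> polydisc p r" shows "pd (Inl a) \<Phi> (mk p (cnj_vec t)) = cnj (v a t)"
proof -
  have "mk p (cnj_vec t) \<in> P" using t pP by (simp add: mk_in_polydisc cnj_vec_in_polydisc)
  then have "pd (Inl a) \<Phi> (mk p (cnj_vec t)) = cnj (pd (Inr a) \<Phi> (swap_cnj (mk p (cnj_vec t))))"
    by (intro pd_sg(1)[OF opP _ h\<Phi>] \<Phi>_sg) (simp_all add: sg_in_polydisc del: sg_mk)
  then show ?thesis by (simp add: v_\<Phi>[OF t])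
qed

text \<open>The sesquilinear form of the inverse metric at p on covectors, so that \<open>Q\<close>
  is the metric inner product of the representative coordinates.\<close>

definition B where "B x y = (\<Sum>a\<in>UNIV. \<Sum>b\<in>UNIV. gi b a (mk p q) * x b * cnj (y a))"
definition Q where "Q z t = B (\<lambda>b. v b z) (\<lambda>a. v a t)"

lemma local_identity:
  assumes "z \<in> polydisc p r" "t \<in> polydisc p r"
  shows "exp (- complex_of_real \<kappa> * \<Phi> (mk z (cnj_vec t))) = 1 - \<kappa> * Q z t"
  using pp.exp_potential[of z "cnj_vec t"] assms by (simp add: cnj_vec_in_polydisc v_\<Phi> v_cnj Q_def B_def)

lemma centre_P: "mk p q \<in> P"
  using radius(1) by simp

section \<open>Hermitian symmetry and positivity of the form \<open>B\<close>\<close>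

lemma g_cnj: "g a b (mk p q) = cnj (g b a (mk p q))"
proof -
  have 1: "pd (Inr b) L W = cnj (pd (Inl b) L (swap_cnj W))" if "W \<in> P" for W
  proof (rule pd_sg(2)[OF opP that hL])
    show "swap_cnj W \<in> P" using that by (simp only: sg_in_polydisc)
    show "L W = cnj (L (swap_cnj W))" if "W \<in> P" for W by (rule L_sg[OF that])
  qed
  have "g a b (mk p q) = cnj (pd (Inr a) (pd (Inl b) L) (swap_cnj (mk p q)))"
    unfolding g_def by (rule pd_sg(1)[OF opP centre_P hdL(1) _ 1]) (use centre_P in auto)
  then show ?thesis using pd_commute[OF opP hL centre_P, of "Inr a" "Inl b"] by (simp add: g_def)
qed

text \<open>The inverse of a Hermitian matrix is Hermitian, since its conjugate transpose is an
  inverse as well.\<close>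

lemma gi_cnj: "gi \<nu> m (mk p q) = cnj (gi m \<nu> (mk p q))"
proof -
  let ?g = "\<lambda>a b. g a b (mk p q)" and ?i = "\<lambda>a b. gi a b (mk p q)"
  have 1: "(\<Sum>k\<in>UNIV. ?g a k * cnj (?i m k)) = (if m = a then 1 else 0)" for a
  proof -
    have "(\<Sum>k\<in>UNIV. ?g a k * cnj (?i m k)) = cnj (\<Sum>k\<in>UNIV. ?i m k * ?g k a)"
      using g_cnj[of a] by (simp add: mult.commute)
    then show ?thesis by (simp add: gi_inv(1)[OF centre_P])
  qed
  have "?i \<nu> m = (\<Sum>a\<in>UNIV. ?i \<nu> a * (\<Sum>k\<in>UNIV. ?g a k * cnj (?i m k)))"
    unfolding 1 by (simp add: if_distrib cong: if_cong)
  also have "\<dots> = (\<Sum>k\<in>UNIV. (\<Sum>a\<in>UNIV. ?i \<nu> a * ?g a k) * cnj (?i m k))"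
    unfolding sum_distrib_left sum_distrib_right mult.assoc by (rule sum.swap)
  also have "\<dots> = cnj (?i m \<nu>)" unfolding gi_inv(1)[OF centre_P] by (simp add: if_distrib[of "\<lambda>x. x * _"] cong: if_cong)
  finally show ?thesis .
qed

lemma B_cnj: "B x y = cnj (B y x)"
proof -
  have "cnj (B y x) = (\<Sum>a\<in>UNIV. \<Sum>b\<in>UNIV. gi a b (mk p q) * x a * cnj (y b))"
    unfolding B_def by (simp add: gi_cnj[symmetric] mult_ac)
  also have "\<dots> = B x y" unfolding B_def by (rule sum.swap)
  finally show ?thesis by simp
qed

lemma Q_cnj: "Q z t = cnj (Q t z)"
  unfolding Q_def by (rule B_cnj)

lemma B_real: "B x x = of_real (Re (B x x))"
  using B_cnj[of x x] by (metis Reals_cnj_iff of_real_Re)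

lemma v_p: "v b p = 0"
  using pp.d_at_p(1)[of q b] pP by (simp add: v_\<Phi>)

definition \<Omega>1 where "\<Omega>1 = {z \<in> \<Omega>. K z p \<noteq> 0}"

lemma open_\<Omega>1: "open \<Omega>1"
proof -
  have "\<Omega>1 = \<Omega> \<inter> (\<lambda>z. K z p) -` (- {0})" by (auto simp: \<Omega>1_def)
  moreover have "open (- {0::complex})" by (rule open_Compl) simp
  ultimately show ?thesis using continuous_open_preimage[OF holo_on_continuous[OF K_holo[OF p]] open_domain, of "- {0}"] by simp
qed

lemma holo_v: "holo_on \<Omega>1 (v b)"
proof -
  have "holo_on \<Omega>1 (\<lambda>z. pd (Inr b) H (mk z q) / K z p - pd (Inr b) L (mk p q))"
    by (intro holo_on_diff holo_on_divide holo_on_const holo_on_mk_left[OF open_D holo_on_pd[OF open_D holo_H]] holo_on_subset[OF K_holo[OF p]])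
      (use p in \<open>auto simp: \<Omega>1_def\<close>)
  then show ?thesis by (subst holo_on_cong[OF open_\<Omega>1 v_eq]) (auto simp: \<Omega>1_def)
qed

lemma polydisc_\<Omega>1: "polydisc p r \<subseteq> \<Omega>1"
proof
  fix z assume z: "z \<in> polydisc p r"
  then have "mk z q \<in> P" using pP by (simp add: mk_in_polydisc)
  then show "z \<in> \<Omega>1" using H_nz(2)[of "mk z q"] polydisc_sub z by (auto simp: \<Omega>1_def)
qed

lemma pd_v: "pd a (v b) p = g a b (mk p q)"
proof -
  have "pd a (v b) p = pd a (\<lambda>z. pd (Inr b) \<Phi> (mk z q)) p"
    by (rule pd_cong[OF open_polydisc pP(1)]) (simp add: v_\<Phi>)
  then show ?thesis using g_\<Phi>[OF centre_P, of a b] by (simp add: pd_mk(1)[of a "pd (Inr b) \<Phi>"])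
qed

lemma kappa_pos: "\<kappa> > 0"
  using \<gamma> by (simp add: \<kappa>_def)

text \<open>By the Cauchy-Schwarz inequality for the kernel the diastasis is nonnegative.\<close>
lemma Q_nonneg: assumes z: "z \<in> polydisc p r" shows "Re (Q z z) \<ge> 0"
proof -
  have zP: "mk z (cnj_vec z) \<in> P" "mk z q \<in> P" "mk p (cnj_vec z) \<in> P"
    using z pP by (auto simp: mk_in_polydisc cnj_vec_in_polydisc)
  have z\<Omega>: "z \<in> \<Omega>" using z polydisc_sub by blast
  have "\<Phi> (mk z (cnj_vec z)) \<in> \<real>" using \<Phi>_sg[OF zP(1)] by (simp add: Reals_cnj_iff)
  then obtain \<phi> where \<phi>: "\<Phi> (mk z (cnj_vec z)) = of_real \<phi>" by (auto elim: Reals_cases)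
  have E: "exp (L W) = H W" if "W \<in> P" for W using H_nz(2)[OF that] by (simp add: L_def)
  have "exp (\<Phi> (mk z (cnj_vec z))) = H (mk z (cnj_vec z)) * H (mk p q) / (H (mk z q) * H (mk p (cnj_vec z)))"
    by (simp add: \<Phi>_def exp_add exp_diff E zP centre_P del: H_mk)
  then have "exp (\<Phi> (mk z (cnj_vec z))) * (K z p * K p z) = K z z * K p p"
    using H_nz(2)[OF zP(2)] H_nz(2)[OF zP(3)] by (simp add: field_simps)
  then have "complex_of_real (exp \<phi> * (cmod (K z p))^2) = of_real (Re (K z z) * Re (K p p))"
    using K_pos(1)[OF z\<Omega>] K_pos(1)[OF p] K_cnj[OF p z\<Omega>] complex_norm_square[of "K z p"]
    by (metis \<phi> exp_of_real of_real_mult)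
  then have "exp \<phi> * (cmod (K z p))^2 = Re (K z z) * Re (K p p)" by (simp only: of_real_eq_iff)
  then have "(cmod (K z p))^2 * 1 \<le> (cmod (K z p))^2 * exp \<phi>" using K_CS[OF z\<Omega> p] by (simp add: mult.commute)
  moreover have "(cmod (K z p))^2 > 0" using H_nz(2)[OF zP(2)] by simp
  ultimately have "exp \<phi> \<ge> 1" by (metis mult_le_cancel_left_pos)
  then have "\<phi> \<ge> 0" by simp
  have "complex_of_real (exp (- \<kappa> * \<phi>)) = 1 - \<kappa> * Q z z" using local_identity[OF z z] \<phi> by (simp flip: exp_of_real)
  then have "exp (- \<kappa> * \<phi>) = 1 - \<kappa> * Re (Q z z)" by (simp add: complex_eq_iff)
  moreover have "exp (- \<kappa> * \<phi>) \<le> 1" using kappa_pos \<open>\<phi> \<ge> 0\<close> by simp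
  ultimately have "\<kappa> * Re (Q z z) \<ge> 0" by simp
  then show ?thesis using kappa_pos by (simp add: zero_le_mult_iff)
qed

text \<open>By \<open>pd_v\<close> the map \<open>v\<close> has the metric as its derivative at p,
  so every covector x is a limit of v(p + a \<xi>) / a. Dividing Q(p + a \<xi>, p + a \<xi>) by a^2
  carries the nonnegativity of Q near p over to B.\<close>

lemma B_nonneg: "Re (B x x) \<ge> 0"
proof -
  \<comment> \<open>The direction whose image under the metric is x, as \<open>dx\<close>
    verifies.\<close>
  define \<xi> :: "complex^'n" where "\<xi> = (\<chi> a. \<Sum>b\<in>UNIV. x b * gi b a (mk p q))"
  have dx: "(\<Sum>a\<in>UNIV. \<xi>$a * g a b (mk p q)) = x b" for b
  proof -
    have "(\<Sum>a\<in>UNIV. \<xi>$a * g a b (mk p q)) = (\<Sum>k\<in>UNIV. x k * (\<Sum>a\<in>UNIV. gi k a (mk p q) * g a b (mk p q)))"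
      unfolding \<xi>_def vec_lambda_beta sum_distrib_left sum_distrib_right mult.assoc by (rule sum.swap)
    then show ?thesis unfolding gi_inv(1)[OF centre_P] by (simp add: if_distrib cong: if_cong)
  qed
  define a where "a n = complex_of_real (inverse (real (Suc n)))" for n
  have anz: "a n \<noteq> 0" and ac: "cnj (a n) = a n" for n by (simp_all add: a_def del: of_nat_Suc)
  have a0: "a \<longlonglongrightarrow> 0" unfolding a_def using tendsto_of_real[OF LIMSEQ_inverse_real_of_nat, where 'a=complex] by simp
  have fa: "filterlim a (at 0) sequentially" using a0 anz by (simp add: filterlim_at)
  have lim: "(\<lambda>n. v b (p + a n *s \<xi>) / a n) \<longlonglongrightarrow> x b" for b
  proof -
    have "p + 0 *s \<xi> \<in> \<Omega>1" using polydisc_\<Omega>1 pP by (simp add: vec_eq_iff subset_iff)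
    from holo_on_line[OF open_\<Omega>1 holo_v this]
    have "((\<lambda>\<zeta>. v b (p + \<zeta> *s \<xi>)) has_field_derivative x b) (at 0)" by (simp add: pd_v dx)
    then have "((\<lambda>h. v b (p + h *s \<xi>) / h) \<longlongrightarrow> x b) (at 0)" by (simp add: DERIV_def v_p)
    then show ?thesis by (rule filterlim_compose[OF _ fa])
  qed
  have "(\<lambda>n. Re (Q (p + a n *s \<xi>) (p + a n *s \<xi>) / (a n * a n))) \<longlonglongrightarrow> Re (B x x)"
  proof (rule tendsto_Re)
    have "Q (p + a n *s \<xi>) (p + a n *s \<xi>) / (a n * a n)
      = (\<Sum>i\<in>UNIV. \<Sum>b\<in>UNIV. gi b i (mk p q) * (v b (p + a n *s \<xi>) / a n) * cnj (v i (p + a n *s \<xi>) / a n))" for n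
      unfolding Q_def B_def by (simp add: sum_divide_distrib ac)
    then show "(\<lambda>n. Q (p + a n *s \<xi>) (p + a n *s \<xi>) / (a n * a n)) \<longlonglongrightarrow> B x x"
      unfolding B_def by (simp only:) (intro tendsto_intros lim)
  qed
  moreover have "\<forall>\<^sub>F n in sequentially. Re (Q (p + a n *s \<xi>) (p + a n *s \<xi>) / (a n * a n)) \<ge> 0"
  proof -
    have "(\<lambda>n. p + a n *s \<xi>) \<longlonglongrightarrow> p + 0 *s \<xi>"
      by (intro tendsto_intros bounded_linear.tendsto[OF bounded_linear_scal] a0)
    then have "\<forall>\<^sub>F n in sequentially. p + a n *s \<xi> \<in> polydisc p r"
      by (rule topological_tendstoD[OF _ open_polydisc]) (use pP in simp)
    then show ?thesis
    proof eventually_elim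
      case (elim n)
      have "a n * a n = of_real (inverse (real (Suc n)) * inverse (real (Suc n)))" by (simp add: a_def)
      then have "Re (Q (p + a n *s \<xi>) (p + a n *s \<xi>) / (a n * a n)) = Re (Q (p + a n *s \<xi>) (p + a n *s \<xi>)) / (inverse (real (Suc n)) * inverse (real (Suc n)))"
        by (simp only: Re_divide_of_real)
      then show ?case using Q_nonneg[OF elim] by simp
    qed
  qed
  ultimately show ?thesis by (intro tendsto_lowerbound[OF _ _ sequentially_bot]) auto
qed

text \<open>Nonnegativity of B on x + s \<beta> y with s real and \<beta> = B(x,y). Only
  semidefiniteness is available, so B(y,y) = 0 is a case of its own.\<close>

lemma B_CS: "(cmod (B x y))^2 \<le> Re (B x x) * Re (B y y)"
proof -
  define \<beta> where "\<beta> = B x y"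
  have exp: "0 \<le> Re (B x x) + 2 * s * (cmod \<beta>)^2 + s^2 * (cmod \<beta>)^2 * Re (B y y)" for s :: real
  proof -
    have "B (\<lambda>b. x b + of_real s * \<beta> * y b) (\<lambda>b. x b + of_real s * \<beta> * y b)
      = B x x + of_real s * cnj \<beta> * B x y + of_real s * \<beta> * B y x + (of_real s * \<beta>) * cnj (of_real s * \<beta>) * B y y"
      by (simp add: B_def sum.distrib sum_distrib_left algebra_simps)
    also have "B y x = cnj \<beta>" unfolding \<beta>_def by (rule B_cnj)
    also have "B x y = \<beta>" by (simp add: \<beta>_def)
    also have "of_real s * cnj \<beta> * \<beta> = of_real (s * (cmod \<beta>)^2)" using complex_norm_square[of \<beta>] by (simp add: mult_ac)
    also have "of_real s * \<beta> * cnj \<beta> = of_real (s * (cmod \<beta>)^2)" using complex_norm_square[of \<beta>] by (simp add: mult_ac)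
    also have "(of_real s * \<beta>) * cnj (of_real s * \<beta>) = of_real (s^2 * (cmod \<beta>)^2)" using complex_norm_square[of \<beta>] by (simp add: mult_ac power2_eq_square)
    finally have "Re (B (\<lambda>b. x b + of_real s * \<beta> * y b) (\<lambda>b. x b + of_real s * \<beta> * y b))
      = Re (B x x) + 2 * s * (cmod \<beta>)^2 + s^2 * (cmod \<beta>)^2 * Re (B y y)" by simp
    then show ?thesis using B_nonneg by metis
  qed
  show ?thesis
  proof (cases "Re (B y y) > 0")
    case True
    then show ?thesis using exp[of "- 1 / Re (B y y)"] by (simp add: \<beta>_def power2_eq_square field_simps)
  next
    case False
    then have 0: "Re (B y y) = 0" using B_nonneg[of y] by simp
    have "\<beta> = 0"
    proof (rule ccontr)
      assume "\<beta> \<noteq> 0"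
      \<comment> \<open>With this s the nonnegative expression would equal -1.\<close>
      then show False using exp[of "- (Re (B x x) + 1) / (2 * (cmod \<beta>)^2)"] 0 B_nonneg[of x] by (simp add: field_simps)
    qed
    then show ?thesis using 0 by (simp add: \<beta>_def)
  qed
qed

text \<open>On a smaller polydisc |\<kappa>\<Phi>| < 1 < pi, so the principal logarithm undoes the
  exponential in \<open>local_identity\<close>.\<close>

lemma local_kernel:
  obtains \<rho> where "0 < \<rho>" "\<rho> \<le> r"
    "\<And>z t. z \<in> polydisc p \<rho> \<Longrightarrow> t \<in> polydisc p \<rho> \<Longrightarrow>
      K z t * K p p = K z p * K p t * exp (- (1 / complex_of_real \<kappa>) * Ln (1 - \<kappa> * Q z t))"
proof -
  have "open (P \<inter> \<Phi> -` ball 0 (1 / \<kappa>))"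
    by (intro continuous_open_preimage holo_on_continuous h\<Phi> opP open_ball)
  moreover have "mk p q \<in> P \<inter> \<Phi> -` ball 0 (1 / \<kappa>)" using centre_P kappa_pos by (simp add: \<Phi>_def)
  ultimately obtain \<rho> where \<rho>: "0 < \<rho>" "polydisc (mk p q) \<rho> \<subseteq> P \<inter> \<Phi> -` ball 0 (1 / \<kappa>)" by (rule polydisc_subset_open)
  show ?thesis
  proof (rule that[of "min \<rho> r"])
    fix z t assume zt: "z \<in> polydisc p (min \<rho> r)" "t \<in> polydisc p (min \<rho> r)"
    then have "z \<in> polydisc p \<rho>" "t \<in> polydisc p \<rho>" and zr: "z \<in> polydisc p r" "t \<in> polydisc p r"
      by (auto simp: polydisc_def)
    then have "mk z (cnj_vec t) \<in> polydisc (mk p q) \<rho>" by (simp add: mk_in_polydisc cnj_vec_in_polydisc)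
    then have small: "cmod (\<Phi> (mk z (cnj_vec t))) < 1 / \<kappa>" using \<rho> by auto
    have zP: "mk z (cnj_vec t) \<in> P" "mk z q \<in> P" "mk p (cnj_vec t) \<in> P"
      using zr pP by (auto simp: mk_in_polydisc cnj_vec_in_polydisc)
    have E: "exp (L W) = H W" if "W \<in> P" for W using H_nz(2)[OF that] by (simp add: L_def)
    have "cmod (- complex_of_real \<kappa> * \<Phi> (mk z (cnj_vec t))) < 1" using small kappa_pos by (simp add: norm_mult field_simps)
    then have "\<bar>Im (- complex_of_real \<kappa> * \<Phi> (mk z (cnj_vec t)))\<bar> < 1" using abs_Im_le_cmod le_less_trans by blast
    then have "Ln (exp (- complex_of_real \<kappa> * \<Phi> (mk z (cnj_vec t)))) = - complex_of_real \<kappa> * \<Phi> (mk z (cnj_vec t))"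
      using pi_gt3 by (intro Ln_exp) linarith+
    then have "- (1 / complex_of_real \<kappa>) * Ln (1 - \<kappa> * Q z t) = \<Phi> (mk z (cnj_vec t))"
      using local_identity[OF zr] kappa_pos by simp
    moreover have "exp (\<Phi> (mk z (cnj_vec t))) = H (mk z (cnj_vec t)) * H (mk p q) / (H (mk z q) * H (mk p (cnj_vec t)))"
      by (simp add: \<Phi>_def exp_add exp_diff E zP centre_P del: H_mk)
    ultimately show "K z t * K p p = K z p * K p t * exp (- (1 / complex_of_real \<kappa>) * Ln (1 - \<kappa> * Q z t))"
      using H_nz(2)[OF zP(2)] H_nz(2)[OF zP(3)] by (simp add: field_simps)
  qed (use \<rho> radius(1) in auto)
qed

end

section \<open>Continuation to the whole domain\<close>

context bergman_const
begin

text \<open>Where the representative coordinates exist and lie in the expected ball; for two such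
  points the principal branch of the power is available by \<open>Re_pos\<close>.\<close>

definition regular_set where "regular_set = {z \<in> \<Omega>1. \<kappa> * Re (Q z z) < 1}"
definition U where "U = connected_component_set regular_set p"

lemma continuous_v: "continuous_on \<Omega>1 (v b)"
  by (rule holo_on_continuous[OF holo_v])

lemma continuous_Q: "continuous_on \<Omega>1 (\<lambda>z. Re (Q z z))"
  unfolding Q_def B_def by (intro continuous_intros continuous_v)

lemma open_regular_set: "open regular_set"
proof -
  have "regular_set = \<Omega>1 \<inter> (\<lambda>z. Re (Q z z)) -` {x. \<kappa> * x < 1}" by (auto simp: regular_set_def)
  moreover have "open {x. \<kappa> * x < 1}" by (intro open_Collect_less continuous_intros)
  ultimately show ?thesis using continuous_open_preimage[OF continuous_Q open_\<Omega>1] by metis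
qed

lemma Q_p: "Q p t = 0" "Q t p = 0"
  by (simp_all add: Q_def B_def v_p)

lemma p_regular: "p \<in> regular_set"
  using polydisc_\<Omega>1 pP by (auto simp: regular_set_def Q_p)

lemma U: "open U" "connected U" "U \<subseteq> regular_set" "p \<in> U" "U \<subseteq> \<Omega>"
proof -
  show "open U" unfolding U_def by (rule open_connected_component[OF open_regular_set])
  show "connected U" unfolding U_def by (rule connected_connected_component)
  show "U \<subseteq> regular_set" unfolding U_def by (rule connected_component_subset)
  then show "U \<subseteq> \<Omega>" by (auto simp: regular_set_def \<Omega>1_def)
  show "p \<in> U" unfolding U_def using p_regular by simp
qed

text \<open>Cauchy-Schwarz for B. The first bound is uniform in z, which the limit towards a
  boundary point needs; the second keeps 1 - \<kappa>Q(z,t) in the right half-plane.\<close>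

lemma Q_bound:
  assumes "z \<in> regular_set" "t \<in> regular_set"
  shows "\<kappa> * cmod (Q z t) \<le> sqrt (\<kappa> * Re (Q t t))" "\<kappa> * cmod (Q z t) < 1"
proof -
  have n: "Re (Q x x) \<ge> 0" for x unfolding Q_def by (rule B_nonneg)
  have lt: "\<kappa> * Re (Q z z) < 1" "\<kappa> * Re (Q t t) < 1" using assms by (auto simp: regular_set_def)
  have "(\<kappa> * cmod (Q z t))^2 \<le> \<kappa>^2 * (Re (Q z z) * Re (Q t t))"
    unfolding power_mult_distrib Q_def by (intro mult_left_mono B_CS) simp
  also have "\<dots> = (\<kappa> * Re (Q z z)) * (\<kappa> * Re (Q t t))" by (simp add: power2_eq_square)
  also have "\<dots> \<le> 1 * (\<kappa> * Re (Q t t))" using lt n[of t] kappa_pos by (intro mult_right_mono) auto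
  finally have "(\<kappa> * cmod (Q z t))^2 \<le> \<kappa> * Re (Q t t)" by simp
  then show 1: "\<kappa> * cmod (Q z t) \<le> sqrt (\<kappa> * Re (Q t t))" by (rule real_le_rsqrt)
  have "sqrt (\<kappa> * Re (Q t t)) < 1" using lt by simp
  with 1 show "\<kappa> * cmod (Q z t) < 1" by (rule le_less_trans)
qed

lemma Re_pos: assumes "z \<in> regular_set" "t \<in> regular_set" shows "Re (1 - \<kappa> * Q z t) > 0"
proof -
  have "Re (\<kappa> * Q z t) \<le> cmod (\<kappa> * Q z t)" by (rule complex_Re_le_cmod)
  also have "\<dots> < 1" using Q_bound(2)[OF assms] kappa_pos by (simp add: norm_mult)
  finally show ?thesis by simp
qed

text \<open>The branch of w^(-1/\<kappa>) given by the principal logarithm.\<close>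

definition pw where "pw w = exp (- (1 / complex_of_real \<kappa>) * Ln w)"
definition E where "E z t \<longleftrightarrow> K z t * K p p = K z p * K p t * pw (1 - \<kappa> * Q z t)"

text \<open>K and Q are Hermitian symmetric, and conjugation commutes with \<open>Ln\<close> off the
  nonpositive real axis.\<close>

lemma E_sym: assumes "E z t" "z \<in> regular_set" "t \<in> regular_set" shows "E t z"
proof -
  have in\<Omega>: "z \<in> \<Omega>" "t \<in> \<Omega>" using assms by (auto simp: regular_set_def \<Omega>1_def)
  have Qc: "cnj (1 - \<kappa> * Q z t) = 1 - \<kappa> * Q t z" using Q_cnj[of t z] by simp
  have "1 - \<kappa> * Q z t \<notin> \<real>\<^sub>\<le>\<^sub>0" using Re_pos[OF assms(2,3)] by (auto simp: complex_nonpos_Reals_iff)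
  then have "cnj (Ln (1 - \<kappa> * Q z t)) = Ln (1 - \<kappa> * Q t z)" unfolding Qc[symmetric] by (rule cnj_Ln)
  then have pwc: "cnj (pw (1 - \<kappa> * Q z t)) = pw (1 - \<kappa> * Q t z)"
    unfolding pw_def by (simp add: exp_cnj)
  have "cnj (K z t * K p p) = cnj (K z p * K p t * pw (1 - \<kappa> * Q z t))" using assms(1) by (simp add: E_def)
  then have "K t z * K p p = K p z * K t p * pw (1 - \<kappa> * Q t z)"
    by (simp only: complex_cnj_mult pwc K_cnj[OF in\<Omega>(2,1), symmetric] K_cnj[OF p p, symmetric] K_cnj[OF p in\<Omega>(1), symmetric] K_cnj[OF in\<Omega>(2) p, symmetric])
  then show ?thesis by (simp add: E_def mult_ac)
qed

lemma extend:
  assumes t: "t \<in> regular_set" and \<rho>: "0 < \<rho>" "polydisc p \<rho> \<subseteq> U" and loc: "\<And>z. z \<in> polydisc p \<rho> \<Longrightarrow> E z t" and z: "z \<in> U"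
  shows "E z t"
proof -
  let ?f = "\<lambda>z. K z t * K p p - K z p * K p t * pw (1 - \<kappa> * Q z t)"
  have in\<Omega>: "t \<in> \<Omega>" using t by (auto simp: regular_set_def \<Omega>1_def)
  have U1: "U \<subseteq> \<Omega>1" using U(3) by (auto simp: regular_set_def)
  have hQ: "holo_on U (\<lambda>z. Q z t)"
    unfolding Q_def B_def by (intro holo_on_sum holo_on_mult holo_on_const holo_on_subset[OF holo_v U1])
  have "holo_on U ?f"
    unfolding pw_def
  proof (intro holo_on_diff holo_on_mult holo_on_const holo_on_exp holo_on_Ln hQ holo_on_subset[OF K_holo U(5)] in\<Omega> p)
    fix Z assume "Z \<in> U"
    then show "1 - \<kappa> * Q Z t \<notin> \<real>\<^sub>\<le>\<^sub>0" using Re_pos[OF _ t] U(3) by (force simp: complex_nonpos_Reals_iff)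
  qed
  then have "?f z = 0"
  proof (rule identity_theorem[OF U(1,2) _ open_polydisc _ \<rho>(2) _ z])
    show "polydisc p \<rho> \<noteq> {}" using centre_in_polydisc[OF \<rho>(1)] by blast
  qed (use loc in \<open>simp add: E_def\<close>)
  then show ?thesis by (simp add: E_def)
qed

text \<open>\<open>extend\<close> moves only the first variable: with t near p it reaches all z in
  U, the symmetry \<open>E_sym\<close> exchanges the roles, and a second application reaches all t
  in U.\<close>

lemma E_U: "z \<in> U \<Longrightarrow> t \<in> U \<Longrightarrow> E z t"
proof -
  assume zt: "z \<in> U" "t \<in> U"
  obtain \<rho>1 where \<rho>1: "0 < \<rho>1" "\<rho>1 \<le> r" and loc: "\<And>z t. z \<in> polydisc p \<rho>1 \<Longrightarrow> t \<in> polydisc p \<rho>1 \<Longrightarrow> E z t"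
    using local_kernel unfolding E_def pw_def by metis
  obtain \<rho>2 where \<rho>2: "0 < \<rho>2" "polydisc p \<rho>2 \<subseteq> U" using polydisc_subset_open[OF U(1,4)] .
  define \<rho> where "\<rho> = min \<rho>1 \<rho>2"
  have \<rho>: "0 < \<rho>" "polydisc p \<rho> \<subseteq> U" using \<rho>1 \<rho>2 polydisc_mono[of \<rho> \<rho>2 p] by (auto simp: \<rho>_def)
  have loc: "E z t" if "z \<in> polydisc p \<rho>" "t \<in> polydisc p \<rho>" for z t
    using loc that polydisc_mono[of \<rho> \<rho>1 p] by (auto simp: \<rho>_def)
  have 1: "E z t" if "t \<in> polydisc p \<rho>" "z \<in> U" for z t
    by (rule extend[OF _ \<rho> _ that(2)]) (use that \<rho> U(3) loc in auto)
  have "E w z" if "w \<in> polydisc p \<rho>" for w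
    using E_sym[OF 1[OF that zt(1)]] zt that \<rho> U(3) by blast
  then have "E t z" by (intro extend[OF _ \<rho> _ zt(2)]) (use zt U(3) in auto)
  then show "E z t" using E_sym zt U(3) by blast
qed

lemma cmod_pw: "w \<noteq> 0 \<Longrightarrow> cmod (pw w) = cmod w powr (- (1 / \<kappa>))"
  by (simp add: pw_def norm_exp_eq_Re powr_def)

text \<open>If \<open>K(y,p) = 0\<close>, the kernel formula gives \<open>K(y,t) = 0\<close> for all \<open>t\<close> in \<open>U\<close>, hence \<open>K(y,y) = 0\<close>; if
  \<open>\<kappa> Q(y,y) = 1\<close>, it makes the kernel blow up along the diagonal at \<open>y\<close>.\<close>
lemma boundary_regular:
  assumes y: "y \<in> \<Omega>" and cl: "y \<in> closure U"
  shows "y \<in> regular_set"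
proof -
  obtain x where x: "\<And>n. x n \<in> U" "x \<longlonglongrightarrow> y" using cl closure_sequential by blast
  have K: "(\<lambda>n. K (x n) t) \<longlonglongrightarrow> K y t" if "t \<in> \<Omega>" for t
    using holo_on_isCont[OF K_holo[OF that] y] isCont_tendsto_compose x(2) by blast
  have nz: "K y p \<noteq> 0"
  proof
    assume 0: "K y p = 0"
    have z: "K y t = 0" if t: "t \<in> U" for t
    proof -
      have tS: "t \<in> regular_set" "t \<in> \<Omega>" using t U by auto
      \<comment> \<open>A lower bound for |1 - \<kappa>Q(x n, t)| that does not depend on n, so the
        power stays bounded while K(x n, p) tends to 0.\<close>
      define \<delta> where "\<delta> = 1 - sqrt (\<kappa> * Re (Q t t))"
      have \<delta>: "\<delta> > 0" using tS by (simp add: \<delta>_def regular_set_def)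
      have bd: "cmod (K (x n) t) * cmod (K p p) \<le> cmod (K (x n) p) * cmod (K p t) * \<delta> powr (- (1 / \<kappa>))" for n
      proof -
        have xS: "x n \<in> regular_set" using x(1) U(3) by blast
        have "\<delta> \<le> 1 - cmod (\<kappa> * Q (x n) t)" using Q_bound(1)[OF xS tS(1)] kappa_pos by (simp add: \<delta>_def norm_mult)
        also have "\<dots> \<le> cmod (1 - \<kappa> * Q (x n) t)" using norm_triangle_ineq2[of 1 "\<kappa> * Q (x n) t"] by simp
        finally have \<delta>le: "\<delta> \<le> cmod (1 - \<kappa> * Q (x n) t)" .
        have "1 - \<kappa> * Q (x n) t \<noteq> 0" using \<delta>le \<delta> by auto
        then have "cmod (pw (1 - \<kappa> * Q (x n) t)) \<le> \<delta> powr (- (1 / \<kappa>))"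
          using \<delta>le \<delta> kappa_pos by (subst cmod_pw) (auto intro: powr_mono2')
        moreover have "cmod (K (x n) t * K p p) = cmod (K (x n) p * K p t * pw (1 - \<kappa> * Q (x n) t))"
          using E_U[OF x(1) t] by (simp add: E_def)
        ultimately show ?thesis by (simp add: norm_mult mult_left_mono)
      qed
      have "cmod (K y t) * cmod (K p p) \<le> cmod (K y p) * cmod (K p t) * \<delta> powr (- (1 / \<kappa>))"
        by (rule LIMSEQ_le[of "\<lambda>n. cmod (K (x n) t) * cmod (K p p)" _ "\<lambda>n. cmod (K (x n) p) * cmod (K p t) * \<delta> powr (- (1 / \<kappa>))"])
          (use bd in \<open>auto intro!: tendsto_intros K tS p\<close>)
      then have "cmod (K y t) * cmod (K p p) \<le> 0" by (simp add: 0)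
      moreover have "cmod (K p p) > 0" using K_pos(2)[OF p] by auto
      ultimately show ?thesis by (simp add: mult_le_0_iff)
    qed
    \<comment> \<open>By symmetry K(.,y) vanishes on the open set U, hence on \<Omega>, and in
      particular at y itself.\<close>
    have "K y y = 0"
    proof (rule identity_theorem[OF open_domain connected_domain K_holo[OF y] U(1) _ U(5) _ y])
      show "K t y = 0" if "t \<in> U" for t using z[OF that] K_cnj[OF _ y, of t] U(5) that by auto
    qed (use U(4) in auto)
    then show False using K_pos(2)[OF y] by simp
  qed
  then have y1: "y \<in> \<Omega>1" using y by (simp add: \<Omega>1_def)
  have "\<kappa> * Re (Q y y) < 1"
  proof (rule ccontr)
    assume ge: "\<not> \<kappa> * Re (Q y y) < 1"
    have xS: "x n \<in> regular_set" for n using x(1) U(3) by blast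
    have "isCont (\<lambda>z. Re (Q z z)) y" using continuous_Q y1 open_\<Omega>1 by (simp add: continuous_on_eq_continuous_at)
    then have "(\<lambda>n. Re (Q (x n) (x n))) \<longlonglongrightarrow> Re (Q y y)" using isCont_tendsto_compose x(2) by blast
    then have lim: "(\<lambda>n. 1 - \<kappa> * Re (Q (x n) (x n))) \<longlonglongrightarrow> 1 - \<kappa> * Re (Q y y)" by (intro tendsto_diff tendsto_mult tendsto_const)
    have up: "1 - \<kappa> * Re (Q (x n) (x n)) > 0" for n using xS[of n] by (simp add: regular_set_def)
    have "1 - \<kappa> * Re (Q y y) \<ge> 0" using up by (intro LIMSEQ_le_const[OF lim]) (auto intro: less_imp_le)
    with ge have u0: "1 - \<kappa> * Re (Q y y) = 0" by simp
    \<comment> \<open>The negative power is moved to the other side; in this form both sides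
      converge, the left one to 0.\<close>
    have id: "cmod (K (x n) (x n)) * cmod (K p p) * (1 - \<kappa> * Re (Q (x n) (x n))) powr (1 / \<kappa>) = cmod (K (x n) p) * cmod (K p (x n))" for n
    proof -
      have r: "1 - \<kappa> * Q (x n) (x n) = of_real (1 - \<kappa> * Re (Q (x n) (x n)))"
        using B_real[of "\<lambda>b. v b (x n)"] by (simp add: Q_def)
      have "cmod (K (x n) (x n) * K p p) = cmod (K (x n) p * K p (x n) * pw (1 - \<kappa> * Q (x n) (x n)))"
        using E_U[OF x(1) x(1)] by (simp add: E_def)
      also have "cmod (K (x n) p * K p (x n) * pw (1 - \<kappa> * Q (x n) (x n)))
          = cmod (K (x n) p) * cmod (K p (x n)) * (1 - \<kappa> * Re (Q (x n) (x n))) powr (- (1 / \<kappa>))"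
      proof -
        have "cmod (1 - \<kappa> * Q (x n) (x n)) = 1 - \<kappa> * Re (Q (x n) (x n))" unfolding r norm_of_real using up[of n] by simp
        moreover have "1 - \<kappa> * Q (x n) (x n) \<noteq> 0" unfolding r of_real_eq_0_iff using up[of n] by simp
        ultimately show ?thesis by (simp add: norm_mult cmod_pw)
      qed
      finally have "cmod (K (x n) (x n)) * cmod (K p p) = cmod (K (x n) p) * cmod (K p (x n)) * (1 - \<kappa> * Re (Q (x n) (x n))) powr (- (1 / \<kappa>))"
        by (simp add: norm_mult)
      then show ?thesis using up[of n] by (simp add: powr_minus field_simps)
    qed
    \<comment> \<open>On the diagonal both arguments move at once, which calls for the joint
      continuity of \<open>H\<close>.\<close>
    have Kd: "(\<lambda>n. cmod (K (x n) (x n))) \<longlonglongrightarrow> cmod (K y y)" and Kp: "(\<lambda>n. cmod (K p (x n))) \<longlonglongrightarrow> cmod (K p y)"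
    proof -
      have "isCont H (mk y (cnj_vec y))" using y by (intro holo_on_isCont[OF holo_H]) simp
      then have "(\<lambda>n. H (mk (x n) (cnj_vec (x n)))) \<longlonglongrightarrow> H (mk y (cnj_vec y))"
        using isCont_tendsto_compose[OF continuous_mk(1) x(2)] isCont_tendsto_compose by blast
      then show "(\<lambda>n. cmod (K (x n) (x n))) \<longlonglongrightarrow> cmod (K y y)" by (intro tendsto_norm) simp
      have "cmod (K p z) = cmod (K z p)" if "z \<in> \<Omega>" for z using K_cnj[OF p that] by simp
      then show "(\<lambda>n. cmod (K p (x n))) \<longlonglongrightarrow> cmod (K p y)" using tendsto_norm[OF K[OF p]] x(1) U(5) y by (simp add: subset_iff)
    qed
    have "(\<lambda>n. (1 - \<kappa> * Re (Q (x n) (x n))) powr (1 / \<kappa>)) \<longlonglongrightarrow> (1 - \<kappa> * Re (Q y y)) powr (1 / \<kappa>)"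
      by (rule tendsto_powr'[OF lim tendsto_const]) (use up kappa_pos in \<open>auto intro: always_eventually less_imp_le\<close>)
    then have "(\<lambda>n. (1 - \<kappa> * Re (Q (x n) (x n))) powr (1 / \<kappa>)) \<longlonglongrightarrow> 0" unfolding u0 by simp
    from tendsto_mult[OF tendsto_mult[OF Kd tendsto_const[of "cmod (K p p)"]] this]
    have "(\<lambda>n. cmod (K (x n) p) * cmod (K p (x n))) \<longlonglongrightarrow> 0" unfolding id by simp
    moreover have "(\<lambda>n. cmod (K (x n) p) * cmod (K p (x n))) \<longlonglongrightarrow> cmod (K y p) * cmod (K p y)"
      by (intro tendsto_intros K Kp p)
    ultimately have "cmod (K y p) * cmod (K p y) = 0" using LIMSEQ_unique by blast
    then show False using nz K_cnj[OF p y] by simp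
  qed
  then show ?thesis using y1 by (simp add: regular_set_def)
qed

text \<open>A component is closed in \<open>regular_set\<close>, so by
  \<open>boundary_regular\<close> U is closed in \<Omega> as well as open.\<close>

lemma U_eq: "U = \<Omega>"
proof -
  have "\<Omega> \<inter> closure U \<subseteq> U"
  proof
    fix y assume y: "y \<in> \<Omega> \<inter> closure U"
    then have yS: "y \<in> regular_set" using boundary_regular by blast
    have "closedin (top_of_set regular_set) U" unfolding U_def by (rule closedin_connected_component)
    then obtain C where C: "closed C" "U = regular_set \<inter> C" by (auto simp: closedin_closed)
    then have "closure U \<subseteq> C" by (intro closure_minimal) auto
    then show "y \<in> U" using y yS C by auto
  qed
  then have "\<Omega> \<subseteq> U \<union> - closure U" by auto
  then have "\<not> (\<exists>y. y \<in> \<Omega> \<and> y \<notin> U)"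
    using connectedD[OF connected_domain U(1), of "- closure U"] U closure_subset[of U] by blast
  then show ?thesis using U(5) by blast
qed

lemma all_regular: "z \<in> \<Omega> \<Longrightarrow> z \<in> regular_set"
  using U_eq U(3) by blast

lemma K_nz: "z \<in> \<Omega> \<Longrightarrow> K z p \<noteq> 0"
  using all_regular by (auto simp: regular_set_def \<Omega>1_def)

section \<open>Representative coordinates, diastasis and its gradient at \<open>p\<close>\<close>

lemma binv_p: "binv K p $ \<nu> $ m = gi \<nu> m (mk p q)"
  by (rule binv_eq[OF pP(1)])

lemma bmetric_p: "bmetric K a b p = g a b (mk p q)"
  by (rule bmetric_eq[OF radius(2) pP(1)])

lemma rep_coord_eq: "rep_coord K p a z = (\<Sum>j\<in>UNIV. gi j a (mk p q) * v j z)"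
  by (simp add: rep_coord_def v_def binv_p)

text \<open>Lowering the index of the representative coordinates with the metric returns
  \<open>v\<close>.\<close>

lemma rep_quad_eq: "rep_quad K p z = Q z z"
proof -
  have w: "(\<Sum>a\<in>UNIV. rep_coord K p a z * g a b (mk p q)) = v b z" for b
  proof -
    have "(\<Sum>a\<in>UNIV. rep_coord K p a z * g a b (mk p q)) = (\<Sum>k\<in>UNIV. v k z * (\<Sum>a\<in>UNIV. gi k a (mk p q) * g a b (mk p q)))"
      unfolding rep_coord_eq sum_distrib_left sum_distrib_right by (subst sum.swap) (simp add: mult_ac)
    then show ?thesis unfolding gi_inv(1)[OF centre_P] by (simp add: if_distrib cong: if_cong)
  qed
  have "rep_quad K p z = (\<Sum>b\<in>UNIV. (\<Sum>a\<in>UNIV. rep_coord K p a z * g a b (mk p q)) * cnj (rep_coord K p b z))"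
    unfolding rep_quad_def bmetric_p sum_distrib_right by (rule sum.swap)
  also have "\<dots> = (\<Sum>b\<in>UNIV. \<Sum>a\<in>UNIV. gi b a (mk p q) * v b z * cnj (v a z))"
    unfolding w unfolding rep_coord_eq by (simp add: gi_cnj[symmetric] sum_distrib_left mult_ac)
  also have "\<dots> = Q z z" unfolding Q_def B_def by (rule sum.swap)
  finally show ?thesis .
qed

lemma Q_real: "Q z z = of_real (Re (Q z z))"
  unfolding Q_def by (rule B_real)

lemma Q_lt: "z \<in> \<Omega> \<Longrightarrow> Re (Q z z) < 2 / \<gamma>^2"
  using all_regular[of z] \<gamma> by (auto simp: regular_set_def \<kappa>_def field_simps)

text \<open>The kernel identity \<open>E\<close> at t = z, where 1 - \<kappa>Q(z,z) is a positive
  real and all logarithms are real.\<close>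

lemma diastasis_eq:
  assumes z: "z \<in> \<Omega>"
  shows "diastasis K p z = complex_of_real (-2 / \<gamma>^2) * Ln (1 - complex_of_real (\<gamma>^2 / 2) * rep_quad K p z)"
proof -
  define u where "u = 1 - \<kappa> * Re (Q z z)"
  have u: "u > 0" using all_regular[OF z] by (simp add: regular_set_def u_def)
  have uc: "1 - \<kappa> * Q z z = of_real u" using Q_real[of z] by (simp add: u_def)
  have "K z z * K p p = K z p * K p z * pw (of_real u)" using E_U[of z z] z by (simp add: U_eq E_def uc)
  also have "pw (of_real u) = of_real (exp (- (1 / \<kappa>) * ln u))" using u by (simp add: pw_def Ln_of_real flip: exp_of_real)
  also have "K z p * K p z = of_real ((cmod (K z p))^2)" using K_cnj[OF p z] complex_norm_square[of "K z p"] by simp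
  finally have "complex_of_real (Re (K z z) * Re (K p p)) = of_real ((cmod (K z p))^2 * exp (- (1 / \<kappa>) * ln u))"
    using K_pos(1)[OF z] K_pos(1)[OF p] by (metis of_real_mult)
  then have "Re (K z z) * Re (K p p) = (cmod (K z p))^2 * exp (- (1 / \<kappa>) * ln u)" by (simp only: of_real_eq_iff)
  then have "Re (K z z) * Re (K p p) / (cmod (K z p))^2 = exp (- (1 / \<kappa>) * ln u)" using K_nz[OF z] by simp
  then have "diastasis K p z = of_real (- (1 / \<kappa>) * ln u)" by (simp add: diastasis_def)
  moreover have "Ln (1 - complex_of_real (\<gamma>^2 / 2) * rep_quad K p z) = of_real (ln u)"
    using uc u by (simp add: rep_quad_eq \<kappa>_def Ln_of_real)
  ultimately show ?thesis by (simp add: \<kappa>_def)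
qed

text \<open>The diastasis is continued to independent (z, s) as L + C - f1(z) - f2(s). Only
  \<open>L\<close> and \<open>f1\<close> contribute to the z-derivative, and the symmetry under
  \<open>swap_cnj\<close> expresses it through \<open>v\<close>.\<close>

lemma wz_diastasis:
  assumes t: "t \<in> \<Omega>"
  shows "wz a (diastasis K t) p = - cnj (v a t)"
proof -
  \<comment> \<open>Dividing by the value at p, nonzero by \<open>K_nz\<close>, keeps K(z,t)/k in
    the right half-plane near p, where \<open>Ln\<close> is holomorphic; the constant
    \<open>C\<close> below compensates for the modulus of k.\<close>
  define k where "k = K p t"
  have k: "k \<noteq> 0" using K_nz[OF t] K_cnj[OF p t] by (simp add: k_def)
  have "open (\<Omega> \<inter> (\<lambda>z. K z t) -` {w. Re (w / k) > 0})"
  proof (rule continuous_open_preimage[OF holo_on_continuous[OF K_holo[OF t]] open_domain])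
    show "open {w. Re (w / k) > 0}" using k by (intro open_Collect_less continuous_intros) auto
  qed
  moreover have "p \<in> \<Omega> \<inter> (\<lambda>z. K z t) -` {w. Re (w / k) > 0}" using p k by (simp add: k_def)
  ultimately obtain \<rho>1 where \<rho>1: "0 < \<rho>1" "polydisc p \<rho>1 \<subseteq> \<Omega> \<inter> (\<lambda>z. K z t) -` {w. Re (w / k) > 0}" by (rule polydisc_subset_open)
  define \<rho> where "\<rho> = min \<rho>1 r"
  have \<rho>: "0 < \<rho>" "polydisc p \<rho> \<subseteq> polydisc p r" "polydisc (mk p q) \<rho> \<subseteq> P" and pos: "\<And>z. z \<in> polydisc p \<rho> \<Longrightarrow> z \<in> \<Omega> \<and> Re (K z t / k) > 0"
    using \<rho>1 radius(1) polydisc_mono[of \<rho> \<rho>1 p] polydisc_mono[of \<rho> r] by (auto simp: \<rho>_def)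
  let ?R = "polydisc (mk p q) \<rho>"
  define C where "C = complex_of_real (ln (Re (K t t)) - 2 * ln (cmod k))"
  define f1 where "f1 z = Ln (K z t / k)" for z
  define f2 where "f2 s = cnj (Ln (K (cnj_vec s) t / k))" for s
  define h where "h W = L W + C - f1 (lpart W) - f2 (rpart W)" for W
  have mkR: "mk z s \<in> ?R \<longleftrightarrow> z \<in> polydisc p \<rho> \<and> s \<in> polydisc q \<rho>" for z s by (rule mk_in_polydisc)
  have nonpos: "K z t / k \<notin> \<real>\<^sub>\<le>\<^sub>0" if "z \<in> polydisc p \<rho>" for z using pos[OF that] by (auto simp: complex_nonpos_Reals_iff)
  have parts: "lpart W \<in> polydisc p \<rho>" "cnj_vec (rpart W) \<in> polydisc p \<rho>" if "W \<in> ?R" for W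
    using that mk_in_polydisc[of "lpart W" "rpart W" p q \<rho>] cnj_vec_in_polydisc[of "rpart W" q \<rho>] by auto
  have pR: "p \<in> polydisc p \<rho>" using \<rho> by simp
  have hf1: "holo_on ?R (\<lambda>W. f1 (lpart W))"
  proof -
    have "holo_on ?R (\<lambda>W. H (mk (lpart W) (cnj_vec t)))"
      by (rule holo_on_lp[OF open_D holo_H]) (use parts(1) pos t in auto)
    then have "holo_on ?R (\<lambda>W. Ln (K (lpart W) t / k))"
      by (intro holo_on_Ln holo_on_divide holo_on_const nonpos parts(1)) (use k in auto)
    then show ?thesis by (simp add: f1_def)
  qed
  have hf2: "holo_on ?R (\<lambda>W. f2 (rpart W))"
  proof -
    have "holo_on ?R (\<lambda>W. H (mk t (rpart W)))"
      by (rule holo_on_rp[OF open_D holo_H]) (use parts(2) pos t in auto)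
    then have 1: "holo_on ?R (\<lambda>W. Ln (H (mk t (rpart W)) / cnj k))"
    proof (intro holo_on_Ln holo_on_divide holo_on_const)
      fix W assume W: "W \<in> ?R"
      have "H (mk t (rpart W)) / cnj k = cnj (K (cnj_vec (rpart W)) t / k)" using K_cnj[OF t, of "cnj_vec (rpart W)"] pos[OF parts(2)[OF W]] by simp
      moreover have "cnj w \<notin> \<real>\<^sub>\<le>\<^sub>0" if "w \<notin> \<real>\<^sub>\<le>\<^sub>0" for w using that by (simp add: complex_nonpos_Reals_iff)
      ultimately show "H (mk t (rpart W)) / cnj k \<notin> \<real>\<^sub>\<le>\<^sub>0" using nonpos[OF parts(2)[OF W]] by metis
    qed (use k in auto)
    have 2: "Ln (H (mk t (rpart W)) / cnj k) = f2 (rpart W)" if W: "W \<in> ?R" for W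
    proof -
      have "H (mk t (rpart W)) / cnj k = cnj (K (cnj_vec (rpart W)) t / k)" using K_cnj[OF t, of "cnj_vec (rpart W)"] pos[OF parts(2)[OF W]] by simp
      then show ?thesis unfolding f2_def by (simp only: cnj_Ln[OF nonpos[OF parts(2)[OF W]]])
    qed
    show ?thesis by (rule iffD1[OF holo_on_cong[OF open_polydisc 2] 1])
  qed
  have hh: "holo_on ?R h"
    unfolding h_def by (intro holo_on_diff holo_on_add holo_on_const hf1 hf2 holo_on_subset[OF hL \<rho>(3)])
  have "diastasis K t z = h (mk z (cnj_vec z))" if z: "z \<in> polydisc p \<rho>" for z
  proof -
    have z\<Omega>: "z \<in> \<Omega>" using pos[OF z] by blast
    have Kz: "K z t / k \<noteq> 0" using pos[OF z] by auto
    have "h (mk z (cnj_vec z)) = Ln (K z z) + C - (Ln (K z t / k) + cnj (Ln (K z t / k)))"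
      by (simp add: h_def f1_def f2_def L_def)
    also have "Ln (K z t / k) + cnj (Ln (K z t / k)) = of_real (2 * ln (cmod (K z t / k)))"
      using Kz by (simp add: complex_add_cnj)
    also have "Ln (K z z) = of_real (ln (Re (K z z)))" using K_pos[OF z\<Omega>] by (metis Ln_of_real)
    also have "of_real (ln (Re (K z z))) + C - of_real (2 * ln (cmod (K z t / k)))
      = of_real (ln (Re (K z z)) + ln (Re (K t t)) - 2 * ln (cmod (K z t)))"
      using Kz k by (simp add: C_def norm_divide ln_div)
    also have "\<dots> = diastasis K t z"
      using Kz K_pos(2)[OF z\<Omega>] K_pos(2)[OF t] by (simp add: diastasis_def ln_div ln_mult ln_realpow)
    finally show ?thesis by simp
  qed
  from diag(1)[OF hh pR this]
  have "wz a (diastasis K t) p = pd (Inl a) h (mk p q)" by simp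
  also have "\<dots> = pd (Inl a) L (mk p q) - pd (Inl a) (\<lambda>W. f1 (lpart W)) (mk p q) - pd (Inl a) (\<lambda>W. f2 (rpart W)) (mk p q)"
  proof -
    have R: "mk p q \<in> ?R" using \<rho>(1) by simp
    have hLR: "holo_on ?R L" by (rule holo_on_subset[OF hL \<rho>(3)])
    show ?thesis unfolding h_def
      by (subst pd_diff[OF _ _ R] pd_add[OF _ _ R]; (intro holo_on_diff holo_on_add holo_on_const hf1 hf2 hLR)?)+ simp
  qed
  also have "pd (Inl a) (\<lambda>W. f2 (rpart W)) (mk p q) = 0" by (rule pd_lp_rp(2))
  also have "pd (Inl a) (\<lambda>W. f1 (lpart W)) (mk p q) = pd a (\<lambda>z. K z t) p / k"
  proof -
    have "pd (Inl a) (\<lambda>W. f1 (lpart W)) (mk p q) = pd a (\<lambda>z. Ln (K z t / k)) p" by (simp add: pd_mk f1_def)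
    also have "\<dots> = 1 / k * pd a (\<lambda>z. K z t) p"
      by (rule pd_comp[where g = "\<lambda>w. Ln (w / k)", OF K_holo[OF t] p])
        (use k in \<open>auto intro!: derivative_eq_intros simp: k_def[symmetric]\<close>)
    finally show ?thesis by simp
  qed
  also have "pd a (\<lambda>z. K z t) p = cnj (pd (Inr a) H (mk t q))"
  proof -
    have "pd a (\<lambda>z. K z t) p = pd (Inl a) H (mk p (cnj_vec t))" by (simp add: pd_mk)
    also have "\<dots> = cnj (pd (Inr a) H (swap_cnj (mk p (cnj_vec t))))"
      by (rule pd_sg(1)[OF open_D _ holo_H _ H_sg]) (use p t in auto)
    finally show ?thesis by simp
  qed
  also have "pd (Inl a) L (mk p q) = cnj (pd (Inr a) L (mk p q))"
  proof -
    have "pd (Inl a) L (mk p q) = cnj (pd (Inr a) L (swap_cnj (mk p q)))"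
      by (rule pd_sg(1)[OF opP centre_P hL _ L_sg]) (use centre_P in auto)
    then show ?thesis by simp
  qed
  finally show ?thesis using K_cnj[OF p t] by (simp add: v_eq[OF t] k_def)
qed

text \<open>Hence the gradient bound of the theorem is \<open>Q_lt\<close> at the point t.\<close>

lemma dPhi_eq: assumes "t \<in> \<Omega>" shows "dPhi_normsq K t p = Q t t"
  by (simp add: dPhi_normsq_def wz_diastasis[OF assms] binv_p Q_def B_def mult_ac)

lemma holo_rep: "holo_on \<Omega> (rep_coord K p a)"
proof -
  have "\<Omega>1 = \<Omega>" using K_nz by (auto simp: \<Omega>1_def)
  then have "holo_on \<Omega> (\<lambda>z. \<Sum>j\<in>UNIV. gi j a (mk p q) * v j z)"
    using holo_v by (intro holo_on_sum holo_on_mult holo_on_const) simp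
  then show ?thesis by (simp add: rep_coord_eq[abs_def])
qed

end

theorem theorem1p2:
  fixes \<Omega> :: "(complex^'n::finite) set"
    and K :: "complex^'n \<Rightarrow> complex^'n \<Rightarrow> complex"
    and c :: real
  assumes "bounded_domain \<Omega>"
    and "is_bergman_kernel \<Omega> K"
    and "c \<noteq> 0"
    and "\<forall>z\<in>\<Omega>. \<forall>\<xi>::complex^'n. \<xi> \<noteq> 0 \<longrightarrow> hsc K z \<xi> = - complex_of_real (c^2)"
    and "p \<in> \<Omega>"
  shows "(\<forall>z\<in>\<Omega>. K z p \<noteq> 0)
    \<and> (\<forall>a. holo_on \<Omega> (rep_coord K p a))
    \<and> (\<forall>z\<in>\<Omega>. rep_quad K p z \<in> \<real> \<and> Re (rep_quad K p z) < 2 / c^2)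
    \<and> (\<forall>z\<in>\<Omega>. diastasis K p z
           = complex_of_real (-2 / c^2) * Ln (1 - complex_of_real (c^2 / 2) * rep_quad K p z))
    \<and> (\<forall>z0\<in>\<Omega>. dPhi_normsq K z0 p \<in> \<real> \<and> Re (dPhi_normsq K z0 p) < 2 / c^2)"
proof -
  interpret bergman_const \<Omega> K c p
    by unfold_locales (use assms in auto)
  have "Q z z \<in> \<real>" for z by (metis Q_real Reals_of_real)
  then show ?thesis
    using K_nz holo_rep rep_quad_eq Q_lt diastasis_eq dPhi_eq by simp
qed

end
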